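(* Let $1/n\ll c\ll\mu\ll1$ and let $t_1,t_2\in\mathbb N$ satisfy $t_1+t_2=n$ and $t_1\ge(2-\mu)t_2$. If $G$ is a red/blue coloured complete graph with $\max\{t_1+2t_2,2t_1\}-1$ vertices which is Type II $(\mu,t_1,t_2)$-extremal, then $G$ contains a monochromatic copy of every $n$-vertex tree $T$ with $\Delta(T)\le cn$ whose bipartition classes have sizes $t_1$ and $t_2$.
   Context: Hierarchy notation "$1/n\ll c\ll\mu\ll1$": each parameter is chosen sufficiently small in terms of those to its right. For a red/blue coloured graph, $d_{\mathrm{red}}(u,S)$, $d_{\mathrm{blue}}(u,S)$ denote numbers of red/blue neighbours of $u$ in $S$. With $n=t_1+t_2$, a red/blue coloured complete graph $G$ is Type II $(\mu,t_1,t_2)$-extremal if there are disjoint $U_1,U_2\subseteq V(G)$ with $|U_1|,|U_2|\ge(1-\mu)t_1$ and, for each $i\in[2]$ and $u\in U_i$, $d_{\mathrm{red}}(u,U_i)\le\mu n$ and $d_{\mathrm{blue}}(u,U_{3-i})\le\mu n$; or the same holds with red and blue swapped. *)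

theory Defs
  imports Complex_Main "HOL-Library.Ramsey"
begin

text \<open>
  Finite simple graphs, given by a vertex set and a set of two-element edges.  The predicate
  \<open>tree\<close> of the session \<open>Graph_Theory\<close> is not suitable here: it concerns digraphs, and an
  undirected edge, read as a pair of opposite arcs, already forms a directed cycle of length two.
\<close>

definition fin_graph :: "'a set \<Rightarrow> 'a set set \<Rightarrow> bool" where
  "fin_graph V E \<longleftrightarrow> finite V \<and> E \<subseteq> [V]\<^bsup>2\<^esup>"

definition connected_graph :: "'a set \<Rightarrow> 'a set set \<Rightarrow> bool" where
  "connected_graph V E \<longleftrightarrow>
     V \<noteq> {} \<and> (\<forall>u\<in>V. \<forall>v\<in>V. (u, v) \<in> {(x, y). {x, y} \<in> E}\<^sup>*)"

text \<open>The list gives the vertices in cyclic order, the first one not repeated at the end.\<close>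

definition is_cycle :: "'a set set \<Rightarrow> 'a list \<Rightarrow> bool" where
  "is_cycle E xs \<longleftrightarrow> 3 \<le> length xs \<and> distinct xs \<and>
     (\<forall>i<length xs. {xs ! i, xs ! (Suc i mod length xs)} \<in> E)"

definition tree :: "'a set \<Rightarrow> 'a set set \<Rightarrow> bool" where
  "tree V E \<longleftrightarrow> fin_graph V E \<and> connected_graph V E \<and> (\<nexists>xs. is_cycle E xs)"

definition degree :: "'a set set \<Rightarrow> 'a \<Rightarrow> nat" where
  "degree E v = card {e \<in> E. v \<in> e}"

definition max_degree :: "'a set \<Rightarrow> 'a set set \<Rightarrow> nat" where
  "max_degree V E = Max (degree E ` V)"

definition bipartition :: "'a set \<Rightarrow> 'a set set \<Rightarrow> 'a set \<Rightarrow> 'a set \<Rightarrow> bool" where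
  "bipartition V E A B \<longleftrightarrow> A \<union> B = V \<and> A \<inter> B = {} \<and>
     (\<forall>e\<in>E. \<exists>a\<in>A. \<exists>b\<in>B. e = {a, b})"

text \<open>
  A red/blue coloured complete graph is a finite vertex set \<open>V\<close> together with a function \<open>col\<close>,
  of which only the values on the two-element subsets of \<open>V\<close> (the edges) matter.
\<close>

datatype colour = Red | Blue

definition col_degree :: "('a set \<Rightarrow> colour) \<Rightarrow> colour \<Rightarrow> 'a \<Rightarrow> 'a set \<Rightarrow> nat" where
  "col_degree col k u S = card {v \<in> S. v \<noteq> u \<and> col {u, v} = k}"

text \<open>
  With \<open>k = Red\<close>, \<open>k' = Blue\<close> this is the condition on \<open>U\<^sub>1\<close>, \<open>U\<^sub>2\<close> as displayed; both size bounds
  involve \<open>t\<^sub>1\<close>.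
\<close>

definition typeII_witness ::
  "real \<Rightarrow> nat \<Rightarrow> nat \<Rightarrow> 'a set \<Rightarrow> ('a set \<Rightarrow> colour) \<Rightarrow> colour \<Rightarrow> colour \<Rightarrow> 'a set \<Rightarrow> 'a set \<Rightarrow> bool"
where
  "typeII_witness \<mu> t\<^sub>1 t\<^sub>2 V col k k' U\<^sub>1 U\<^sub>2 \<longleftrightarrow>
     U\<^sub>1 \<subseteq> V \<and> U\<^sub>2 \<subseteq> V \<and> U\<^sub>1 \<inter> U\<^sub>2 = {} \<and>
     real (card U\<^sub>1) \<ge> (1 - \<mu>) * real t\<^sub>1 \<and> real (card U\<^sub>2) \<ge> (1 - \<mu>) * real t\<^sub>1 \<and>
     (\<forall>u\<in>U\<^sub>1. real (col_degree col k u U\<^sub>1) \<le> \<mu> * real (t\<^sub>1 + t\<^sub>2) \<and>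
             real (col_degree col k' u U\<^sub>2) \<le> \<mu> * real (t\<^sub>1 + t\<^sub>2)) \<and>
     (\<forall>u\<in>U\<^sub>2. real (col_degree col k u U\<^sub>2) \<le> \<mu> * real (t\<^sub>1 + t\<^sub>2) \<and>
             real (col_degree col k' u U\<^sub>1) \<le> \<mu> * real (t\<^sub>1 + t\<^sub>2))"

definition typeII_extremal ::
  "real \<Rightarrow> nat \<Rightarrow> nat \<Rightarrow> 'a set \<Rightarrow> ('a set \<Rightarrow> colour) \<Rightarrow> bool"
where
  "typeII_extremal \<mu> t\<^sub>1 t\<^sub>2 V col \<longleftrightarrow>
     (\<exists>U\<^sub>1 U\<^sub>2. typeII_witness \<mu> t\<^sub>1 t\<^sub>2 V col Red Blue U\<^sub>1 U\<^sub>2) \<or>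
     (\<exists>U\<^sub>1 U\<^sub>2. typeII_witness \<mu> t\<^sub>1 t\<^sub>2 V col Blue Red U\<^sub>1 U\<^sub>2)"

definition has_mono_copy ::
  "'a set \<Rightarrow> ('a set \<Rightarrow> colour) \<Rightarrow> 'b set \<Rightarrow> 'b set set \<Rightarrow> bool"
where
  "has_mono_copy V col VT ET \<longleftrightarrow>
     (\<exists>k f. inj_on f VT \<and> f ` VT \<subseteq> V \<and> (\<forall>e\<in>ET. col (f ` e) = k))"

end

theory Submission
  imports Defs
begin

text \<open>Call the colour dominating between \<open>U1\<close> and \<open>U2\<close> red. A red copy would put the class \<open>A\<close>
  of size \<open>t1\<close> essentially on \<open>U1\<close> and \<open>B\<close> on \<open>U2\<close>; since \<open>V\<close> may have only \<open>2 * t1 - 1\<close> vertices,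
  the side receiving \<open>A\<close> has to be used up completely. A blue copy would split the tree at one or
  two vertices into parts of order at most about \<open>2 * n / 3\<close>, one in each \<open>Ui\<close>; the cut
  vertices must be sent to vertices with some blue neighbours on both sides.

  The two options are played off against each other by the least size \<open>m\<close> of a set \<open>H \<subseteq> B\<close>
  dominating 99 percent of \<open>A\<close>. If a vertex has fewer than \<open>m\<close> blue neighbours among the images of
  \<open>B\<close>, then a positive proportion of \<open>A\<close> has only red images as neighbours, so the vertex can be
  exchanged with the image of one of these, and leaf by leaf a partial red copy is completed.
  Conversely the branches meeting \<open>H\<close> (or \<open>H\<close> minus three vertices) carry almost all of \<open>A\<close>, so
  that a balanced split can be made by cutting fewer than \<open>m\<close> edges, and two suitable vertices with
  \<open>m\<close> blue neighbours on the other side yield a blue copy.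

  If all but boundedly many vertices have few blue neighbours across, the remaining ones receive
  leaves whose parents are placed beforehand. The only obstruction is a single vertex that is blue
  to almost everything, together with two sides of size exactly \<open>t1 - 1\<close>; then a single
  additional red edge gives a red copy, and without such an edge both sides are blue cliques.\<close>

section \<open>Rooted trees and greedy embedding\<close>

text \<open>The comparison with \<open>m\<close> leaves a gap: vertices with at least
  \<open>\<kappa>\<close> but fewer than \<open>K\<close> (about \<open>n/400\<close>) blue
  neighbours in each of the two sides. There may be many of them; each is too blue for the exchange
  argument to apply to it individually, and not blue enough to be the image of a cut vertex. An
  average over the edges of the tree shows that at most a third of them is unusable for any
  placement of \<open>B\<close> which avoids a small set of exceptional vertices. They may be used
  by \<open>A\<close> whichever side receives it, so in the final count they appear twice, and
  losing a third on each side is affordable.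

  The vertices with at least \<open>K\<close> blue neighbours in one side and at least
  \<open>\<kappa>\<close> in the other are at most 3000 in number, because two of them with a common
  blue neighbour in the first side would give a blue copy. Being so few, they can be served by
  leaves reserved in advance.

  All thresholds are fixed numbers. The slack comes from \<open>n/3\<close>: the class
  \<open>B\<close> and either part of a balanced split are smaller than a side by a constant
  fraction of \<open>n\<close>, and only \<open>A\<close> has to fit exactly.\<close>

locale rooted_tree =
  fixes V :: "'b set" and r :: 'b and par :: "'b \<Rightarrow> 'b" and rk :: "'b \<Rightarrow> nat"
  assumes fin: "finite V" and root: "r \<in> V"
    and par_in: "\<And>v. v \<in> V \<Longrightarrow> v \<noteq> r \<Longrightarrow> par v \<in> V"
    and par_rk: "\<And>v. v \<in> V \<Longrightarrow> v \<noteq> r \<Longrightarrow> rk (par v) < rk v"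
    and rk_inj: "inj_on rk V"
begin

inductive_set desc :: "'b \<Rightarrow> 'b set" for y where
  desc_self: "y \<in> V \<Longrightarrow> y \<in> desc y"
| desc_step: "v \<in> V \<Longrightarrow> v \<noteq> r \<Longrightarrow> par v \<in> desc y \<Longrightarrow> v \<in> desc y"

definition children :: "'b \<Rightarrow> 'b set" where
  "children y = {z \<in> V. z \<noteq> r \<and> par z = y}"

definition edges :: "'b set set" where
  "edges = (\<lambda>v. {v, par v}) ` (V - {r})"

lemma desc_subset: "desc y \<subseteq> V"
proof
  fix v assume "v \<in> desc y" then show "v \<in> V" by cases auto
qed

lemma finite_desc: "finite (desc y)"
  using desc_subset fin finite_subset by blast

lemma desc_par: "v \<in> desc y \<Longrightarrow> v \<noteq> y \<Longrightarrow> v \<noteq> r \<and> par v \<in> desc y"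
  by (auto elim: desc.cases)

lemma desc_rk: "v \<in> desc y \<Longrightarrow> rk y \<le> rk v"
proof (induction rule: desc.induct)
  case (desc_step v)
  then show ?case using par_rk[of v] by simp
qed simp

lemma desc_root: "desc r = V"
proof
  show "V \<subseteq> desc r"
  proof
    fix v assume "v \<in> V"
    then show "v \<in> desc r"
    proof (induction "rk v" arbitrary: v rule: less_induct)
      case less
      show ?case
      proof (cases "v = r")
        case True then show ?thesis using root desc_self by simp
      next
        case False
        then show ?thesis using less par_in par_rk desc_step by blast
      qed
    qed
  qed
qed (rule desc_subset)

lemma children_subset: "children y \<subseteq> V"
  by (auto simp: children_def)

lemma finite_children: "finite (children y)"
  using children_subset fin finite_subset by blast

lemma children_rk: "z \<in> children y \<Longrightarrow> rk y < rk z"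
  using par_rk by (auto simp: children_def)

lemma not_desc_child: "z \<in> children y \<Longrightarrow> y \<notin> desc z"
  using children_rk desc_rk by fastforce

lemma child_in_desc: "z \<in> children y \<Longrightarrow> y \<in> V \<Longrightarrow> z \<in> desc y"
  by (auto simp: children_def intro: desc_step desc_self)

lemma desc_trans: "v \<in> desc z \<Longrightarrow> z \<in> desc y \<Longrightarrow> v \<in> desc y"
  by (induction rule: desc.induct) (auto intro: desc_step)

lemma desc_siblings_disjoint:
  assumes "z \<in> children y" "z' \<in> children y" "z \<noteq> z'"
  shows "desc z \<inter> desc z' = {}"
proof -
  have "u \<notin> desc z'" if "u \<in> desc z" for u
    using that
  proof (induction rule: desc.induct)
    case desc_self
    show ?case
      using desc_par[of z z'] assms not_desc_child[of z' y] by (auto simp: children_def)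
  next
    case (desc_step v)
    then show ?case
      using desc_par[of v z'] assms not_desc_child[of z y]
      by (cases "v = z'") (auto simp: children_def)
  qed
  then show ?thesis by blast
qed

lemma desc_decomp:
  assumes "y \<in> V"
  shows "desc y = insert y (\<Union>z\<in>children y. desc z)"
proof
  show "desc y \<subseteq> insert y (\<Union>z\<in>children y. desc z)"
  proof
    fix v assume "v \<in> desc y"
    then show "v \<in> insert y (\<Union>z\<in>children y. desc z)"
    proof (induction rule: desc.induct)
      case (desc_step v)
      then show ?case
        by (cases "par v = y") (auto simp: children_def intro: desc.intros)
    qed simp
  qed
  show "insert y (\<Union>z\<in>children y. desc z) \<subseteq> desc y"
    using assms child_in_desc desc_trans desc_self by blast
qed

lemma lowest:
  assumes "y0 \<in> V" "P y0"
  obtains y where "y \<in> desc y0" "P y" "\<And>z. z \<in> children y \<Longrightarrow> \<not> P z"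
proof -
  have "finite (rk ` {y \<in> desc y0. P y})" using finite_desc by auto
  moreover have "rk ` {y \<in> desc y0. P y} \<noteq> {}" using assms desc_self by auto
  ultimately have "Max (rk ` {y \<in> desc y0. P y}) \<in> rk ` {y \<in> desc y0. P y}" by (rule Max_in)
  then obtain y where y: "y \<in> desc y0" "P y" "rk y = Max (rk ` {y \<in> desc y0. P y})" by auto
  have "\<not> P z" if z: "z \<in> children y" for z
  proof
    assume "P z"
    moreover have "z \<in> desc y0" using z y child_in_desc desc_trans desc_subset by blast
    ultimately have "rk z \<le> rk y" using y(3) finite_desc by simp
    then show False using children_rk[OF z] by simp
  qed
  with y that show ?thesis by blast
qed

lemma edge_cases:
  assumes "{u, v} \<in> edges"
  shows "u \<in> V" "v \<in> V" "(u \<noteq> r \<and> par u = v) \<or> (v \<noteq> r \<and> par v = u)"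
proof -
  obtain w where w: "w \<in> V" "w \<noteq> r" "{u, v} = {w, par w}" using assms by (auto simp: edges_def)
  then have "par w \<in> V" using par_in by blast
  with w show "u \<in> V" "v \<in> V" "(u \<noteq> r \<and> par u = v) \<or> (v \<noteq> r \<and> par v = u)"
    by (auto simp: doubleton_eq_iff)
qed

lemma child_edge: "z \<in> children y \<Longrightarrow> {z, y} \<in> edges"
  by (auto simp: children_def edges_def)

lemma degree_children: "card (children y) \<le> degree edges y"
proof -
  have "inj_on (\<lambda>z. {z, y}) (children y)"
    by (auto simp: inj_on_def doubleton_eq_iff)
  moreover have "(\<lambda>z. {z, y}) ` children y \<subseteq> {e \<in> edges. y \<in> e}" using child_edge by auto
  moreover have "finite edges" using fin by (auto simp: edges_def)
  ultimately show ?thesis unfolding degree_def by (intro card_inj_on_le) auto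
qed

text \<open>Vertices are placed in the order of \<open>rk\<close>, so a parent comes before its
  children, and a free value exists while the candidates outnumber the competitors. If the parent is
  preassigned, \<open>pre1\<close> makes all of \<open>\<Gamma> t\<close> admissible; hence the
  weaker condition \<open>start\<close>, which permits target sets of exactly the required size. A
  preassigned child of a vertex that is not preassigned is covered by \<open>pre2\<close>.\<close>

lemma greedy_embedding:
  fixes \<Gamma> :: "'b \<Rightarrow> 'a set" and \<phi> :: "'b \<Rightarrow> 'a" and adj :: "'a \<Rightarrow> 'a \<Rightarrow> bool"
  assumes S: "S \<subseteq> V" "inj_on \<phi> S"
    and avoid: "\<And>t s. t \<in> V - S \<Longrightarrow> s \<in> S \<Longrightarrow> \<phi> s \<notin> \<Gamma> t"
    and start: "\<And>t. t \<in> V - S \<Longrightarrow> t = r \<or> par t \<in> S \<Longrightarrow>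
        card {s \<in> V - S. s \<noteq> t \<and> \<Gamma> s \<inter> \<Gamma> t \<noteq> {}} < card (\<Gamma> t)"
    and step: "\<And>t p. t \<in> V - S \<Longrightarrow> t \<noteq> r \<Longrightarrow> par t \<notin> S \<Longrightarrow> p \<in> \<Gamma> (par t) \<Longrightarrow>
        card {s \<in> V - S. s \<noteq> t \<and> \<Gamma> s \<inter> \<Gamma> t \<noteq> {}} < card {q \<in> \<Gamma> t. adj p q}"
    and pre1: "\<And>t q. t \<in> V - S \<Longrightarrow> t \<noteq> r \<Longrightarrow> par t \<in> S \<Longrightarrow> q \<in> \<Gamma> t \<Longrightarrow> adj (\<phi> (par t)) q"
    and pre2: "\<And>t p. t \<in> S \<Longrightarrow> t \<noteq> r \<Longrightarrow> par t \<notin> S \<Longrightarrow> p \<in> \<Gamma> (par t) \<Longrightarrow> adj p (\<phi> t)"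
    and pre3: "\<And>t. t \<in> S \<Longrightarrow> t \<noteq> r \<Longrightarrow> par t \<in> S \<Longrightarrow> adj (\<phi> (par t)) (\<phi> t)"
  obtains f where "inj_on f V" "\<And>t. t \<in> S \<Longrightarrow> f t = \<phi> t" "\<And>t. t \<in> V - S \<Longrightarrow> f t \<in> \<Gamma> t"
    "\<And>t. t \<in> V \<Longrightarrow> t \<noteq> r \<Longrightarrow> adj (f (par t)) (f t)"
proof -
  define L where "L m = {t \<in> V - S. rk t < m}" for m
  have "\<exists>f. inj_on f (S \<union> L m) \<and> (\<forall>t\<in>S. f t = \<phi> t) \<and> (\<forall>t\<in>L m. f t \<in> \<Gamma> t) \<and>
          (\<forall>t\<in>L m. t \<noteq> r \<longrightarrow> adj (f (par t)) (f t))" for m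
  proof (induction m)
    case 0
    then show ?case using S by (intro exI[of _ \<phi>]) (auto simp: L_def)
  next
    case (Suc m)
    then obtain f where f: "inj_on f (S \<union> L m)" "\<forall>t\<in>S. f t = \<phi> t" "\<forall>t\<in>L m. f t \<in> \<Gamma> t"
      "\<forall>t\<in>L m. t \<noteq> r \<longrightarrow> adj (f (par t)) (f t)" by blast
    show ?case
    proof (cases "\<exists>t\<in>V - S. rk t = m")
      case False
      then have "L (Suc m) = L m" by (auto simp: L_def less_Suc_eq)
      with f show ?thesis by auto
    next
      case True
      then obtain t where t: "t \<in> V - S" "rk t = m" by blast
      have L: "L (Suc m) = insert t (L m)"
        using t inj_onD[OF rk_inj] by (auto simp: L_def less_Suc_eq)
      have tL: "t \<notin> L m" using t by (simp add: L_def)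
      define C where "C = (if t = r \<or> par t \<in> S then \<Gamma> t else {q \<in> \<Gamma> t. adj (f (par t)) q})"
      define X where "X = {s \<in> V - S. s \<noteq> t \<and> \<Gamma> s \<inter> \<Gamma> t \<noteq> {}}"
      have parL: "par t \<in> L m" if "t \<noteq> r" "par t \<notin> S"
        using that t par_in par_rk by (auto simp: L_def)
      have cC: "card X < card C"
        using start[OF t(1)] step[OF t(1)] parL f(3) by (auto simp: C_def X_def)
      have "finite X" using fin by (auto simp: X_def)
      then have "card (f ` X) < card C" using card_image_le[of X f] cC by linarith
      moreover have "finite (f ` X)" using \<open>finite X\<close> by simp
      ultimately obtain q where q: "q \<in> C" "q \<notin> f ` X"
        by (meson card_mono leD subsetI)
      have q\<Gamma>: "q \<in> \<Gamma> t" using q by (auto simp: C_def split: if_splits)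
      have qnew: "q \<notin> f ` (S \<union> L m)"
      proof
        assume "q \<in> f ` (S \<union> L m)"
        then obtain s where s: "s \<in> S \<union> L m" "q = f s" by blast
        show False
        proof (cases "s \<in> S")
          case True
          then show False using avoid[OF t(1) True] f(2) s q\<Gamma> by auto
        next
          case False
          then have "s \<in> L m" using s by auto
          then have "s \<in> X" using f(3) s q\<Gamma> tL by (auto simp: X_def L_def)
          then show False using q s by blast
        qed
      qed
      define g where "g = f(t := q)"
      have gf: "\<And>s. s \<in> S \<union> L m \<Longrightarrow> g s = f s" using tL t by (auto simp: g_def)
      have 1: "inj_on g (S \<union> L (Suc m))"
      proof -
        have "inj_on g (S \<union> L m)" using f(1) gf inj_on_cong by metis
        moreover have "g t \<notin> g ` (S \<union> L m)" using qnew gf by (auto simp: g_def)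
        ultimately show ?thesis using tL t by (simp add: L inj_on_insert)
      qed
      have 2: "\<forall>t\<in>S. g t = \<phi> t" using f(2) gf by auto
      have 3: "\<forall>t\<in>L (Suc m). g t \<in> \<Gamma> t" using f(3) gf L q\<Gamma> by (auto simp: g_def)
      have 4: "adj (g (par s)) (g s)" if s: "s \<in> L (Suc m)" "s \<noteq> r" for s
      proof (cases "s = t")
        case True
        show ?thesis
        proof (cases "par t \<in> S")
          case True
          then show ?thesis using \<open>s = t\<close> pre1[OF t(1) _ True q\<Gamma>] 2 s by (simp add: g_def)
        next
          case False
          then have "g (par t) = f (par t)" using parL s True gf by auto
          then show ?thesis using True q False s by (simp add: g_def C_def)
        qed
      next
        case False
        then have sL: "s \<in> L m" using s L by auto
        then have "rk (par s) < m" "par s \<in> V" using par_rk[of s] par_in[of s] s by (auto simp: L_def)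
        then have "par s \<in> S \<union> L m" by (auto simp: L_def)
        then show ?thesis using f(4) sL s gf by auto
      qed
      show ?thesis using 1 2 3 4 by blast
    qed
  qed
  from this[of "Suc (Max (rk ` V))"] obtain f where
    f: "inj_on f (S \<union> L (Suc (Max (rk ` V))))" "\<forall>t\<in>S. f t = \<phi> t"
      "\<forall>t\<in>L (Suc (Max (rk ` V))). f t \<in> \<Gamma> t"
      "\<forall>t\<in>L (Suc (Max (rk ` V))). t \<noteq> r \<longrightarrow> adj (f (par t)) (f t)" by blast
  have L: "L (Suc (Max (rk ` V))) = V - S"
    using fin by (auto simp: L_def less_Suc_eq_le)
  have "adj (f (par t)) (f t)" if t: "t \<in> V" "t \<noteq> r" for t
  proof (cases "t \<in> S")
    case False
    then show ?thesis using f(4) t L by auto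
  next
    case True
    show ?thesis
    proof (cases "par t \<in> S")
      case True
      then show ?thesis using pre3[OF \<open>t \<in> S\<close>] t f(2) \<open>t \<in> S\<close> by auto
    next
      case False
      then have "f (par t) \<in> \<Gamma> (par t)" using f(3) L par_in t by auto
      then show ?thesis using pre2[OF \<open>t \<in> S\<close> _ False] t f(2) \<open>t \<in> S\<close> by auto
    qed
  qed
  moreover have "S \<union> (V - S) = V" using S by auto
  ultimately show ?thesis using that f L by metis
qed

end

section \<open>Rooting an arbitrary tree\<close>

lemma simple_path:
  assumes "(x, y) \<in> {(u, v). u \<in> S \<and> v \<in> S \<and> {u, v} \<in> E}\<^sup>*" "x \<in> S"
  shows "\<exists>p. p \<noteq> [] \<and> hd p = x \<and> last p = y \<and> distinct p \<and> set p \<subseteq> S \<and>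
    (\<forall>i. Suc i < length p \<longrightarrow> {p ! i, p ! Suc i} \<in> E)"
  using assms(1)
proof (induction rule: rtrancl_induct)
  case base
  then show ?case using assms(2) by (intro exI[of _ "[x]"]) auto
next
  case (step y z)
  then obtain p where p: "p \<noteq> []" "hd p = x" "last p = y" "distinct p" "set p \<subseteq> S"
    "\<forall>i. Suc i < length p \<longrightarrow> {p ! i, p ! Suc i} \<in> E" by blast
  show ?case
  proof (cases "z \<in> set p")
    case True
    then obtain j where j: "j < length p" "p ! j = z" by (auto simp: in_set_conv_nth)
    have "last (take (Suc j) p) = z" using j by (simp add: take_Suc_conv_app_nth)
    then show ?thesis using p j set_take_subset[of "Suc j" p]
      by (intro exI[of _ "take (Suc j) p"]) (auto simp: hd_take)
  next
    case False
    have "{(p @ [z]) ! i, (p @ [z]) ! Suc i} \<in> E" if "Suc i < length (p @ [z])" for i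
    proof (cases "Suc i = length p")
      case True
      then have "p ! i = y" using p(1,3) last_conv_nth[of p] by (metis diff_Suc_1)
      then show ?thesis using True step(2) by (auto simp: nth_append)
    next
      case False
      then show ?thesis using that p(6) by (auto simp: nth_append)
    qed
    then show ?thesis using p False step(2) by (intro exI[of _ "p @ [z]"]) auto
  qed
qed

text \<open>The rooted part grows by one vertex at a time, its parent edges being exactly the edges
  induced on it. Connectedness supplies an edge leaving it. The outer end has no second neighbour
  inside, since a path between the two neighbours would close a cycle.\<close>

lemma tree_rooting:
  assumes T: "tree V E" and r: "r \<in> V"
  obtains par rk where "rooted_tree V r par rk" "rooted_tree.edges V r par = E"
proof -
  have finV: "finite V" and E2: "\<And>e. e \<in> E \<Longrightarrow> e \<subseteq> V \<and> card e = 2"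
    and conn: "\<And>u v. u \<in> V \<Longrightarrow> v \<in> V \<Longrightarrow> (u, v) \<in> {(x, y). {x, y} \<in> E}\<^sup>*"
    and acyc: "\<And>xs. \<not> is_cycle E xs"
    using T by (auto simp: tree_def fin_graph_def connected_graph_def nsets_def)
  have "\<exists>S par rk. S \<subseteq> V \<and> card S = Suc m \<and> rooted_tree S r par rk \<and>
      (\<lambda>v. {v, par v}) ` (S - {r}) = {e \<in> E. e \<subseteq> S}" if "Suc m \<le> card V" for m
    using that
  proof (induction m)
    case 0
    have "{e \<in> E. e \<subseteq> {r}} = {}"
    proof -
      have "\<not> e \<subseteq> {r}" if "e \<in> E" for e
        using E2[OF that] card_mono[of "{r}" e] by auto
      then show ?thesis by auto
    qed
    then show ?case using r
      by (intro exI[of _ "{r}"] exI[of _ id] exI[of _ "\<lambda>_. 0"]) (auto simp: rooted_tree_def)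
  next
    case (Suc m)
    then obtain S par rk where S: "S \<subseteq> V" "card S = Suc m" "rooted_tree S r par rk"
      "(\<lambda>v. {v, par v}) ` (S - {r}) = {e \<in> E. e \<subseteq> S}" by auto
    interpret S: rooted_tree S r par rk by fact
    obtain v0 where v0: "v0 \<in> V" "v0 \<notin> S"
      using S(1,2) Suc.prems by (metis Suc_n_not_le_n subsetI subset_antisym)
    have "\<exists>s v. s \<in> S \<and> v \<notin> S \<and> {s, v} \<in> E"
    proof (rule ccontr)
      assume n: "\<not> ?thesis"
      have "(r, v) \<in> {(x, y). {x, y} \<in> E}\<^sup>* \<Longrightarrow> v \<in> S" for v
        by (induction rule: rtrancl_induct) (use n S.root in auto)
      then show False using conn[OF r v0(1)] v0 by blast
    qed
    then obtain s v where sv: "s \<in> S" "v \<notin> S" "{s, v} \<in> E" by blast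
    have vV: "v \<in> V" using E2[OF sv(3)] by auto
    have toroot: "(u, r) \<in> {(x, y). x \<in> S \<and> y \<in> S \<and> {x, y} \<in> E}\<^sup>*" if "u \<in> S" for u
      using that
    proof (induction "rk u" arbitrary: u rule: less_induct)
      case less
      show ?case
      proof (cases "u = r")
        case False
        then have "{u, par u} \<in> E" using S(4) less.prems by auto
        moreover have "(par u, r) \<in> {(x, y). x \<in> S \<and> y \<in> S \<and> {x, y} \<in> E}\<^sup>*"
          using less False S.par_in S.par_rk by auto
        ultimately show ?thesis using less.prems False S.par_in
          by (intro converse_rtrancl_into_rtrancl[of u "par u"]) auto
      qed simp
    qed
    have uniq: "s' = s" if s': "s' \<in> S" "{s', v} \<in> E" for s'
    proof (rule ccontr)
      assume ne: "s' \<noteq> s"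
      have "sym {(x, y). x \<in> S \<and> y \<in> S \<and> {x, y} \<in> E}"
        by (auto simp: sym_def insert_commute)
      then have "(r, s') \<in> {(x, y). x \<in> S \<and> y \<in> S \<and> {x, y} \<in> E}\<^sup>*"
        using toroot[OF s'(1)] by (meson sym_rtrancl symD)
      then have "(s, s') \<in> {(x, y). x \<in> S \<and> y \<in> S \<and> {x, y} \<in> E}\<^sup>*"
        using toroot[OF sv(1)] by (meson rtrancl_trans)
      from simple_path[OF this sv(1)] obtain p where p: "p \<noteq> []" "hd p = s" "last p = s'"
        "distinct p" "set p \<subseteq> S" "\<forall>i. Suc i < length p \<longrightarrow> {p ! i, p ! Suc i} \<in> E" by blast
      have len: "2 \<le> length p"
      proof (rule ccontr)
        assume "\<not> 2 \<le> length p"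
        then have "length p = Suc 0" using p(1) length_greater_0_conv[of p] by linarith
        then obtain z where "p = [z]" by (auto simp: length_Suc_conv)
        then show False using p ne by simp
      qed
      have "is_cycle E (p @ [v])"
        unfolding is_cycle_def
      proof (intro conjI allI impI)
        fix i assume i: "i < length (p @ [v])"
        consider "Suc i < length p" | "Suc i = length p" | "i = length p" using i by fastforce
        then show "{(p @ [v]) ! i, (p @ [v]) ! (Suc i mod length (p @ [v]))} \<in> E"
        proof cases
          case 1
          then show ?thesis using p(6) by (auto simp: nth_append)
        next
          case 2
          then have "p ! i = s'" using p(1,3) last_conv_nth[of p] by (metis diff_Suc_1)
          then show ?thesis using 2 s' by (auto simp: nth_append)
        next
          case 3
          then have "p ! 0 = s" using p(1,2) by (simp add: hd_conv_nth)
          then show ?thesis using 3 sv p(1) by (auto simp: nth_append insert_commute)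
        qed
      qed (use len p sv in auto)
      then show False using acyc by blast
    qed
    define par' where "par' = par(v := s)"
    define rk' where "rk' = rk(v := Suc (Max (rk ` S)))"
    have mx: "\<And>u. u \<in> S \<Longrightarrow> rk u < Suc (Max (rk ` S))" using S.fin by (simp add: le_imp_less_Suc)
    have vr: "v \<noteq> r" using sv S.root by auto
    have rt: "rooted_tree (insert v S) r par' rk'"
    proof
      show "inj_on rk' (insert v S)"
      proof -
        have "inj_on rk' S" using S.rk_inj sv by (auto simp: rk'_def inj_on_def)
        moreover have "rk' v \<notin> rk' ` S"
        proof
          assume "rk' v \<in> rk' ` S"
          then obtain u where "u \<in> S" "rk' v = rk' u" by blast
          then show False using mx[of u] sv by (cases "u = v") (auto simp: rk'_def)
        qed
        ultimately show ?thesis by (simp add: sv)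
      qed
    qed (use S.fin S.root S.par_in S.par_rk sv mx in \<open>auto simp: par'_def rk'_def\<close>)
    have "(\<lambda>u. {u, par' u}) ` (insert v S - {r}) = insert {v, s} ((\<lambda>u. {u, par u}) ` (S - {r}))"
    proof -
      have "(\<lambda>u. {u, par' u}) ` (S - {r}) = (\<lambda>u. {u, par u}) ` (S - {r})"
        using sv by (intro image_cong) (auto simp: par'_def)
      then show ?thesis using vr by (simp add: insert_Diff_if par'_def)
    qed
    also have "\<dots> = {e \<in> E. e \<subseteq> insert v S}"
    proof -
      have "e = {v, s}" if e: "e \<in> E" "e \<subseteq> insert v S" "\<not> e \<subseteq> S" for e
      proof -
        have "v \<in> e" using e by auto
        moreover obtain a b where "e = {a, b}" "a \<noteq> b" using E2[OF e(1)] by (auto simp: card_2_iff)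
        ultimately obtain b where b: "e = {b, v}" "b \<noteq> v" by (auto simp: insert_commute)
        then have "b = s" using uniq[of b] e by auto
        with b show ?thesis by auto
      qed
      moreover have "{v, s} \<in> E" using sv(3) by (simp add: insert_commute)
      ultimately show ?thesis unfolding S(4) using sv(1) by blast
    qed
    finally show ?case using rt S sv vV S.fin
      by (intro exI[of _ "insert v S"] exI[of _ par'] exI[of _ rk']) auto
  qed
  from this[of "card V - 1"] obtain S par rk where S: "S \<subseteq> V" "card S = Suc (card V - 1)"
    "rooted_tree S r par rk" "(\<lambda>v. {v, par v}) ` (S - {r}) = {e \<in> E. e \<subseteq> S}"
    using r finV card_gt_0_iff[of V] by auto
  have "card V > 0" using r finV by (auto simp: card_gt_0_iff)
  then have "S = V" using S(1,2) finV by (intro card_subset_eq) auto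
  then have "(\<lambda>v. {v, par v}) ` (V - {r}) = E" using S(4) E2 by auto
  then show ?thesis using that S(3) \<open>S = V\<close> by (simp add: rooted_tree.edges_def)
qed

section \<open>Balanced splits of a tree\<close>

text \<open>Adding items of weight at most \<open>g\<close> one by one cannot jump over a window of
  length \<open>g\<close>. Items in \<open>J0\<close> may be heavier, as long as together they do
  not overshoot the window.\<close>

lemma accumulate:
  fixes w :: "'i \<Rightarrow> real"
  assumes "finite I" "J0 \<subseteq> I" "lo \<le> sum w I" "sum w J0 \<le> lo + g" "\<And>i. i \<in> I - J0 \<Longrightarrow> w i \<le> g"
  shows "\<exists>J. J0 \<subseteq> J \<and> J \<subseteq> I \<and> lo \<le> sum w J \<and> sum w J \<le> lo + g"
  using assms
proof (induction "card (I - J0)" arbitrary: J0 rule: less_induct)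
  case less
  show ?case
  proof (cases "lo \<le> sum w J0")
    case True
    then show ?thesis using less.prems by blast
  next
    case False
    then obtain i where i: "i \<in> I - J0" using less.prems by (metis DiffI subsetI subset_antisym)
    have fin: "finite J0" using less.prems finite_subset by blast
    have eq: "sum w (insert i J0) = w i + sum w J0" using i fin by simp
    have "card (I - insert i J0) < card (I - J0)"
      using i less.prems(1) by (intro psubset_card_mono) auto
    from less.hyps[OF this] obtain J where "insert i J0 \<subseteq> J" "J \<subseteq> I" "lo \<le> sum w J" "sum w J \<le> lo + g"
      using less.prems i eq False by fastforce
    then show ?thesis by auto
  qed
qed

text \<open>A branch at the root is a component of the tree without the root. This is how branches
  belonging to two different roots are compared.\<close>

lemma (in rooted_tree) desc_subset_closed:
  assumes "z \<in> C" "z \<in> children r"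
    and "\<And>u v. {u, v} \<in> edges \<Longrightarrow> u \<noteq> r \<Longrightarrow> v \<noteq> r \<Longrightarrow> u \<in> C \<Longrightarrow> v \<in> C"
  shows "desc z \<subseteq> C"
proof
  fix v assume "v \<in> desc z"
  then show "v \<in> C"
  proof (induction rule: desc.induct)
    case (desc_step v)
    have "par v \<noteq> r" using not_desc_child[OF assms(2)] desc_step by auto
    moreover have "{par v, v} \<in> edges" using desc_step by (auto simp: edges_def)
    ultimately show ?case using assms(3) desc_step by blast
  qed (rule assms)
qed

text \<open>\<open>x\<close> is a lowest vertex having at least half of all vertices below it. After
  rerooting at \<open>x\<close>, a branch lies either below an old child of \<open>x\<close>, where
  there is less than half, or outside the old subtree of \<open>x\<close>, where there is at most
  half.\<close>

lemma centroid:
  assumes T: "tree V E"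
  obtains x par rk where "rooted_tree V x par rk" "rooted_tree.edges V x par = E"
    "\<And>z. z \<in> rooted_tree.children V x par x \<Longrightarrow> 2 * card (rooted_tree.desc V x par z) \<le> card V"
proof -
  obtain r0 where r0: "r0 \<in> V" using T by (auto simp: tree_def connected_graph_def)
  obtain par rk where R: "rooted_tree V r0 par rk" "rooted_tree.edges V r0 par = E"
    using tree_rooting[OF T r0] by blast
  interpret R: rooted_tree V r0 par rk by fact
  obtain x where x: "x \<in> V" "card V \<le> 2 * card (R.desc x)"
    "\<And>z. z \<in> R.children x \<Longrightarrow> \<not> card V \<le> 2 * card (R.desc z)"
    using R.lowest[OF r0, of "\<lambda>y. card V \<le> 2 * card (R.desc y)"] R.desc_root r0 R.desc_subset
    by (metis le_add1 mult_2 subsetD)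
  obtain par' rk' where R': "rooted_tree V x par' rk'" "rooted_tree.edges V x par' = E"
    using tree_rooting[OF T x(1)] by blast
  interpret R': rooted_tree V x par' rk' by fact
  have down: "v \<in> R.desc z" if uv: "{u, v} \<in> E" "v \<noteq> x" "u \<noteq> x" "u \<in> R.desc z"
    and z: "z \<in> R.children x" for u v z
  proof -
    have "(u \<noteq> r0 \<and> par u = v) \<or> (v \<noteq> r0 \<and> par v = u)" "v \<in> V"
      using R.edge_cases[of u v] uv R(2) by auto
    then show ?thesis
    proof (elim disjE conjE)
      assume "par u = v"
      then show ?thesis using R.desc_par[OF uv(4)] uv z by (auto simp: R.children_def)
    next
      assume "v \<noteq> r0" "par v = u"
      then show ?thesis using uv \<open>v \<in> V\<close> R.desc_step[of v z] by auto
    qed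
  qed
  have dec: "R.desc x = insert x (\<Union>z\<in>R.children x. R.desc z)" by (rule R.desc_decomp[OF x(1)])
  have "2 * card (R'.desc z) \<le> card V" if z: "z \<in> R'.children x" for z
  proof -
    have zx: "z \<noteq> x" "z \<in> V" using z by (auto simp: R'.children_def)
    show ?thesis
    proof (cases "z \<in> R.desc x")
      case True
      then obtain z0 where z0: "z0 \<in> R.children x" "z \<in> R.desc z0" using dec zx by blast
      have "R'.desc z \<subseteq> R.desc z0"
        using down z0 R'(2) by (intro R'.desc_subset_closed[OF z0(2) z]) blast
      then have "card (R'.desc z) \<le> card (R.desc z0)" using R.finite_desc card_mono by blast
      then show ?thesis using x(3)[OF z0(1)] by simp
    next
      case False
      have "R'.desc z \<subseteq> V - R.desc x"
      proof (intro R'.desc_subset_closed[OF _ z])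
        show "z \<in> V - R.desc x" using False zx by simp
        fix u v assume uv: "{u, v} \<in> R'.edges" "u \<noteq> x" "v \<noteq> x" "u \<in> V - R.desc x"
        then have "{v, u} \<in> E" using R'(2) by (simp add: insert_commute)
        then have "v \<notin> R.desc x" using down[of v u] uv dec by blast
        then show "v \<in> V - R.desc x" using R'.edge_cases(2)[OF uv(1)] by simp
      qed
      then have "card (R'.desc z) \<le> card (V - R.desc x)" using R.fin card_mono by blast
      also have "\<dots> = card V - card (R.desc x)"
        using R.desc_subset R.finite_desc by (simp add: card_Diff_subset)
      finally show ?thesis using x(2) by simp
    qed
  qed
  with that R' show ?thesis by blast
qed

context rooted_tree
begin

definition met_children :: "'b set \<Rightarrow> 'b \<Rightarrow> 'b set" where
  "met_children H y = {z \<in> children y. desc z \<inter> H \<noteq> {}}"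

lemma finite_met_children: "finite (met_children H y)"
  using finite_children by (simp add: met_children_def)

text \<open>A vertex below \<open>y\<close>, other than \<open>y\<close> and its children, has all
  its neighbours in its own branch. So if \<open>H\<close> dominates it, then \<open>H\<close> meets
  this branch, and the branches avoiding \<open>H\<close> carry few vertices of
  \<open>A\<close>.\<close>

lemma card_met_children_desc:
  assumes "y \<in> V" "A \<subseteq> V"
  shows "card (A \<inter> desc y) \<le>
    1 + card (children y) + card {a \<in> A. \<forall>h\<in>H. {a, h} \<notin> edges} + (\<Sum>z\<in>met_children H y. card (A \<inter> desc z))"
proof -
  let ?U = "{a \<in> A. \<forall>h\<in>H. {a, h} \<notin> edges}"
  have "A \<inter> desc y \<subseteq> {y} \<union> children y \<union> ?U \<union> (\<Union>z\<in>met_children H y. A \<inter> desc z)"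
  proof
    fix a assume a: "a \<in> A \<inter> desc y"
    show "a \<in> {y} \<union> children y \<union> ?U \<union> (\<Union>z\<in>met_children H y. A \<inter> desc z)"
    proof (rule ccontr)
      assume n: "\<not> ?thesis"
      then obtain z where z: "z \<in> children y" "a \<in> desc z" using a desc_decomp[OF assms(1)] by auto
      have nm: "desc z \<inter> H = {}" using n z a by (auto simp: met_children_def)
      obtain h where h: "h \<in> H" "{a, h} \<in> edges" using n a desc_subset by auto
      have "h \<in> desc z"
        using edge_cases[OF h(2)] desc_par[OF z(2)] desc_step[of h z] z n by auto
      then show False using nm h by blast
    qed
  qed
  moreover have fU: "finite ({y} \<union> children y \<union> ?U \<union> (\<Union>z\<in>met_children H y. A \<inter> desc z))"
    using finite_subset[OF assms(2) fin] finite_children finite_met_children finite_desc by auto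
  ultimately have "card (A \<inter> desc y) \<le> card ({y} \<union> children y \<union> ?U \<union> (\<Union>z\<in>met_children H y. A \<inter> desc z))"
    by (rule card_mono[rotated])
  also have "\<dots> \<le> card {y} + card (children y) + card ?U + card (\<Union>z\<in>met_children H y. A \<inter> desc z)"
    by (meson card_Un_le order_trans add_le_mono1)
  also have "card (\<Union>z\<in>met_children H y. A \<inter> desc z) \<le> (\<Sum>z\<in>met_children H y. card (A \<inter> desc z))"
    by (rule card_UN_le[OF finite_met_children])
  finally show ?thesis by simp
qed

lemma card_UN_desc:
  assumes "J \<subseteq> V" "\<And>z z'. z \<in> J \<Longrightarrow> z' \<in> J \<Longrightarrow> z \<noteq> z' \<Longrightarrow> desc z \<inter> desc z' = {}"
  shows "card (\<Union>z\<in>J. desc z) = (\<Sum>z\<in>J. card (desc z))"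
  using assms fin finite_subset finite_desc by (intro card_UN_disjoint) auto

text \<open>Picking a point of \<open>H\<close> in each branch is injective when the branches are
  disjoint. This bounds the number of cut edges by the size of \<open>H\<close>.\<close>

lemma card_le_card_met:
  assumes "finite H" "\<And>z z'. z \<in> J \<Longrightarrow> z' \<in> J \<Longrightarrow> z \<noteq> z' \<Longrightarrow> desc z \<inter> desc z' = {}"
    "\<And>z. z \<in> J \<Longrightarrow> desc z \<inter> H \<noteq> {}"
  shows "card J \<le> card H"
proof -
  obtain h where h: "\<forall>z\<in>J. h z \<in> desc z \<inter> H"
    using bchoice[of J "\<lambda>z x. x \<in> desc z \<inter> H"] assms(3) by blast
  have "inj_on h J" using h assms(2) by (fastforce simp: inj_on_def)
  then show ?thesis using h assms(1) by (intro card_inj_on_le[of h]) auto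
qed

end

lemma two_large_of_three:
  fixes a :: "'i \<Rightarrow> real"
  assumes "card B = 2 \<or> card B = 3" "3 * c \<le> 2 * sum a B" "\<And>i. i \<in> B \<Longrightarrow> 0 \<le> a i"
  shows "\<exists>i\<in>B. \<exists>j\<in>B. i \<noteq> j \<and> c \<le> a i + a j"
  using assms(1)
proof
  assume "card B = 2"
  then obtain i j where B: "B = {i, j}" "i \<noteq> j" by (auto simp: card_2_iff)
  then have "c \<le> a i + a j" using assms(2) assms(3)[of i] assms(3)[of j] by auto
  with B show ?thesis by blast
next
  assume "card B = 3"
  then obtain i j k where B: "B = {i, j, k}" "i \<noteq> j" "i \<noteq> k" "j \<noteq> k" by (auto simp: card_3_iff)
  then have "c \<le> a i + a j \<or> c \<le> a i + a k \<or> c \<le> a j + a k" using assms(2) by auto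
  with B show ?thesis by blast
qed

text \<open>A centroid \<open>x\<close> works as the only cut vertex unless almost all of the tree lies in two or
  three branches of order about \<open>n/3\<close>. In that case one cuts inside two of these branches, as
  close to the leaves as the size of a branch permits; all pieces are then small enough for the
  greedy choice to hit the middle third.\<close>

lemma balanced_split:
  assumes T: "tree V E" and n: "card V = n" "10^8 \<le> n"
    and deg: "\<And>v. v \<in> V \<Longrightarrow> real (degree E v) \<le> \<Delta>" "\<Delta> \<le> real n / 10^6"
    and A: "A \<subseteq> V" "0.666 * real n \<le> real (card A)"
    and H: "finite H" "real (card {a \<in> A. \<forall>h\<in>H. {a, h} \<notin> E}) \<le> 0.011 * real n"
  obtains r par rk y1 y2 Z S where "rooted_tree V r par rk" "rooted_tree.edges V r par = E"
    "y1 \<in> V" "y2 \<in> V" "y1 \<noteq> y2" "{y1, y2} \<notin> E"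
    "\<And>z. z \<in> Z \<Longrightarrow> z \<in> V \<and> z \<noteq> r \<and> (par z = y1 \<or> par z = y2)"
    "S = (\<Union>z\<in>Z. rooted_tree.desc V r par z)" "y1 \<notin> S" "y2 \<notin> S"
    "card Z \<le> card H" "real (card Z) \<le> 2 * \<Delta>"
    "(1/3 + 1/200) * real n \<le> real (card S)" "real (card S) \<le> (2/3 - 1/200) * real n"
    "\<And>t. {t, y1} \<in> E \<Longrightarrow> {t, y2} \<in> E \<Longrightarrow> t = r \<or> par t = y1 \<or> par t = y2"
proof -
  obtain x par rk where R: "rooted_tree V x par rk" "rooted_tree.edges V x par = E"
    and half: "\<And>z. z \<in> rooted_tree.children V x par x \<Longrightarrow> 2 * card (rooted_tree.desc V x par z) \<le> card V"
    using centroid[OF T] by blast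
  interpret rooted_tree V x par rk by fact
  have E: "edges = E" by fact
  \<comment> \<open>The window for the size of \<open>S\<close> is symmetric about
    \<open>n/2\<close>. Its margin \<open>n/200\<close> makes both parts fit into sides of order
    \<open>0.666 n\<close>, with room for reserved vertices.\<close>
  define lo where "lo = (1/3 + 1/200) * real n"
  define w where "w z = real (card (desc z))" for z
  define a where "a z = real (card (A \<inter> desc z))" for z
  define M where "M = met_children H x"
  define good where "good J \<longleftrightarrow> lo \<le> sum w J \<and> sum w J \<le> (2/3 - 1/200) * real n" for J
  have n0: "real n \<ge> 10^8" using of_nat_mono[OF n(2), where 'a = real] by simp
  have Mfin: "finite M" by (simp add: M_def finite_met_children)
  have Mch: "M \<subseteq> children x" by (auto simp: M_def met_children_def)
  have chdeg: "real (card (children y)) \<le> \<Delta>" if "y \<in> V" for y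
    using degree_children[of y] deg(1)[OF that] E by simp
  have met: "a y \<le> 1 + \<Delta> + 0.011 * real n + (\<Sum>z\<in>met_children H y. a z)" if "y \<in> V" for y
  proof -
    have "a y \<le> real (1 + card (children y) + card {a \<in> A. \<forall>h\<in>H. {a, h} \<notin> E} + (\<Sum>z\<in>met_children H y. card (A \<inter> desc z)))"
      using card_met_children_desc[OF that A(1), of H] unfolding a_def E of_nat_le_iff .
    then show ?thesis using chdeg[OF that] H(2) by (simp add: a_def)
  qed
  have aw: "a z \<le> w z" for z unfolding a_def w_def using finite_desc by (simp add: card_mono)
  have w0: "w z \<ge> 0" for z by (simp add: w_def)
  have a0: "a z \<ge> 0" for z by (simp add: a_def)
  have disjM: "desc z \<inter> desc z' = {}" if "z \<in> children x" "z' \<in> children x" "z \<noteq> z'" for z z'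
    using desc_siblings_disjoint that by blast
  have chroot: "t \<in> children x" if "{t, x} \<in> E" for t
    using edge_cases[of t x] that E by (auto simp: children_def)
  have ax: "a x = real (card A)" using A desc_root by (simp add: a_def Int_absorb2)
  have sumMa: "sum a M \<ge> 0.654 * real n" using met[OF root] ax A(2) deg(2) n0 by (simp add: M_def)
  have sumM: "sum w M \<ge> 0.654 * real n" using sumMa sum_mono[of M a w] aw by force
  show ?thesis
  proof (cases "\<exists>J\<subseteq>M. good J")
    case True
    then obtain J where J: "J \<subseteq> M" "good J" by blast
    define S where "S = (\<Union>z\<in>J. desc z)"
    have JV: "J \<subseteq> V" using J Mch children_subset by blast
    have cS: "real (card S) = sum w J"
      unfolding S_def w_def using card_UN_desc[OF JV] disjM J Mch by (subst card_UN_desc[OF JV]) auto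
    have xS: "x \<notin> S" using not_desc_child J Mch by (auto simp: S_def)
    have finS: "finite S" using desc_subset fin finite_subset[of S V] by (auto simp: S_def)
    have "card (insert x (S \<union> children x)) < card V"
    proof -
      have "card (insert x (S \<union> children x)) \<le> Suc (card S + card (children x))"
        using card_Un_le[of S "children x"] finite_children finS by (auto simp: card_insert_if)
      moreover have "real (Suc (card S + card (children x))) < real n"
        using cS J(2) chdeg[OF root] deg(2) n0 by (simp add: good_def)
      ultimately show ?thesis using n by linarith
    qed
    then have "\<not> V \<subseteq> insert x (S \<union> children x)"
      using card_mono[of "insert x (S \<union> children x)" V] finite_children finS by auto
    \<comment> \<open>Cutting at \<open>x\<close> alone is enough here. \<open>y2\<close> is a dummy
      second cut vertex, chosen outside \<open>S\<close> and not adjacent to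
      \<open>x\<close>.\<close>
    then obtain y2 where y2: "y2 \<in> V" "y2 \<noteq> x" "y2 \<notin> S" "y2 \<notin> children x" by blast
    have "card J \<le> card H"
      using J Mch disjM H by (intro card_le_card_met) (auto simp: M_def met_children_def)
    moreover have "card J \<le> card (children x)" using J Mch finite_children by (intro card_mono) auto
    moreover have "\<Delta> \<ge> 0" using chdeg[OF root] by linarith
    moreover have "{x, y2} \<notin> E" using chroot[of y2] y2(4) by (auto simp: insert_commute)
    moreover have "z \<in> V \<and> z \<noteq> x \<and> (par z = x \<or> par z = y2)" if "z \<in> J" for z
      using that J(1) Mch by (auto simp: children_def)
    moreover have "t = x \<or> par t = x \<or> par t = y2" if "{t, x} \<in> E" for t
      using chroot[OF that] by (auto simp: children_def)
    moreover have "(1/3 + 1/200) * real n \<le> real (card S)" "real (card S) \<le> (2/3 - 1/200) * real n"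
      using J(2) cS by (auto simp: good_def lo_def)
    moreover have "real (card J) \<le> 2 * \<Delta>"
      using calculation(2,3) chdeg[OF root] by linarith
    ultimately show ?thesis
      using that[OF R root y2(1) y2(2)[symmetric] _ _ S_def xS y2(3)] by blast
  next
    case False
    then have ng: "\<And>J. J \<subseteq> M \<Longrightarrow> \<not> good J" by blast
    have wlo: "w z < lo" if "z \<in> M" for z
    proof -
      have "w z \<le> real n / 2" using half[of z] that Mch n by (auto simp: w_def)
      then show ?thesis using ng[of "{z}"] that n0 by (auto simp: good_def lo_def)
    qed
    \<comment> \<open>\<open>g\<close> is the length of the window, so branches of order at most
      \<open>g\<close> can be accumulated without missing it.\<close>
    define g where "g = (1/3 - 2/200) * real n"
    have acc: "\<not> lo \<le> sum w I" if I: "I \<subseteq> M" "J0 \<subseteq> I" "sum w J0 \<le> lo + g" "\<And>i. i \<in> I - J0 \<Longrightarrow> w i \<le> g" for I J0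
    proof
      assume "lo \<le> sum w I"
      then obtain J where "J \<subseteq> I" "lo \<le> sum w J" "sum w J \<le> lo + g"
        using accumulate[of I J0 lo w g] I Mfin finite_subset by blast
      then show False using ng[of J] I by (auto simp: good_def lo_def g_def algebra_simps)
    qed
    define B where "B = {z \<in> M. w z > g}"
    have BM: "B \<subseteq> M" "finite B" using Mfin by (auto simp: B_def)
    have "B \<noteq> {}"
    proof
      assume "B = {}"
      then have "\<not> lo \<le> sum w M" using acc[of M "{}"] n0 by (auto simp: B_def lo_def g_def not_less)
      then show False using sumM n0 by (simp add: lo_def)
    qed
    then obtain b where b: "b \<in> B" by blast
    \<comment> \<open>If the small branches weighed more than \<open>lo - g = 0.015 n\<close>, then
      one big branch followed by small ones would hit the window.\<close>
    have sumN: "sum w (M - B) \<le> 0.015 * real n"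
    proof -
      have "\<not> lo \<le> sum w (insert b (M - B))"
        using b BM wlo[of b] n0 by (intro acc[of _ "{b}"]) (auto simp: B_def g_def)
      then show ?thesis using b Mfin by (simp add: B_def g_def lo_def)
    qed
    have sumBa: "sum a B \<ge> 0.639 * real n"
    proof -
      have "sum a M = sum a (M - B) + sum a B" using BM Mfin by (intro sum.subset_diff) auto
      moreover have "sum a (M - B) \<le> sum w (M - B)" by (intro sum_mono aw)
      ultimately show ?thesis using sumMa sumN by linarith
    qed
    have sumB: "sum w B \<le> real n"
    proof -
      have "sum w B = real (card (\<Union>z\<in>B. desc z))"
      proof -
        have "B \<subseteq> V" "B \<subseteq> children x" using BM(1) Mch children_subset by blast+
        then have "card (\<Union>z\<in>B. desc z) = (\<Sum>z\<in>B. card (desc z))"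
          using disjM by (intro card_UN_desc) blast+
        then show ?thesis by (simp add: w_def)
      qed
      also have "\<dots> \<le> real n" using n fin desc_subset by (auto intro!: card_mono)
      finally show ?thesis .
    qed
    have "card B = 2 \<or> card B = 3"
    proof -
      have "real (card B) * g \<le> sum w B"
        using sum_bounded_below[of B g w] by (force simp: B_def)
      then have "real (card B) * (1/3 - 2/200) * real n \<le> 1 * real n"
        using sumB by (simp add: g_def mult.assoc)
      then have "real (card B) * (1/3 - 2/200) \<le> 1"
        by (rule mult_right_le_imp_le) (use n0 in simp)
      then have "real (card B) < 4" by simp
      then have "card B < 4" by simp
      moreover have "sum w B \<le> real (card B) * lo"
        using sum_bounded_above[of B w lo] wlo BM by force
      then have "0.639 * real n \<le> real (card B) * lo" using sumBa sum_mono[of B a w] aw by force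
      then have "0.639 * real n \<le> real (card B) * (1/3 + 1/200) * real n"
        by (simp add: lo_def mult.assoc)
      then have "0.639 \<le> real (card B) * (1/3 + 1/200)"
        by (rule mult_right_le_imp_le) (use n0 in simp)
      then have "real (card B) > 1" by simp
      then have "card B > 1" by simp
      ultimately show ?thesis by linarith
    qed
    \<comment> \<open>Two of at most three branches carry two thirds of the \<open>0.639 n\<close>
      vertices of \<open>A\<close>.\<close>
    then obtain z1 z2 where z: "z1 \<in> B" "z2 \<in> B" "z1 \<noteq> z2" "0.426 * real n \<le> a z1 + a z2"
      using two_large_of_three[of B "0.426 * real n" a] sumBa a0 by auto
    have zch: "z1 \<in> children x" "z2 \<in> children x" using z BM Mch by auto
    have zV: "z1 \<in> V" "z2 \<in> V" using zch children_subset by auto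
    have D: "desc z1 \<inter> desc z2 = {}" using disjM zch z(3) by blast
    \<comment> \<open>Pieces of order at most \<open>h\<close> keep the accumulated size below
      \<open>lo + h\<close>, inside the window. As a branch has fewer than \<open>lo\<close>
      vertices, descending to a lowest vertex with more than \<open>h\<close> below it loses at most
      \<open>lo - h = 0.02 n\<close>.\<close>
    define h where "h = (1/3 - 3/200) * real n"
    have gh: "h < g" using n0 by (simp add: h_def g_def)
    obtain y1 where y1: "y1 \<in> desc z1" "h < w y1" "\<And>z. z \<in> children y1 \<Longrightarrow> \<not> h < w z"
      using lowest[OF zV(1), of "\<lambda>y. h < w y"] z gh by (auto simp: B_def)
    obtain y2 where y2: "y2 \<in> desc z2" "h < w y2" "\<And>z. z \<in> children y2 \<Longrightarrow> \<not> h < w z"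
      using lowest[OF zV(2), of "\<lambda>y. h < w y"] z gh by (auto simp: B_def)
    have yV: "y1 \<in> V" "y2 \<in> V" using y1 y2 desc_subset by auto
    have loss: "a z \<le> a y + 0.02 * real n" if "z \<in> B" "y \<in> desc z" "h < w y" for z y
    proof -
      have "desc y \<subseteq> desc z" using that desc_trans by blast
      then have "card (desc z - desc y) = card (desc z) - card (desc y)" "card (desc y) \<le> card (desc z)"
        using finite_desc by (auto simp: card_Diff_subset card_mono)
      moreover have "A \<inter> desc z \<subseteq> (A \<inter> desc y) \<union> (desc z - desc y)" by blast
      then have "card (A \<inter> desc z) \<le> card ((A \<inter> desc y) \<union> (desc z - desc y))"
        using finite_desc by (intro card_mono) auto
      ultimately have "a z \<le> a y + (w z - w y)"
        using card_Un_le[of "A \<inter> desc y" "desc z - desc y"] unfolding a_def w_def by linarith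
      then show ?thesis using that wlo[of z] BM n0 by (auto simp: h_def lo_def)
    qed
    define I where "I = met_children H y1 \<union> met_children H y2"
    have sub: "desc z \<subseteq> desc z1" if "z \<in> children y1" for z
      using that y1(1) child_in_desc yV desc_trans by blast
    have sub2: "desc z \<subseteq> desc z2" if "z \<in> children y2" for z
      using that y2(1) child_in_desc yV desc_trans by blast
    have chd: "children y1 \<inter> children y2 = {}"
      using y1(1) y2(1) D by (auto simp: children_def)
    have mc: "met_children H y \<subseteq> children y" for y by (auto simp: met_children_def)
    \<comment> \<open>Up to the degrees, the met pieces still carry
      \<open>0.426 - 2 * 0.02 - 2 * 0.011 = 0.364\<close> times \<open>n\<close> vertices of
      \<open>A\<close>, against a target of about \<open>0.338 n\<close>.\<close>
    have sumI: "lo \<le> sum w I"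
    proof -
      have "sum w I = sum w (met_children H y1) + sum w (met_children H y2)"
        unfolding I_def using chd mc finite_met_children by (intro sum.union_disjoint) blast+
      moreover have "sum a (met_children H y1) \<le> sum w (met_children H y1)"
        "sum a (met_children H y2) \<le> sum w (met_children H y2)" by (intro sum_mono aw)+
      ultimately have "a y1 + a y2 \<le> 2 + 2 * \<Delta> + 0.022 * real n + sum w I"
        using met[OF yV(1)] met[OF yV(2)] by simp
      then show ?thesis
        using loss[OF z(1) y1(1,2)] loss[OF z(2) y2(1,2)] z(4) deg(2) n0 by (simp add: lo_def)
    qed
    have "\<exists>J. {} \<subseteq> J \<and> J \<subseteq> I \<and> lo \<le> sum w J \<and> sum w J \<le> lo + h"
      using sumI y1(3) y2(3) mc n0 finite_met_children
      by (intro accumulate) (auto simp: I_def h_def lo_def not_less subset_iff)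
    then obtain J where J: "J \<subseteq> I" "lo \<le> sum w J" "sum w J \<le> lo + h" by blast
    define S where "S = (\<Union>z\<in>J. desc z)"
    have JC: "z \<in> children y1 \<or> z \<in> children y2" if "z \<in> J" for z using that J mc by (auto simp: I_def)
    have JV: "J \<subseteq> V" using JC children_subset by blast
    have disjJ: "desc z \<inter> desc z' = {}" if "z \<in> J" "z' \<in> J" "z \<noteq> z'" for z z'
      using JC[OF that(1)] JC[OF that(2)] desc_siblings_disjoint that(3) sub sub2 D by blast
    have cS: "real (card S) = sum w J"
      unfolding S_def w_def using disjJ by (subst card_UN_desc[OF JV]) auto
    have "y1 \<notin> S" using JC not_desc_child y1(1) sub2 D unfolding S_def by blast
    moreover have "y2 \<notin> S" using JC not_desc_child y2(1) sub D unfolding S_def by blast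
    moreover have "card J \<le> card H"
      using J disjJ H by (intro card_le_card_met) (auto simp: I_def met_children_def)
    moreover have "real (card J) \<le> 2 * \<Delta>"
    proof -
      have "card J \<le> card (children y1 \<union> children y2)"
        using JC finite_children by (intro card_mono) auto
      then have "card J \<le> card (children y1) + card (children y2)" using card_Un_le le_trans by blast
      then show ?thesis using chdeg[OF yV(1)] chdeg[OF yV(2)] by linarith
    qed
    moreover have up: "par y = x \<or> par y \<in> desc z" if "y \<in> desc z" "z \<in> children x" for y z
      using that desc_par[of y z] by (cases "y = z") (auto simp: children_def)
    have xz: "x \<notin> desc z1" "x \<notin> desc z2" using zch not_desc_child by auto
    have "{y1, y2} \<notin> E"
    proof
      assume "{y1, y2} \<in> E"
      then have "par y1 = y2 \<or> par y2 = y1" using edge_cases[of y1 y2] E by auto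
      then show False using up[OF y1(1) zch(1)] up[OF y2(1) zch(2)] y1(1) y2(1) D xz by auto
    qed
    \<comment> \<open>A common neighbour of the cut vertices will have only one admissible image, so
      it must not depend on the image of a parent that is placed by the greedy choice.\<close>
    moreover have "t = x \<or> par t = y1 \<or> par t = y2" if "{t, y1} \<in> E" "{t, y2} \<in> E" for t
    proof (rule ccontr)
      assume "\<not> ?thesis"
      then have "par y1 = t" "par y2 = t" "t \<noteq> x"
        using edge_cases[of t y1] edge_cases[of t y2] that E by auto
      then show False using up[OF y1(1) zch(1)] up[OF y2(1) zch(2)] D by auto
    qed
    moreover have "z \<in> V \<and> z \<noteq> x \<and> (par z = y1 \<or> par z = y2)" if "z \<in> J" for z
      using JC[OF that] by (auto simp: children_def)
    moreover have "y1 \<noteq> y2" using y1 y2 D by auto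
    moreover have "lo + h \<le> (2/3 - 1/200) * real n" using n0 by (simp add: lo_def h_def)
    ultimately show ?thesis
      using that[OF R yV, of J S] J cS unfolding S_def lo_def by auto
  qed
qed

section \<open>Embeddings into almost complete graphs\<close>

context rooted_tree
begin

lemma par_bipartition:
  assumes "bipartition V edges A B" "t \<in> V" "t \<noteq> r"
  shows "(t \<in> A \<longleftrightarrow> par t \<in> B) \<and> (t \<in> B \<longleftrightarrow> par t \<in> A)"
proof -
  have "{t, par t} \<in> edges" using assms by (auto simp: edges_def)
  then obtain a b where "a \<in> A" "b \<in> B" "{t, par t} = {a, b}"
    using assms(1) unfolding bipartition_def by blast
  then show ?thesis using assms(1) by (auto simp: bipartition_def doubleton_eq_iff)
qed

text \<open>The children of a vertex of \<open>A\<close> lie in \<open>B\<close>, and no two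
  vertices of \<open>A\<close> share a child.\<close>

lemma card_inner_le:
  assumes "bipartition V edges A B"
  shows "card {a \<in> A. children a \<noteq> {}} \<le> card B"
proof -
  have finB: "finite B" using assms fin by (auto simp: bipartition_def)
  have "{a \<in> A. children a \<noteq> {}} \<subseteq> par ` B"
    using par_bipartition[OF assms] by (force simp: children_def)
  then show ?thesis using finB card_mono[of "par ` B"] card_image_le[OF finB, of par]
    by (meson finite_imageI le_trans)
qed

lemma embedding_reserved_leaves:
  fixes adj :: "'a \<Rightarrow> 'a \<Rightarrow> bool"
  assumes bip: "bipartition V edges A B" "r \<in> B"
    and sym: "\<And>u v. adj u v \<Longrightarrow> adj v u"
    and B0: "B0 \<subseteq> B" "inj_on \<phi>0 B0"
    and \<alpha>: "\<And>b. b \<in> B0 \<Longrightarrow> \<alpha> b \<in> A \<and> children (\<alpha> b) = {} \<and> par (\<alpha> b) = b"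
    and wv: "inj_on wv B0" "\<And>b. b \<in> B0 \<Longrightarrow> adj (\<phi>0 b) (wv b)"
    and finPQ: "finite P" "finite Q" and P1: "P1 \<subseteq> P"
    and disj: "P \<inter> Q = {}" "\<phi>0 ` B0 \<inter> P = {}" "wv ` B0 \<inter> (P \<union> Q \<union> \<phi>0 ` B0) = {}"
    and P1adj: "\<And>p b. p \<in> P1 \<Longrightarrow> b \<in> B0 \<Longrightarrow> adj p (\<phi>0 b)"
    and d: "\<And>p. p \<in> P1 \<Longrightarrow> card {q \<in> Q. \<not> adj p q} \<le> d"
           "\<And>q. q \<in> Q \<Longrightarrow> card {p \<in> P1. \<not> adj q p} \<le> d"
    and sizes: "card B + card B0 + d \<le> card Q" "card B + d \<le> card P1"
    and D: "\<And>q. q \<in> Q \<union> \<phi>0 ` B0 \<Longrightarrow> card {p \<in> P. \<not> adj q p} \<le> D"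
    and cover: "\<And>\<phi>. inj_on \<phi> B \<Longrightarrow> \<phi> ` B \<subseteq> Q \<union> \<phi>0 ` B0 \<Longrightarrow> (\<And>b. b \<in> B0 \<Longrightarrow> \<phi> b = \<phi>0 b) \<Longrightarrow>
       card A \<le> card B0 + card {u \<in> P. D < card {a \<in> A - \<alpha> ` B0. \<forall>b\<in>B. {a, b} \<in> edges \<longrightarrow> adj u (\<phi> b)}}"
  shows "\<exists>f. inj_on f V \<and> f ` V \<subseteq> P \<union> Q \<union> \<phi>0 ` B0 \<union> wv ` B0 \<and> (\<forall>t\<in>V. t \<noteq> r \<longrightarrow> adj (f (par t)) (f t))"
proof -
  have AB: "A \<union> B = V" "A \<inter> B = {}" and bipE: "\<And>e. e \<in> edges \<Longrightarrow> \<exists>a\<in>A. \<exists>b\<in>B. e = {a, b}"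
    using bip by (auto simp: bipartition_def)
  have finA: "finite A" and finB: "finite B" using AB(1) fin by auto
  have finB0: "finite B0" using B0 finB finite_subset by blast
  note parAB = par_bipartition[OF bip(1)]
  define \<Lambda> where "\<Lambda> = {a \<in> A. children a = {}}"
  \<comment> \<open>Without the leaves in \<open>A\<close> this is still a rooted tree, and both of
    its classes have at most \<open>card B\<close> vertices, so the greedy choice has ample
    room.\<close>
  define V' where "V' = V - \<Lambda>"
  have rV': "r \<in> V'" using bip(2) AB root by (auto simp: V'_def \<Lambda>_def)
  have BV': "B \<subseteq> V'" using AB by (auto simp: V'_def \<Lambda>_def)
  have parV': "par v \<in> V'" if "v \<in> V" "v \<noteq> r" for v
    using that par_in by (auto simp: V'_def \<Lambda>_def children_def)
  interpret I: rooted_tree V' r par rk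
    using fin rV' parV' par_rk rk_inj
    by unfold_locales (auto simp: V'_def intro: inj_on_subset)
  define \<Gamma> where "\<Gamma> t = (if t \<in> B then Q - \<phi>0 ` B0 else P1)" for t
  have AV': "t \<in> A" if "t \<in> V'" "t \<notin> B" for t using that AB by (auto simp: V'_def)
  have "A \<inter> V' = {a \<in> A. children a \<noteq> {}}" using AB by (auto simp: V'_def \<Lambda>_def)
  then have cardAV': "card (A \<inter> V') \<le> card B" using card_inner_le[OF bip(1)] by simp
  have disj\<Gamma>: "P1 \<inter> (Q - \<phi>0 ` B0) = {}" using disj P1 by auto
  have othersB: "card {s \<in> V' - B0. s \<noteq> t \<and> \<Gamma> s \<inter> \<Gamma> t \<noteq> {}} < card B" if "t \<in> B" for t
  proof -
    have "{s \<in> V' - B0. s \<noteq> t \<and> \<Gamma> s \<inter> \<Gamma> t \<noteq> {}} \<subseteq> B - {t}"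
      using disj\<Gamma> that by (auto simp: \<Gamma>_def split: if_splits)
    then have "card {s \<in> V' - B0. s \<noteq> t \<and> \<Gamma> s \<inter> \<Gamma> t \<noteq> {}} \<le> card (B - {t})"
      using finB by (intro card_mono) auto
    also have "\<dots> < card B" using finB that by (intro psubset_card_mono) auto
    finally show ?thesis .
  qed
  have othersA: "card {s \<in> V' - B0. s \<noteq> t \<and> \<Gamma> s \<inter> \<Gamma> t \<noteq> {}} < card B" if "t \<in> V'" "t \<notin> B" for t
  proof -
    have "{s \<in> V' - B0. s \<noteq> t \<and> \<Gamma> s \<inter> \<Gamma> t \<noteq> {}} \<subseteq> (A \<inter> V') - {t}"
      using disj\<Gamma> that AV' by (auto simp: \<Gamma>_def split: if_splits)
    then have "card {s \<in> V' - B0. s \<noteq> t \<and> \<Gamma> s \<inter> \<Gamma> t \<noteq> {}} \<le> card ((A \<inter> V') - {t})"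
      using finA by (intro card_mono) auto
    also have "\<dots> < card (A \<inter> V')" using finA that AV' by (intro psubset_card_mono) auto
    finally show ?thesis using cardAV' by simp
  qed
  have cQ: "card B + d \<le> card (Q - \<phi>0 ` B0)"
    using diff_card_le_card_Diff[of "\<phi>0 ` B0" Q] finB0 card_image_le[OF finB0, of \<phi>0] sizes(1) by simp
  have good_nbrs: "card X - d \<le> card {q \<in> X. R q}" if "card {q \<in> X. \<not> R q} \<le> d" "finite X" for X :: "'a set" and R
  proof -
    have "X = {q \<in> X. R q} \<union> {q \<in> X. \<not> R q}" by blast
    then have "card X \<le> card {q \<in> X. R q} + card {q \<in> X. \<not> R q}" by (metis card_Un_le)
    then show ?thesis using that by linarith
  qed
  have finP1: "finite P1" using P1 finPQ finite_subset by blast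
  obtain f1 where f1: "inj_on f1 V'" "\<And>t. t \<in> B0 \<Longrightarrow> f1 t = \<phi>0 t" "\<And>t. t \<in> V' - B0 \<Longrightarrow> f1 t \<in> \<Gamma> t"
    "\<And>t. t \<in> V' \<Longrightarrow> t \<noteq> r \<Longrightarrow> adj (f1 (par t)) (f1 t)"
  proof (rule I.greedy_embedding[of B0 \<phi>0 \<Gamma> adj])
    show "B0 \<subseteq> V'" using B0 BV' by blast
    show "inj_on \<phi>0 B0" by fact
    show "\<phi>0 s \<notin> \<Gamma> t" if "t \<in> V' - B0" "s \<in> B0" for t s
      using that disj P1 by (auto simp: \<Gamma>_def)
    show "card {s \<in> V' - B0. s \<noteq> t \<and> \<Gamma> s \<inter> \<Gamma> t \<noteq> {}} < card (\<Gamma> t)" if "t \<in> V' - B0" for t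
    proof (cases "t \<in> B")
      case True
      then show ?thesis using othersB[OF True] cQ by (simp add: \<Gamma>_def)
    next
      case False
      then show ?thesis using othersA[of t] that sizes by (simp add: \<Gamma>_def)
    qed
    show "card {s \<in> V' - B0. s \<noteq> t \<and> \<Gamma> s \<inter> \<Gamma> t \<noteq> {}} < card {q \<in> \<Gamma> t. adj p q}"
      if t: "t \<in> V' - B0" "t \<noteq> r" "par t \<notin> B0" "p \<in> \<Gamma> (par t)" for t p
    proof (cases "t \<in> B")
      case True
      then have "par t \<notin> B" using parAB[of t] t AB by (auto simp: V'_def)
      then have "p \<in> P1" using t by (simp add: \<Gamma>_def)
      have "card {q \<in> Q - \<phi>0 ` B0. \<not> adj p q} \<le> card {q \<in> Q. \<not> adj p q}"
        using finPQ by (intro card_mono) auto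
      then have "card (Q - \<phi>0 ` B0) - d \<le> card {q \<in> Q - \<phi>0 ` B0. adj p q}"
        using d(1)[OF \<open>p \<in> P1\<close>] finPQ by (intro good_nbrs) auto
      then show ?thesis using othersB[OF True] True cQ by (simp add: \<Gamma>_def)
    next
      case False
      then have "par t \<in> B" using parAB[of t] t AV' by (auto simp: V'_def)
      then have "p \<in> Q" using t by (simp add: \<Gamma>_def)
      then have "card P1 - d \<le> card {q \<in> P1. adj p q}" using d(2) finP1 by (intro good_nbrs) auto
      then show ?thesis using othersA[of t] t False sizes by (simp add: \<Gamma>_def)
    qed
    show "adj (\<phi>0 (par t)) q" if t: "t \<in> V' - B0" "t \<noteq> r" "par t \<in> B0" "q \<in> \<Gamma> t" for t q
    proof -
      have "t \<notin> B" using parAB[of t] t B0 AB by (auto simp: V'_def)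
      then show ?thesis using t P1adj sym by (auto simp: \<Gamma>_def)
    qed
    show "adj p (\<phi>0 t)" if t: "t \<in> B0" "t \<noteq> r" "par t \<notin> B0" "p \<in> \<Gamma> (par t)" for t p
    proof -
      have "par t \<notin> B" using parAB[of t] t B0 AB by auto
      then show ?thesis using t P1adj by (auto simp: \<Gamma>_def)
    qed
    show "adj (\<phi>0 (par t)) (\<phi>0 t)" if t: "t \<in> B0" "t \<noteq> r" "par t \<in> B0" for t
      using parAB[of t] t B0 AB by auto
  qed blast
  define \<Lambda>' where "\<Lambda>' = \<Lambda> - \<alpha> ` B0"
  have \<alpha>\<Lambda>: "\<alpha> ` B0 \<subseteq> \<Lambda>" using \<alpha> by (auto simp: \<Lambda>_def)
  have inj\<alpha>: "inj_on \<alpha> B0" using \<alpha> by (metis inj_on_inverseI)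
  have finPQ\<Lambda>: "finite \<Lambda>'" using finA by (auto simp: \<Lambda>'_def \<Lambda>_def)
  have f1B: "f1 b \<in> Q \<union> \<phi>0 ` B0" if "b \<in> B" for b
    using f1(2)[of b] f1(3)[of b] that BV' by (cases "b \<in> B0") (auto simp: \<Gamma>_def)
  \<comment> \<open>The bound variable \<open>D\<close> is the set of leaves still missing and
    shadows the number \<open>D\<close>. The images of \<open>B\<close> never change, because
    exchanges only move vertices of \<open>A\<close>.\<close>
  define Good where "Good D f \<longleftrightarrow> D \<subseteq> \<Lambda>' \<and> inj_on f (V - D) \<and> f ` (A - D - \<alpha> ` B0) \<subseteq> P \<and>
    (\<forall>b\<in>B. f b = f1 b) \<and> (\<forall>b\<in>B0. f (\<alpha> b) = wv b) \<and> (\<forall>t\<in>V - D. t \<noteq> r \<longrightarrow> adj (f (par t)) (f t))" for D f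
  have leafpar: "par t \<notin> \<Lambda>" if "t \<in> V" "t \<noteq> r" for t using parV' that by (auto simp: V'_def)
  have "\<exists>D f. card D = card \<Lambda>' - m \<and> Good D f" for m
  proof (induction m)
    case 0
    define f where "f t = (if t \<in> \<alpha> ` B0 then wv (par t) else f1 t)" for t
    have V\<Lambda>: "V - \<Lambda>' = V' \<union> \<alpha> ` B0" using \<alpha>\<Lambda> AB by (auto simp: V'_def \<Lambda>'_def \<Lambda>_def)
    have fV': "f t = f1 t" if "t \<in> V'" for t using that \<alpha>\<Lambda> by (auto simp: f_def V'_def)
    have f\<alpha>: "f (\<alpha> b) = wv b" if "b \<in> B0" for b using that \<alpha> by (simp add: f_def)
    have f1P: "f1 t \<in> P \<union> Q \<union> \<phi>0 ` B0" if "t \<in> V'" for t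
      using f1B[of t] f1(3)[of t] that P1 B0(1) by (cases "t \<in> B") (auto simp: \<Gamma>_def)
    have "inj_on f (V - \<Lambda>')"
    proof -
      have 1: "inj_on f V'" using f1(1) fV' inj_on_cong by metis
      have 2: "inj_on f (\<alpha> ` B0)" using wv(1) f\<alpha> by (auto simp: inj_on_def)
      have "f ` \<alpha> ` B0 = wv ` B0" using f\<alpha> by (auto simp: image_image)
      moreover have "f ` V' \<subseteq> P \<union> Q \<union> \<phi>0 ` B0" using fV' f1P by auto
      ultimately have "f ` V' \<inter> f ` \<alpha> ` B0 = {}" using disj(3) by blast
      then show ?thesis unfolding V\<Lambda> inj_on_Un using 1 2 by blast
    qed
    moreover have "f ` (A - \<Lambda>' - \<alpha> ` B0) \<subseteq> P"
    proof
      fix y assume "y \<in> f ` (A - \<Lambda>' - \<alpha> ` B0)"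
      then obtain a where a: "a \<in> A" "a \<notin> \<Lambda>'" "a \<notin> \<alpha> ` B0" "y = f a" by blast
      then have "a \<in> V'" "a \<notin> B" using AB by (auto simp: V'_def \<Lambda>'_def)
      then show "y \<in> P" using a f1(3)[of a] fV' P1 B0 by (auto simp: \<Gamma>_def)
    qed
    moreover have "\<forall>b\<in>B. f b = f1 b" using fV' BV' by auto
    moreover have "adj (f (par t)) (f t)" if t: "t \<in> V - \<Lambda>'" "t \<noteq> r" for t
    proof (cases "t \<in> V'")
      case True
      then show ?thesis using f1(4)[of t] fV' I.par_in[of t] that by simp
    next
      case False
      then obtain b where b: "b \<in> B0" "t = \<alpha> b" using t(1) unfolding V\<Lambda> by auto
      then have "f (par t) = \<phi>0 b" using \<alpha> fV'[of b] f1(2) B0 BV' by auto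
      then show ?thesis using b f\<alpha> wv(2) by simp
    qed
    ultimately have "Good \<Lambda>' f" using f\<alpha> by (simp add: Good_def)
    then show ?case by auto
  next
    case (Suc m)
    then obtain D0 f where f: "card D0 = card \<Lambda>' - m" "Good D0 f" by blast
    show ?case
    proof (cases "D0 = {}")
      case True
      then show ?thesis using f by (intro exI[of _ D0] exI[of _ f]) auto
    next
      case False
      note g = f(2)[unfolded Good_def]
      have D0\<Lambda>: "D0 \<subseteq> \<Lambda>'" "D0 \<subseteq> A" using g by (auto simp: \<Lambda>'_def \<Lambda>_def)
      have finD0: "finite D0" using D0\<Lambda> finPQ\<Lambda> finite_subset by blast
      define G where "G u = {a \<in> A - \<alpha> ` B0. \<forall>b\<in>B. {a, b} \<in> edges \<longrightarrow> adj u (f b)}" for u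
      define N where "N = {u \<in> P. D < card (G u)}"
      have BD0: "B \<subseteq> V - D0" using D0\<Lambda> AB by auto
      have "card A \<le> card B0 + card N"
        unfolding N_def G_def
      proof (rule cover)
        show "inj_on f B" using g BD0 inj_on_subset by blast
        show "f ` B \<subseteq> Q \<union> \<phi>0 ` B0" using g f1B by auto
        show "f b = \<phi>0 b" if "b \<in> B0" for b using g f1(2) that B0 by auto
      qed
      moreover have "card (f ` (A - D0 - \<alpha> ` B0)) < card A - card B0"
      proof -
        have "card (A - D0 - \<alpha> ` B0) = card A - card D0 - card B0"
        proof -
          have "A - D0 - \<alpha> ` B0 = A - (D0 \<union> \<alpha> ` B0)" by blast
          moreover have "card (D0 \<union> \<alpha> ` B0) = card D0 + card B0"
            using D0\<Lambda> finD0 finB0 card_image[OF inj\<alpha>] by (subst card_Un_disjoint) (auto simp: \<Lambda>'_def)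
          moreover have "D0 \<union> \<alpha> ` B0 \<subseteq> A" using D0\<Lambda> \<alpha> by auto
          ultimately show ?thesis using finD0 finB0 by (simp add: card_Diff_subset)
        qed
        moreover have "card D0 > 0" using False finD0 by (simp add: card_gt_0_iff)
        moreover have "card D0 + card B0 \<le> card A"
        proof -
          have "card (D0 \<union> \<alpha> ` B0) = card D0 + card B0"
            using D0\<Lambda> finD0 finB0 card_image[OF inj\<alpha>] by (subst card_Un_disjoint) (auto simp: \<Lambda>'_def)
          moreover have "D0 \<union> \<alpha> ` B0 \<subseteq> A" using D0\<Lambda> \<alpha> by auto
          ultimately show ?thesis using card_mono[OF finA] by metis
        qed
        ultimately show ?thesis using card_image_le[of "A - D0 - \<alpha> ` B0" f] finA by simp
      qed
      ultimately have "card (f ` (A - D0 - \<alpha> ` B0)) < card N" by linarith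
      moreover have "finite (f ` (A - D0 - \<alpha> ` B0))" using finA by simp
      ultimately obtain u where u: "u \<in> N" "u \<notin> f ` (A - D0 - \<alpha> ` B0)"
        by (meson card_mono leD subsetI)
      have uP: "u \<in> P" using u by (simp add: N_def)
      have unew: "u \<notin> f ` (V - D0)"
      proof
        assume "u \<in> f ` (V - D0)"
        then obtain t where t: "t \<in> V - D0" "u = f t" by blast
        consider "t \<in> B" | "t \<in> \<alpha> ` B0" | "t \<in> A - D0 - \<alpha> ` B0" using t AB by auto
        then show False
        proof cases
          case 1
          then have "u \<in> Q \<union> \<phi>0 ` B0" using g f1B t by auto
          then show False using uP disj by auto
        next
          case 2
          then have "u \<in> wv ` B0" using g t by auto
          then show False using uP disj by auto
        next
          case 3
          then show False using u t by auto
        qed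
      qed
      have fpB: "f (par a) \<in> Q \<union> \<phi>0 ` B0" if "a \<in> A" for a
      proof -
        have "a \<noteq> r" "a \<in> V" using that AB bip(2) by auto
        then have "par a \<in> B" using parAB that by blast
        then show ?thesis using g f1B by simp
      qed
      have card1: "card (D0 - {a}) = card \<Lambda>' - Suc m" if "a \<in> D0" for a
        using that f(1) finD0 by simp
      have leafD: "par t \<noteq> a" if "a \<in> D0" "t \<in> V" "t \<noteq> r" for a t
        using leafpar[of t] that D0\<Lambda> by (auto simp: \<Lambda>'_def)
      show ?thesis
      proof (cases "\<exists>a\<in>D0. adj (f (par a)) u")
        case True
        then obtain a where a: "a \<in> D0" "adj (f (par a)) u" by blast
        have aA: "a \<in> A" "a \<notin> B" "a \<notin> \<alpha> ` B0" using a D0\<Lambda> AB by (auto simp: \<Lambda>'_def)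
        have VD: "V - (D0 - {a}) = insert a (V - D0)" using aA AB by auto
        define f' where "f' = f(a := u)"
        have "inj_on f' (V - (D0 - {a}))"
          unfolding VD using g unew a by (auto simp: f'_def inj_on_fun_updI)
        moreover have "f' ` (A - (D0 - {a}) - \<alpha> ` B0) \<subseteq> P" using g uP by (auto simp: f'_def)
        moreover have "\<forall>b\<in>B. f' b = f1 b" using g aA by (auto simp: f'_def)
        moreover have "\<forall>b\<in>B0. f' (\<alpha> b) = wv b" using g aA by (auto simp: f'_def)
        moreover have "\<forall>t\<in>V - (D0 - {a}). t \<noteq> r \<longrightarrow> adj (f' (par t)) (f' t)"
        proof -
          have "par t \<noteq> a" if "t \<in> V" "t \<noteq> r" for t using leafD[OF a(1) that] .
          moreover have "a \<in> V" using aA AB by auto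
          ultimately show ?thesis using g a unfolding VD f'_def by simp
        qed
        ultimately have "Good (D0 - {a}) f'" using D0\<Lambda> by (auto simp: Good_def)
        then show ?thesis using card1[OF a(1)] by blast
      next
        case nadj: False
        obtain a where a: "a \<in> D0" using False by blast
        have aA: "a \<in> A" "a \<notin> B" "a \<notin> \<alpha> ` B0" "a \<noteq> r" using a D0\<Lambda> AB bip(2) by (auto simp: \<Lambda>'_def)
        \<comment> \<open>A missing leaf in \<open>G u\<close> could be placed at \<open>u\<close>
          directly, so in this case every vertex of \<open>G u\<close> already has an image to give
          up.\<close>
        have GD: "G u \<inter> D0 = {}"
        proof -
          have False if "x \<in> G u" "x \<in> D0" for x
          proof -
            have xA: "x \<in> A" "x \<in> V" "x \<noteq> r" using that D0\<Lambda> AB bip(2) by auto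
            then have "par x \<in> B" "{x, par x} \<in> edges" using parAB by (auto simp: edges_def)
            then have "adj u (f (par x))" using that(1) by (auto simp: G_def)
            then show False using nadj that(2) sym by blast
          qed
          then show ?thesis by blast
        qed
        have GA: "G u \<subseteq> A - D0 - \<alpha> ` B0" using GD by (auto simp: G_def)
        have "card (f ` G u) = card (G u)"
          using g GA AB by (intro card_image) (auto intro: inj_on_subset)
        then have "card {p \<in> P. \<not> adj (f (par a)) p} < card (f ` G u)"
          using D[OF fpB[OF aA(1)]] u by (simp add: N_def)
        moreover have "f ` G u \<subseteq> P" using g GA by blast
        ultimately have "\<not> f ` G u \<subseteq> {p \<in> P. \<not> adj (f (par a)) p}"
          using finPQ card_mono[of "{p \<in> P. \<not> adj (f (par a)) p}" "f ` G u"] by auto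
        then obtain a' where a': "a' \<in> G u" "adj (f (par a)) (f a')" using \<open>f ` G u \<subseteq> P\<close> by blast
        have a'A: "a' \<in> A" "a' \<notin> D0" "a' \<notin> \<alpha> ` B0" "a' \<notin> B" "a' \<noteq> a" "a' \<noteq> r" "a' \<in> V"
          using a' GA a AB bip(2) by auto
        have VD: "V - (D0 - {a}) = insert a (V - D0)" using aA AB by auto
        define f' where "f' = f(a := f a', a' := u)"
        have "inj_on f' (V - (D0 - {a}))"
        proof -
          have "inj_on (f(a' := u)) (V - D0)" using g unew by (auto simp: inj_on_fun_updI)
          moreover have "f a' \<notin> (f(a' := u)) ` (V - D0)"
          proof
            assume "f a' \<in> (f(a' := u)) ` (V - D0)"
            then obtain t where t: "t \<in> V - D0" "f a' = (f(a' := u)) t" by blast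
            then have "t \<noteq> a'" using unew a'A by (metis DiffI fun_upd_same image_eqI)
            then show False using t g a'A by (auto simp: inj_on_def)
          qed
          moreover have "\<forall>t\<in>V - D0. f' t = (f(a' := u)) t" using a a'A by (auto simp: f'_def)
          then have "inj_on f' (V - D0) = inj_on (f(a' := u)) (V - D0)" "f' ` (V - D0) = (f(a' := u)) ` (V - D0)"
            by (auto intro!: inj_on_cong image_cong)
          moreover have "f' a = f a'" "a \<notin> V - D0" using a a'A by (auto simp: f'_def)
          ultimately show ?thesis unfolding VD inj_on_insert by simp
        qed
        moreover have "f' ` (A - (D0 - {a}) - \<alpha> ` B0) \<subseteq> P"
          using g uP a'A by (auto simp: f'_def)
        moreover have "\<forall>b\<in>B. f' b = f1 b" using g aA a'A by (auto simp: f'_def)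
        moreover have "\<forall>b\<in>B0. f' (\<alpha> b) = wv b" using g aA a'A by (auto simp: f'_def)
        moreover have "adj (f' (par t)) (f' t)" if t: "t \<in> V - (D0 - {a})" "t \<noteq> r" for t
        proof -
          have tV: "t \<in> V" using t by auto
          have pa: "par t \<noteq> a" using leafD[OF a tV t(2)] .
          consider "t = a" | "t = a'" | "t \<noteq> a" "t \<noteq> a'" "par t = a'" | "t \<noteq> a" "t \<noteq> a'" "par t \<noteq> a'" by blast
          then show ?thesis
          proof cases
            case 1
            then have "par a \<noteq> a'" using parAB[of a] aA a'A AB by auto
            then show ?thesis using 1 a' pa a'A by (auto simp: f'_def)
          next
            case 2
            then have "par a' \<in> B" "{a', par a'} \<in> edges" using parAB[of a'] a'A by (auto simp: edges_def)
            then have "adj u (f (par a'))" using a'(1) by (auto simp: G_def)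
            moreover have "par a' \<noteq> a'" using \<open>par a' \<in> B\<close> a'A by auto
            ultimately show ?thesis using 2 pa sym by (auto simp: f'_def)
          next
            case 3
            then have "t \<in> B" "{a', t} \<in> edges"
              using parAB[of t] a'A tV t(2) by (auto simp: edges_def insert_commute)
            then have "adj u (f t)" using a'(1) by (auto simp: G_def)
            then show ?thesis using 3 by (auto simp: f'_def)
          next
            case 4
            then have "t \<in> V - D0" using t by auto
            then show ?thesis using g 4 pa t(2) by (auto simp: f'_def)
          qed
        qed
        ultimately have "Good (D0 - {a}) f'" using D0\<Lambda> by (auto simp: Good_def)
        then show ?thesis using card1[OF a] by blast
      qed
    qed
  qed
  from this[of "card \<Lambda>'"] obtain D0 f where f: "card D0 = 0" "Good D0 f" by auto
  have "D0 = {}" using f finPQ\<Lambda> finite_subset[of D0 \<Lambda>'] by (auto simp: Good_def)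
  note g = f(2)[unfolded Good_def this]
  have "f t \<in> P \<union> Q \<union> \<phi>0 ` B0 \<union> wv ` B0" if t: "t \<in> V" for t
  proof -
    consider "t \<in> B" | "t \<in> \<alpha> ` B0" | "t \<in> A - {} - \<alpha> ` B0" using t AB by auto
    then show ?thesis using g f1B by cases auto
  qed
  then show ?thesis using g by (intro exI[of _ f]) auto
qed

end


section \<open>Blue copies: two cut vertices, and two cliques sharing a vertex\<close>

definition embeds :: "('a \<Rightarrow> 'a \<Rightarrow> bool) \<Rightarrow> 'b set \<Rightarrow> 'b set set \<Rightarrow> 'a set \<Rightarrow> bool" where
  "embeds adj VT ET V \<longleftrightarrow> (\<exists>f. inj_on f VT \<and> f ` VT \<subseteq> V \<and> (\<forall>u v. {u, v} \<in> ET \<longrightarrow> adj (f u) (f v)))"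

lemma (in rooted_tree) embedsI:
  assumes "\<And>u v. adj u v \<Longrightarrow> adj v u" "inj_on f V" "f ` V \<subseteq> X"
    "\<And>t. t \<in> V \<Longrightarrow> t \<noteq> r \<Longrightarrow> adj (f (par t)) (f t)"
  shows "embeds adj V edges X"
proof -
  have "adj (f u) (f v)" if "{u, v} \<in> edges" for u v
    using edge_cases[OF that] assms(1,4) by blast
  then show ?thesis using assms unfolding embeds_def by blast
qed

lemma subset_avoiding:
  assumes "finite X" "finite Y" "k + card Y \<le> card X"
  obtains R where "R \<subseteq> X - Y" "card R = k" "finite R"
proof -
  have "k \<le> card (X - Y)" using diff_card_le_card_Diff[OF assms(2), of X] assms(3) by linarith
  then show ?thesis using that obtain_subset_with_card_n by metis
qed

lemma card_neighbours_le_degree: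
  assumes "finite E"
  shows "finite {t. {t, y} \<in> E}" "card {t. {t, y} \<in> E} \<le> degree E y"
proof -
  have inj: "inj_on (\<lambda>t. {t, y}) {t. {t, y} \<in> E}" by (auto simp: inj_on_def doubleton_eq_iff)
  have sub: "(\<lambda>t. {t, y}) ` {t. {t, y} \<in> E} \<subseteq> {e \<in> E. y \<in> e}" by auto
  have fin: "finite {e \<in> E. y \<in> e}" using assms by simp
  show "finite {t. {t, y} \<in> E}" using inj_on_finite[OF inj sub fin] .
  show "card {t. {t, y} \<in> E} \<le> degree E y" unfolding degree_def using card_inj_on_le[OF inj sub fin] .
qed

text \<open>The part \<open>S\<close> of a balanced split goes to \<open>U2\<close>, the rest to \<open>U1\<close>; the two cut vertices go
  to \<open>v1\<close> and \<open>v2\<close>, whose few neighbours in \<open>U2\<close> suffice for the cut edges.\<close>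

lemma embedding_through_two_vertices:
  fixes adj :: "'a \<Rightarrow> 'a \<Rightarrow> bool"
  assumes T: "tree VT E" and n: "card VT = n" "10^8 \<le> n"
    and deg: "\<And>v. v \<in> VT \<Longrightarrow> real (degree E v) \<le> \<Delta>" "\<Delta> \<le> real n / 10^6"
    and A: "A \<subseteq> VT" "0.666 * real n \<le> real (card A)"
    and H: "finite H" "real (card {a \<in> A. \<forall>h\<in>H. {a, h} \<notin> E}) \<le> 0.011 * real n"
    and \<kappa>: "card H + 2 \<le> \<kappa> \<or> 2 * \<Delta> + 2 \<le> real \<kappa>"
    and sym: "\<And>u v. adj u v \<Longrightarrow> adj v u" and irr: "\<And>u. \<not> adj u u"
    and U: "finite U1" "finite U2" "U1 \<inter> U2 = {}" "0.666 * real n \<le> real (card U1)" "0.666 * real n \<le> real (card U2)"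
    and d: "\<And>u. u \<in> U1 \<Longrightarrow> real (card {q \<in> U1. \<not> adj u q}) \<le> real n / 10^5"
           "\<And>u. u \<in> U2 \<Longrightarrow> real (card {q \<in> U2. \<not> adj u q}) \<le> real n / 10^5"
    and v: "v1 \<noteq> v2" "\<And>v. v \<in> {v1, v2} \<Longrightarrow> real n / 500 \<le> real (card {u \<in> U1. adj v u})"
      "\<And>v. v \<in> {v1, v2} \<Longrightarrow> \<kappa> \<le> card {u \<in> U2. adj v u}"
    and u0: "u0 \<in> U1" "adj v1 u0" "adj v2 u0"
  shows "embeds adj VT E (U1 \<union> U2 \<union> {v1, v2})"
proof -
  obtain r par rk y1 y2 Z S where R: "rooted_tree VT r par rk" and E': "rooted_tree.edges VT r par = E"
    and y: "y1 \<in> VT" "y2 \<in> VT" "y1 \<noteq> y2" "{y1, y2} \<notin> E"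
    and Z: "\<And>z. z \<in> Z \<Longrightarrow> z \<in> VT \<and> z \<noteq> r \<and> (par z = y1 \<or> par z = y2)"
    and S: "S = (\<Union>z\<in>Z. rooted_tree.desc VT r par z)" "y1 \<notin> S" "y2 \<notin> S"
    and cZ: "card Z \<le> card H" "real (card Z) \<le> 2 * \<Delta>"
    and cS: "(1/3 + 1/200) * real n \<le> real (card S)" "real (card S) \<le> (2/3 - 1/200) * real n"
    and common: "\<And>t. {t, y1} \<in> E \<Longrightarrow> {t, y2} \<in> E \<Longrightarrow> t = r \<or> par t = y1 \<or> par t = y2"
  proof (rule balanced_split[OF T n _ deg(2) A H])
    show "real (degree E v) \<le> \<Delta>" if "v \<in> VT" for v using deg(1)[OF that] .
  qed (rule that, assumption+)
  interpret rooted_tree VT r par rk by fact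
  have E: "E = edges" using E' by simp
  have n0: "real n \<ge> 10^8" using of_nat_mono[OF n(2), where 'a = real] by simp
  have finE: "finite E" using fin by (simp add: E edges_def)
  have finZ: "finite Z" using Z fin by (meson finite_subset subsetI)
  have SV: "S \<subseteq> VT" using desc_subset by (auto simp: S)
  have finS: "finite S" using SV fin finite_subset by blast
  have edge: "{t, par t} \<in> E" "{par t, t} \<in> E" if "t \<in> VT" "t \<noteq> r" for t
    using that by (auto simp: E edges_def insert_commute)
  have Zdesc: "z \<in> S" if "z \<in> Z" for z using that Z desc_self by (auto simp: S)
  have rS: "r \<notin> S" using Z desc_par by (force simp: S)
  have Sdown: "t \<in> S" if "t \<in> VT" "t \<noteq> r" "par t \<in> S" for t
    using that desc_step by (auto simp: S)
  have Sup: "t \<in> Z \<or> par t \<in> S" if "t \<in> S" for t using that desc_par by (auto simp: S)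
  define N where "N y = {t. {t, y} \<in> E}" for y
  have cN: "finite (N y)" "real (card (N y)) \<le> \<Delta>" if "y \<in> VT" for y
    using card_neighbours_le_degree[OF finE, of y] deg(1)[OF that] by (auto simp: N_def)
  define Z1 where "Z1 = {z \<in> Z. par z = y1}"
  define Z2 where "Z2 = {z \<in> Z. par z = y2}"
  have cZ12: "card Z1 + card Z2 = card Z"
    using Z y(3) finZ by (subst card_Un_disjoint[symmetric]) (auto simp: Z1_def Z2_def intro!: arg_cong[of _ _ card])
  have cZ\<kappa>: "card Z + 2 \<le> \<kappa>"
    using \<kappa>
  proof
    assume "2 * \<Delta> + 2 \<le> real \<kappa>"
    then have "real (card Z + 2) \<le> real \<kappa>" using cZ(2) by simp
    then show ?thesis by linarith
  qed (use cZ in simp)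
  have d0: "\<Delta> \<ge> 0" using cN(2)[OF y(1)] by linarith
  \<comment> \<open>Two disjoint sets of size \<open>n/2000\<close> fit into the
    \<open>n/500\<close> neighbours of \<open>v2\<close>, and each exceeds the maximum degree plus
    the \<open>n/10^5\<close> non-neighbours that any vertex of \<open>U1\<close> may have.\<close>
  define \<rho> where "\<rho> = nat \<lfloor>real n / 2000\<rfloor>"
  have \<rho>: "real \<rho> \<le> real n / 2000" "real n / 2000 - 1 \<le> real \<rho>"
    unfolding \<rho>_def by linarith+
  define L1 where "L1 v = {u \<in> U1. adj v u}" for v
  define L2 where "L2 v = {u \<in> U2. adj v u}" for v
  have finL: "finite (L1 v)" "finite (L2 v)" for v using U by (auto simp: L1_def L2_def)
  have c2: "card {a, b} \<le> 2" for a b :: 'a by (simp add: card_insert_if)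
  obtain R1 where R1: "R1 \<subseteq> L1 v1 - {v2, u0}" "card R1 = \<rho>" "finite R1"
  proof (rule subset_avoiding[of "L1 v1" "{v2, u0}" \<rho>])
    have "real (\<rho> + card {v2, u0}) \<le> real (card (L1 v1))"
      using v(2)[of v1] c2[of v2 u0] \<rho> n0 unfolding L1_def by simp
    then show "\<rho> + card {v2, u0} \<le> card (L1 v1)" by linarith
  qed (use finL in auto)
  obtain R1' where R1': "R1' \<subseteq> L1 v2 - ({v1, u0} \<union> R1)" "card R1' = \<rho>" "finite R1'"
  proof (rule subset_avoiding[of "L1 v2" "{v1, u0} \<union> R1" \<rho>])
    have "card ({v1, u0} \<union> R1) \<le> 2 + \<rho>" using card_Un_le[of "{v1, u0}" R1] c2[of v1 u0] R1 by linarith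
    then have "real (\<rho> + card ({v1, u0} \<union> R1)) \<le> real (card (L1 v2))"
      using v(2)[of v2] \<rho> n0 unfolding L1_def by simp
    then show "\<rho> + card ({v1, u0} \<union> R1) \<le> card (L1 v2)" by linarith
  qed (use finL R1 in auto)
  \<comment> \<open>Exactly as many neighbours are reserved in \<open>U2\<close> as edges are cut.
    There is no slack, and none is lost: these children have their parent preassigned, so every
    reserved vertex is admissible.\<close>
  obtain R2 where R2: "R2 \<subseteq> L2 v1 - {v2}" "card R2 = card Z1" "finite R2"
  proof (rule subset_avoiding[of "L2 v1" "{v2}" "card Z1"])
    show "card Z1 + card {v2} \<le> card (L2 v1)"
      using v(3)[of v1] cZ\<kappa> cZ12 unfolding L2_def by simp
  qed (use finL in auto)
  obtain R2' where R2': "R2' \<subseteq> L2 v2 - ({v1} \<union> R2)" "card R2' = card Z2" "finite R2'"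
  proof (rule subset_avoiding[of "L2 v2" "{v1} \<union> R2" "card Z2"])
    show "card Z2 + card ({v1} \<union> R2) \<le> card (L2 v2)"
      using v(3)[of v2] cZ\<kappa> cZ12 card_Un_le[of "{v1}" R2] R2 unfolding L2_def by simp
  qed (use finL R2 in auto)
  define X1 where "X1 = U1 - (R1 \<union> R1' \<union> {u0, v1, v2})"
  define X2 where "X2 = U2 - (R2 \<union> R2' \<union> {v1, v2})"
  \<comment> \<open>\<open>N\<close> contains the parent of a cut vertex as well as its children. A
    common neighbour of both cut vertices must be sent to a common neighbour of \<open>v1\<close>
    and \<open>v2\<close>, which is \<open>u0\<close>.\<close>
  define \<Gamma> where "\<Gamma> t = (if t \<in> S then (if par t = y1 then R2 else if par t = y2 then R2' else X2)
     else if t \<in> N y1 \<and> t \<in> N y2 then {u0} else if t \<in> N y1 then R1 else if t \<in> N y2 then R1' else X1)" for t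
  define \<phi> where "\<phi> = (\<lambda>y. if y = y1 then v1 else v2)"
  have R1sub: "R1 \<subseteq> U1" "R1' \<subseteq> U1" "R2 \<subseteq> U2" "R2' \<subseteq> U2" "X1 \<subseteq> U1" "X2 \<subseteq> U2"
    using R1 R1' R2 R2' by (auto simp: L1_def L2_def X1_def X2_def)
  have \<Gamma>S: "\<Gamma> t \<subseteq> U2" if "t \<in> S" for t using that R1sub by (auto simp: \<Gamma>_def)
  have \<Gamma>nS: "\<Gamma> t \<subseteq> U1" if "t \<notin> S" for t using that R1sub u0 by (auto simp: \<Gamma>_def)
  have selfno: "v1 \<notin> L1 v1" "v2 \<notin> L1 v2" "v1 \<notin> L2 v1" "v2 \<notin> L2 v2" using irr by (auto simp: L1_def L2_def)
  have u0v: "u0 \<noteq> v1" "u0 \<noteq> v2" using u0 irr by auto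
  have av: "\<Gamma> t \<inter> {v1, v2} = {}" for t
    using R1 R1' R2 R2' selfno u0v by (auto simp: \<Gamma>_def X1_def X2_def)
  have disj12: "R1 \<inter> R1' = {}" "R2 \<inter> R2' = {}" "u0 \<notin> R1" "u0 \<notin> R1'" "X1 \<inter> R1 = {}" "X1 \<inter> R1' = {}"
    "u0 \<notin> X1" "X2 \<inter> R2 = {}" "X2 \<inter> R2' = {}"
    using R1 R1' R2 R2' by (auto simp: X1_def X2_def)
  have noZ: "t \<in> Z" if "t \<in> S" "par t = y1 \<or> par t = y2" for t using Sup[OF that(1)] that(2) S(2,3) by auto
  define Oth where "Oth t = {s \<in> VT - {y1, y2}. s \<noteq> t \<and> \<Gamma> s \<inter> \<Gamma> t \<noteq> {}}" for t
  have OS: "Oth t \<subseteq> S - {t}" if "t \<in> S" for t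
    using \<Gamma>S[OF that] \<Gamma>nS U(3) by (auto simp: Oth_def)
  have OnS: "Oth t \<subseteq> VT - S - {t}" if "t \<notin> S" for t
    using \<Gamma>S \<Gamma>nS[OF that] U(3) by (auto simp: Oth_def)
  have cX2: "real (card S) + real n / 10^5 < real (card X2)"
  proof -
    have "real (card Z) \<le> 2 * real n / 10^6" using cZ deg by linarith
    moreover have "card (R2 \<union> R2' \<union> {v1, v2}) \<le> card Z + 2"
      using card_Un_le[of "R2 \<union> R2'" "{v1, v2}"] card_Un_le[of R2 R2'] c2[of v1 v2] R2 R2' cZ12 by linarith
    moreover have "card U2 \<le> card X2 + card (R2 \<union> R2' \<union> {v1, v2})"
      unfolding X2_def using diff_card_le_card_Diff[of "R2 \<union> R2' \<union> {v1, v2}" U2] R2 R2' by simp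
    ultimately show ?thesis using U(5) cS(2) n0 by simp
  qed
  have cVS: "card (VT - S) = n - card S" using n SV finS by (simp add: card_Diff_subset)
  have cX1: "real (card (VT - S)) + real n / 10^5 < real (card X1)"
  proof -
    have "card {u0, v1, v2} \<le> 3" by (simp add: card_insert_if)
    then have "card (R1 \<union> R1' \<union> {u0, v1, v2}) \<le> 2 * \<rho> + 3"
      using card_Un_le[of "R1 \<union> R1'" "{u0, v1, v2}"] card_Un_le[of R1 R1'] R1 R1' by linarith
    moreover have "card U1 \<le> card X1 + card (R1 \<union> R1' \<union> {u0, v1, v2})"
      unfolding X1_def using diff_card_le_card_Diff[of "R1 \<union> R1' \<union> {u0, v1, v2}" U1] R1 R1' by simp
    moreover have "real (card (VT - S)) = real n - real (card S)"
      using cVS cS n0 by simp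
    ultimately show ?thesis using U(4) cS(1) n0 \<rho> by simp
  qed
  have good_nbrs: "real (card X) - real n / 10^5 \<le> real (card {q \<in> X. adj p q})"
    if "real (card {q \<in> U. \<not> adj p q}) \<le> real n / 10^5" "finite U" "X \<subseteq> U" for X U p
  proof -
    have "X = {q \<in> X. adj p q} \<union> {q \<in> X. \<not> adj p q}" by blast
    then have "card X \<le> card {q \<in> X. adj p q} + card {q \<in> X. \<not> adj p q}" by (metis card_Un_le)
    moreover have "card {q \<in> X. \<not> adj p q} \<le> card {q \<in> U. \<not> adj p q}"
      using that by (intro card_mono) auto
    ultimately show ?thesis using that(1) by linarith
  qed
  have NtoV: "t \<in> VT" if "t \<in> N y" for t y using that edge_cases(1)[of t y] by (auto simp: N_def E)
  have Ncase: "(t \<noteq> r \<and> par t = y) \<or> (y \<noteq> r \<and> par y = t)" if "t \<in> N y" for t y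
    using that edge_cases(3)[of t y] by (auto simp: N_def E)
  \<comment> \<open>Two common neighbours would form a 4-cycle with \<open>y1\<close> and
    \<open>y2\<close>; here the ranks exclude it.\<close>
  have single: "s = t" if st: "s \<in> N y1" "s \<in> N y2" "t \<in> N y1" "t \<in> N y2" for s t
  proof (rule ccontr)
    assume "s \<noteq> t"
    have rk1: "par t = y \<Longrightarrow> t \<noteq> r \<Longrightarrow> t \<in> VT \<Longrightarrow> rk y < rk t" for t y using par_rk by blast
    have "s \<in> VT" "t \<in> VT" using NtoV st by auto
    then show False
      using \<open>s \<noteq> t\<close> Ncase[OF st(1)] Ncase[OF st(2)] Ncase[OF st(3)] Ncase[OF st(4)] y(1-3)
        rk1[of s y1] rk1[of s y2] rk1[of t y1] rk1[of t y2] rk1[of y1 s] rk1[of y2 s] rk1[of y1 t] rk1[of y2 t]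
      by (elim disjE) simp_all
  qed
  have Oth1: "card (Oth t) < card (\<Gamma> t)" if t: "t \<in> S" "par t = y1 \<or> par t = y2" for t
  proof -
    have tZ: "t \<in> Z" using noZ[OF t] .
    show ?thesis
    proof (cases "par t = y1")
      case True
      have "Oth t \<subseteq> Z1 - {t}"
      proof
        fix s assume s: "s \<in> Oth t"
        then have "s \<in> S" "s \<noteq> t" using OS[OF t(1)] by auto
        moreover have "\<Gamma> s \<inter> R2 \<noteq> {}" using s True t by (auto simp: Oth_def \<Gamma>_def)
        ultimately have "par s = y1" using disj12 by (auto simp: \<Gamma>_def split: if_splits)
        then show "s \<in> Z1 - {t}" using noZ[OF \<open>s \<in> S\<close>] \<open>s \<noteq> t\<close> by (auto simp: Z1_def)
      qed
      moreover have "t \<in> Z1" "finite Z1" using tZ True finZ by (auto simp: Z1_def)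
      ultimately have "card (Oth t) < card Z1" by (intro psubset_card_mono) auto
      then show ?thesis using True t R2 by (simp add: \<Gamma>_def)
    next
      case False
      then have p2: "par t = y2" using t by simp
      have "Oth t \<subseteq> Z2 - {t}"
      proof
        fix s assume s: "s \<in> Oth t"
        then have "s \<in> S" "s \<noteq> t" using OS[OF t(1)] by auto
        moreover have "\<Gamma> s \<inter> R2' \<noteq> {}" using s p2 y(3) t by (auto simp: Oth_def \<Gamma>_def)
        ultimately have "par s = y2" using disj12 by (auto simp: \<Gamma>_def split: if_splits)
        then show "s \<in> Z2 - {t}" using noZ[OF \<open>s \<in> S\<close>] \<open>s \<noteq> t\<close> by (auto simp: Z2_def)
      qed
      moreover have "t \<in> Z2" "finite Z2" using tZ p2 finZ by (auto simp: Z2_def)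
      ultimately have "card (Oth t) < card Z2" by (intro psubset_card_mono) auto
      then show ?thesis using p2 y(3) t R2' by (simp add: \<Gamma>_def)
    qed
  qed
  have Oth2: "real (card (Oth t)) + real n / 10^5 < real (card (\<Gamma> t))" "\<Gamma> t = X2"
    if t: "t \<in> S" "par t \<noteq> y1" "par t \<noteq> y2" for t
  proof -
    have "card (Oth t) \<le> card S" using OS[OF t(1)] finS by (intro card_mono) auto
    moreover show "\<Gamma> t = X2" using t by (simp add: \<Gamma>_def)
    ultimately show "real (card (Oth t)) + real n / 10^5 < real (card (\<Gamma> t))" using cX2 by simp
  qed
  have Oth3: "Oth t = {}" "\<Gamma> t = {u0}" if t: "t \<notin> S" "t \<in> N y1" "t \<in> N y2" for t
  proof -
    show "\<Gamma> t = {u0}" using t by (simp add: \<Gamma>_def)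
    then have "s = t" if s: "s \<in> Oth t" for s
    proof -
      have "s \<notin> S" "u0 \<in> \<Gamma> s" using s OnS[OF t(1)] \<open>\<Gamma> t = {u0}\<close> by (auto simp: Oth_def)
      then have "s \<in> N y1 \<and> s \<in> N y2" using disj12 by (simp add: \<Gamma>_def split: if_splits)
      then show ?thesis using single t(2,3) by blast
    qed
    then show "Oth t = {}" by (auto simp: Oth_def)
  qed
  have Oth4: "real (card (Oth t)) + real n / 10^5 < real (card (\<Gamma> t))"
    if t: "t \<notin> S" "t \<notin> N y1 \<or> t \<notin> N y2" for t
  proof (cases "t \<in> N y1 \<or> t \<in> N y2")
    case False
    have "card (Oth t) \<le> card (VT - S)" using OnS[OF t(1)] fin by (intro card_mono) auto
    moreover have "\<Gamma> t = X1" using False t by (auto simp: \<Gamma>_def)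
    ultimately show ?thesis using cX1 by simp
  next
    case True
    define y where "y = (if t \<in> N y1 then y1 else y2)"
    have "Oth t \<subseteq> N y"
    proof
      fix s assume s: "s \<in> Oth t"
      then have "s \<notin> S" "\<Gamma> s \<inter> \<Gamma> t \<noteq> {}" using OnS[OF t(1)] by (auto simp: Oth_def)
      moreover have "\<Gamma> t = (if t \<in> N y1 then R1 else R1')" using t True by (auto simp: \<Gamma>_def)
      ultimately show "s \<in> N y" using disj12 by (simp add: \<Gamma>_def y_def Int_commute split: if_splits)
    qed
    moreover have "y \<in> VT" using y by (auto simp: y_def)
    ultimately have "real (card (Oth t)) \<le> \<Delta>" using cN[of y] card_mono[of "N y" "Oth t"] by linarith
    moreover have "card (\<Gamma> t) = \<rho>" using True t R1 R1' by (auto simp: \<Gamma>_def)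
    ultimately show ?thesis using \<rho> deg(2) n0 by simp
  qed
  have \<phi>: "\<phi> y1 = v1" "\<phi> y2 = v2" using y by (auto simp: \<phi>_def)
  have N1: "q \<in> \<Gamma> t \<Longrightarrow> adj v1 q" if "t \<notin> S" "t \<in> N y1" for t q
    using that R1 u0 by (auto simp: \<Gamma>_def L1_def split: if_splits)
  have N2: "q \<in> \<Gamma> t \<Longrightarrow> adj v2 q" if "t \<notin> S" "t \<in> N y2" for t q
    using that R1' u0 by (auto simp: \<Gamma>_def L1_def split: if_splits)
  obtain f where f: "inj_on f VT" "\<And>t. t \<in> {y1, y2} \<Longrightarrow> f t = \<phi> t"
    "\<And>t. t \<in> VT - {y1, y2} \<Longrightarrow> f t \<in> \<Gamma> t" "\<And>t. t \<in> VT \<Longrightarrow> t \<noteq> r \<Longrightarrow> adj (f (par t)) (f t)"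
  proof (rule greedy_embedding[of "{y1, y2}" \<phi> \<Gamma> adj])
    show "{y1, y2} \<subseteq> VT" using y by auto
    show "inj_on \<phi> {y1, y2}" using y v \<phi> by (auto simp: inj_on_def)
    show "\<phi> s \<notin> \<Gamma> t" if "t \<in> VT - {y1, y2}" "s \<in> {y1, y2}" for t s
      using that av[of t] \<phi> by auto
    show "card {s \<in> VT - {y1, y2}. s \<noteq> t \<and> \<Gamma> s \<inter> \<Gamma> t \<noteq> {}} < card (\<Gamma> t)"
      if "t \<in> VT - {y1, y2}" for t
    proof -
      have n5: "0 \<le> real n / 10^5" by simp
      have "card (Oth t) < card (\<Gamma> t)"
      proof (cases "t \<in> S")
        case True
        then show ?thesis using Oth1[of t] Oth2(1)[of t] n5 by (cases "par t = y1 \<or> par t = y2") auto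
      next
        case False
        then show ?thesis using Oth3[of t] Oth4[of t] n5 by (cases "t \<in> N y1 \<and> t \<in> N y2") auto
      qed
      then show ?thesis by (simp add: Oth_def)
    qed
    show "card {s \<in> VT - {y1, y2}. s \<noteq> t \<and> \<Gamma> s \<inter> \<Gamma> t \<noteq> {}} < card {q \<in> \<Gamma> t. adj p q}"
      if t: "t \<in> VT - {y1, y2}" "t \<noteq> r" "par t \<notin> {y1, y2}" "p \<in> \<Gamma> (par t)" for t p
    proof -
      have "card (Oth t) < card {q \<in> \<Gamma> t. adj p q}"
      proof (cases "t \<in> S")
        case True
        then have "par t \<in> S" using Sup[OF True] Z[of t] t by auto
        then have "p \<in> U2" using \<Gamma>S t by blast
        then have "real (card (\<Gamma> t)) - real n / 10^5 \<le> real (card {q \<in> \<Gamma> t. adj p q})"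
          using d(2) \<Gamma>S[OF True] U(2) by (intro good_nbrs) auto
        then show ?thesis using Oth2[OF True] t by simp
      next
        case False
        then have "par t \<notin> S" using Sdown[of t] t by auto
        then have "p \<in> U1" using \<Gamma>nS t by blast
        then have "real (card (\<Gamma> t)) - real n / 10^5 \<le> real (card {q \<in> \<Gamma> t. adj p q})"
          using d(1) \<Gamma>nS[OF False] U(1) by (intro good_nbrs) auto
        moreover have "t \<notin> N y1 \<or> t \<notin> N y2" using common[of t] t by (auto simp: N_def)
        ultimately show ?thesis using Oth4[OF False] by simp
      qed
      then show ?thesis by (simp add: Oth_def)
    qed
    show "adj (\<phi> (par t)) q"
      if t: "t \<in> VT - {y1, y2}" "t \<noteq> r" "par t \<in> {y1, y2}" "q \<in> \<Gamma> t" for t q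
    proof (cases "t \<in> S")
      case True
      then show ?thesis using t R2 R2' y(3) \<phi> by (auto simp: \<Gamma>_def L2_def split: if_splits)
    next
      case False
      have "t \<in> N (par t)" using edge[of t] t by (auto simp: N_def)
      then show ?thesis using t N1[OF False _ t(4)] N2[OF False _ t(4)] \<phi> by auto
    qed
    show "adj p (\<phi> t)"
      if t: "t \<in> {y1, y2}" "t \<noteq> r" "par t \<notin> {y1, y2}" "p \<in> \<Gamma> (par t)" for t p
    proof -
      have "t \<in> VT" "t \<notin> S" using t y S by auto
      then have "par t \<notin> S" "par t \<in> N t" using Sdown[of t] t edge[of t] by (auto simp: N_def)
      then show ?thesis using t N1[OF _ _ t(4)] N2[OF _ _ t(4)] \<phi> sym by auto
    qed
    show "adj (\<phi> (par t)) (\<phi> t)" if t: "t \<in> {y1, y2}" "t \<noteq> r" "par t \<in> {y1, y2}" for t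
    proof -
      have "{t, par t} \<in> E" using edge[of t] t y by auto
      moreover have "{par t, t} \<in> E" using edge[of t] t y by auto
      moreover have "card {t, par t} = 2"
        using T \<open>{t, par t} \<in> E\<close> by (auto simp: tree_def fin_graph_def nsets_def)
      ultimately show ?thesis using t y(4) by auto
    qed
  qed blast
  have "f t \<in> U1 \<union> U2 \<union> {v1, v2}" if "t \<in> VT" for t
    using f(2)[of t] f(3)[of t] that \<Gamma>S[of t] \<Gamma>nS[of t] \<phi> by (cases "t \<in> {y1, y2}"; cases "t \<in> S") auto
  then show ?thesis unfolding E using f sym by (intro embedsI) auto
qed

text \<open>A centroid goes to \<open>w\<close>, and its branches are distributed over the two
  cliques. Each clique may have only \<open>t - 1\<close> vertices, so the distribution has to be
  exact.\<close>

lemma embedding_two_cliques: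
  assumes T: "tree VT E" and n: "card VT = n" "2 * n \<le> 3 * t" "4 \<le> t" "t \<le> n"
    and X: "finite X1" "finite X2" "X1 \<inter> X2 = {}" "w \<notin> X1 \<union> X2" "t \<le> card X1 + 1" "t \<le> card X2 + 1"
    and sym: "\<And>u v. adj u v \<Longrightarrow> adj v u"
    and cl: "\<And>u v. u \<in> X1 \<Longrightarrow> v \<in> X1 \<Longrightarrow> u \<noteq> v \<Longrightarrow> adj u v" "\<And>u v. u \<in> X2 \<Longrightarrow> v \<in> X2 \<Longrightarrow> u \<noteq> v \<Longrightarrow> adj u v"
      "\<And>u. u \<in> X1 \<union> X2 \<Longrightarrow> adj w u"
  shows "embeds adj VT E (insert w (X1 \<union> X2))"
proof -
  obtain x par rk where R: "rooted_tree VT x par rk" "rooted_tree.edges VT x par = E"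
    and half: "\<And>z. z \<in> rooted_tree.children VT x par x \<Longrightarrow> 2 * card (rooted_tree.desc VT x par z) \<le> card VT"
    using centroid[OF T] by blast
  interpret rooted_tree VT x par rk by fact
  have E: "E = edges" using R by simp
  define sz where "sz z = real (card (desc z))" for z
  have union: "real (card (\<Union>z\<in>J. desc z)) = sum sz J" if J: "J \<subseteq> children x" for J
  proof -
    have "J \<subseteq> VT" using J children_subset by blast
    then have "card (\<Union>z\<in>J. desc z) = (\<Sum>z\<in>J. card (desc z))"
      using J desc_siblings_disjoint by (intro card_UN_desc) blast+
    then show ?thesis by (simp add: sz_def)
  qed
  have "VT - {x} = (\<Union>z\<in>children x. desc z)"
    using desc_decomp[OF root] desc_root not_desc_child by auto
  then have total: "sum sz (children x) = real n - 1"
  proof -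
    have "n = Suc (card (VT - {x}))" using n(1) root fin by (metis card.remove)
    then show ?thesis using union[of "children x"] \<open>VT - {x} = _\<close> by simp
  qed
  \<comment> \<open>The lower bound says that the other part also has at most \<open>t - 1\<close>
    vertices. A branch of order at least \<open>n - t\<close> is a solution by itself: its order is
    at most \<open>n/2\<close>, hence at most \<open>t - 1\<close> by \<open>4 <= t\<close>.
    Otherwise all branches have order at most \<open>n - t - 1\<close>, and accumulation stops at
    \<open>2 * (n - t) - 1\<close>, which is at most \<open>t - 1\<close> by
    \<open>2 * n <= 3 * t\<close>.\<close>
  have "\<exists>J\<subseteq>children x. real n - real t \<le> sum sz J \<and> sum sz J \<le> real t - 1"
  proof (cases "\<exists>z\<in>children x. real n - real t \<le> sz z")
    case True
    then obtain z where z: "z \<in> children x" "real n - real t \<le> sz z" by blast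
    have "2 * card (desc z) \<le> 2 * t - 2" using half[OF z(1)] n by linarith
    then have "sz z \<le> real t - 1" using n(3) by (simp add: sz_def)
    then show ?thesis using z by (intro exI[of _ "{z}"]) auto
  next
    case False
    have small: "sz z \<le> real n - real t - 1" if "z \<in> children x" for z
    proof -
      have "card (desc z) < n - t" using False that n(4) by (force simp: sz_def not_le)
      then have "card (desc z) + 1 + t \<le> n" by linarith
      then show ?thesis unfolding sz_def by linarith
    qed
    have "real t \<ge> 4" "2 * real n \<le> 3 * real t" using n by linarith+
    moreover have "\<exists>J. {} \<subseteq> J \<and> J \<subseteq> children x \<and> real n - real t \<le> sum sz J \<and>
        sum sz J \<le> (real n - real t) + (real n - real t - 1)"
    proof (rule accumulate)
      have "real t \<le> real n" "1 \<le> real t" using n by linarith+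
      then show "real n - real t \<le> sum sz (children x)" using total by simp
      show "sum sz {} \<le> (real n - real t) + (real n - real t - 1)"
      proof (cases "t = n")
        case True
        have "children x \<noteq> {}" using total \<open>1 \<le> real t\<close> n by auto
        then obtain z where "z \<in> children x" by blast
        then show ?thesis using small[of z] by (simp add: sz_def)
      next
        case False
        then have "t + 1 \<le> n" using n(4) by simp
        then have "real t + 1 \<le> real n" by linarith
        then show ?thesis by simp
      qed
    qed (use finite_children small in auto)
    then obtain J where "J \<subseteq> children x" "real n - real t \<le> sum sz J"
      "sum sz J \<le> (real n - real t) + (real n - real t - 1)" by blast
    ultimately show ?thesis by (intro exI[of _ J]) auto
  qed
  then obtain J where J: "J \<subseteq> children x" "real n - real t \<le> sum sz J" "sum sz J \<le> real t - 1" by blast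
  define S where "S = (\<Union>z\<in>J. desc z)"
  have cS: "real (card S) = sum sz J" using union J by (simp add: S_def)
  have SV: "S \<subseteq> VT" "finite S" "x \<notin> S"
    using desc_subset not_desc_child J finite_subset[OF _ fin] unfolding S_def by blast+
  have "card (VT - {x} - S) = n - 1 - card S"
    using SV n root fin card_Diff_subset[of "insert x S" VT] by (simp add: Diff_insert2[symmetric])
  then have cS': "card (VT - {x} - S) < t" "card S < t" using cS J(2,3) n(3) by linarith+
  have side: "t \<in> S \<longleftrightarrow> par t \<in> S" if "t \<in> VT" "t \<noteq> x" "par t \<noteq> x" for t
  proof
    assume "t \<in> S"
    then obtain z where "z \<in> J" "t \<in> desc z" by (auto simp: S_def)
    then show "par t \<in> S" using desc_par[of t z] J that by (auto simp: S_def children_def)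
  next
    assume "par t \<in> S"
    then show "t \<in> S" using desc_step that by (auto simp: S_def)
  qed
  define \<Gamma> where "\<Gamma> t = (if t \<in> S then X1 else X2)" for t
  have oth: "card {s \<in> VT - {x}. s \<noteq> t \<and> \<Gamma> s \<inter> \<Gamma> t \<noteq> {}} < card (\<Gamma> t)" if t: "t \<in> VT - {x}" for t
  proof (cases "t \<in> S")
    case True
    have "{s \<in> VT - {x}. s \<noteq> t \<and> \<Gamma> s \<inter> \<Gamma> t \<noteq> {}} \<subseteq> S - {t}"
      using True X(3) by (auto simp: \<Gamma>_def split: if_splits)
    then have "card {s \<in> VT - {x}. s \<noteq> t \<and> \<Gamma> s \<inter> \<Gamma> t \<noteq> {}} \<le> card (S - {t})"
      using SV by (intro card_mono) auto
    moreover have "card (S - {t}) < card S" using True SV by (intro psubset_card_mono) auto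
    ultimately show ?thesis using cS' X True by (simp add: \<Gamma>_def)
  next
    case False
    have "{s \<in> VT - {x}. s \<noteq> t \<and> \<Gamma> s \<inter> \<Gamma> t \<noteq> {}} \<subseteq> (VT - {x} - S) - {t}"
      using False X(3) by (auto simp: \<Gamma>_def split: if_splits)
    then have "card {s \<in> VT - {x}. s \<noteq> t \<and> \<Gamma> s \<inter> \<Gamma> t \<noteq> {}} \<le> card ((VT - {x} - S) - {t})"
      using fin by (intro card_mono) auto
    moreover have "card ((VT - {x} - S) - {t}) < card (VT - {x} - S)"
      using False t fin by (intro psubset_card_mono) auto
    ultimately show ?thesis using cS' X False by (simp add: \<Gamma>_def)
  qed
  \<comment> \<open>The greedy lemma is applied to the reflexive closure of \<open>adj\<close>, so that no vertex of a
    clique is excluded and the cliques can be filled completely.\<close>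
  obtain f where f: "inj_on f VT" "\<And>t. t \<in> {x} \<Longrightarrow> f t = w" "\<And>t. t \<in> VT - {x} \<Longrightarrow> f t \<in> \<Gamma> t"
    "\<And>t. t \<in> VT \<Longrightarrow> t \<noteq> x \<Longrightarrow> f (par t) = f t \<or> adj (f (par t)) (f t)"
  proof (rule greedy_embedding[of "{x}" "\<lambda>_. w" \<Gamma> "\<lambda>p q. p = q \<or> adj p q"])
    show "w \<notin> \<Gamma> t" for t using X(4) by (auto simp: \<Gamma>_def)
    show "card {s \<in> VT - {x}. s \<noteq> t \<and> \<Gamma> s \<inter> \<Gamma> t \<noteq> {}} < card {q \<in> \<Gamma> t. p = q \<or> adj p q}"
      if t: "t \<in> VT - {x}" "t \<noteq> x" "par t \<notin> {x}" "p \<in> \<Gamma> (par t)" for t p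
    proof -
      have "\<Gamma> (par t) = \<Gamma> t" using side[of t] t by (simp add: \<Gamma>_def)
      then have "{q \<in> \<Gamma> t. p = q \<or> adj p q} = \<Gamma> t"
        using t(4) cl(1,2) by (auto simp: \<Gamma>_def split: if_splits)
      then show ?thesis using oth[OF t(1)] by simp
    qed
    show "w = q \<or> adj w q" if "q \<in> \<Gamma> t" for t q using that cl(3) by (auto simp: \<Gamma>_def split: if_splits)
  qed (use root oth in auto)
  have "adj (f (par t)) (f t)" if t: "t \<in> VT" "t \<noteq> x" for t
  proof -
    have "par t \<in> VT" "par t \<noteq> t" using par_in par_rk t by force+
    then have "f (par t) \<noteq> f t" using f(1) t by (auto dest: inj_onD)
    then show ?thesis using f(4)[OF t] by simp
  qed
  moreover have "f t \<in> insert w (X1 \<union> X2)" if "t \<in> VT" for t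
    using f(2)[of t] f(3)[of t] that by (cases "t = x") (auto simp: \<Gamma>_def split: if_splits)
  ultimately show ?thesis unfolding E using f(1) sym by (intro embedsI) auto
qed

lemma injective_choice:
  assumes "finite W" "\<And>w. w \<in> W \<Longrightarrow> finite (C w)" "\<And>w. w \<in> W \<Longrightarrow> card W \<le> card (C w)"
  shows "\<exists>\<psi>. inj_on \<psi> W \<and> (\<forall>w\<in>W. \<psi> w \<in> C w)"
  using assms
proof (induction W rule: finite_induct)
  case (insert x W)
  then obtain \<psi> where \<psi>: "inj_on \<psi> W" "\<forall>w\<in>W. \<psi> w \<in> C w" by force
  have "card (\<psi> ` W) < card (C x)"
    using insert.prems(2)[of x] insert.hyps card_image_le[of W \<psi>] by simp
  then obtain c where c: "c \<in> C x" "c \<notin> \<psi> ` W"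
    using insert.hyps(1) by (meson card_mono finite_imageI leD subsetI)
  have "inj_on (\<psi>(x := c)) (insert x W)"
    using \<psi>(1) c insert.hyps(2) by (auto simp: inj_on_def)
  moreover have "\<forall>w\<in>insert x W. (\<psi>(x := c)) w \<in> C w" using \<psi>(2) c by auto
  ultimately show ?case by blast
qed simp

section \<open>The two-coloured graph\<close>

lemma tree_bipartition_neighbour:
  assumes "tree V E" "bipartition V E A B" "2 \<le> card V" "a \<in> A"
  shows "\<exists>b\<in>B. {a, b} \<in> E"
proof -
  have aV: "a \<in> V" "finite V" using assms by (auto simp: bipartition_def tree_def fin_graph_def)
  have "\<not> V \<subseteq> {a}" using assms(3) card_mono[of "{a}" V] by auto
  then obtain u where u: "u \<in> V" "u \<noteq> a" by blast
  then have "(a, u) \<in> {(x, y). {x, y} \<in> E}\<^sup>*" using assms(1) aV by (auto simp: tree_def connected_graph_def)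
  then obtain b where b: "{a, b} \<in> E" using u(2) by (auto elim: converse_rtranclE)
  then obtain a' b' where ab: "a' \<in> A" "b' \<in> B" "{a, b} = {a', b'}"
    using assms(2) unfolding bipartition_def by blast
  then have "a = a' \<and> b = b'" using assms(2,4) by (auto simp: bipartition_def doubleton_eq_iff)
  then show ?thesis using ab b by blast
qed

text \<open>The extremal structure with numbers in place of the parameters, under the assumption
  that neither colour contains the tree. Red is the colour dominating between the sides. The two
  inequalities in \<open>cardV\<close> come from the maximum in the order of the graph.\<close>

locale counterexample =
  fixes V U1 U2 :: "'a set" and red blue :: "'a \<Rightarrow> 'a \<Rightarrow> bool"
    and VT :: "'b set" and ET :: "'b set set" and A B :: "'b set" and n t1 t2 :: nat
  assumes V: "finite V" "U1 \<subseteq> V" "U2 \<subseteq> V" "U1 \<inter> U2 = {}"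
    and sizes: "0.666 * real n \<le> real (card U1)" "0.666 * real n \<le> real (card U2)"
      "real (card (V - U1 - U2)) \<le> real n / 10^5" "card V \<le> 3 * n"
    and sym: "\<And>u v. red u v \<Longrightarrow> red v u" "\<And>u v. blue u v \<Longrightarrow> blue v u"
    and col: "\<And>u v. u \<noteq> v \<Longrightarrow> red u v \<or> blue u v" "\<And>u. \<not> red u u" "\<And>u. \<not> blue u u"
      "\<And>u v. \<not> (red u v \<and> blue u v)"
    and miss1: "\<And>u. u \<in> U1 \<Longrightarrow> real (card {q \<in> U1. red u q}) \<le> real n / 10^6"
      "\<And>u. u \<in> U1 \<Longrightarrow> real (card {q \<in> U2. blue u q}) \<le> real n / 10^6"
    and miss2: "\<And>u. u \<in> U2 \<Longrightarrow> real (card {q \<in> U2. red u q}) \<le> real n / 10^6"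
      "\<And>u. u \<in> U2 \<Longrightarrow> real (card {q \<in> U1. blue u q}) \<le> real n / 10^6"
    and T: "tree VT ET" "card VT = n" "10^9 \<le> n" "\<And>v. v \<in> VT \<Longrightarrow> real (degree ET v) \<le> real n / 10^7"
    and bip: "bipartition VT ET A B" "card A = t1" "card B = t2" "0.666 * real n \<le> real t1"
    and cardV: "2 * t1 \<le> card V + 1" "t1 + 2 * t2 \<le> card V + 1"
    and none: "\<not> embeds red VT ET V" "\<not> embeds blue VT ET V"
begin

lemma n_large: "10^9 \<le> real n"
  using of_nat_mono[OF T(3), where 'a = real] by simp

lemma finite_tree: "finite VT" "finite ET"
  using T(1) finite_subset[of ET "Pow VT"] by (auto simp: tree_def fin_graph_def nsets_def)

lemma AB: "A \<union> B = VT" "A \<inter> B = {}" "finite A" "finite B" "A \<subseteq> VT" "B \<subseteq> VT"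
  using bip(1) finite_tree by (auto simp: bipartition_def)

lemma n_eq: "n = t1 + t2"
  using card_Un_disjoint[of A B] AB bip T(2) by simp

lemma t2_le: "real t2 \<le> 0.334 * real n"
  using n_eq bip(4) by simp

text \<open>The assumptions are symmetric in the two sides, so each later fact has a mirror image,
  obtained by an interpretation \<open>sw\<close>.\<close>

lemma swapped: "counterexample V U2 U1 red blue VT ET A B n t1 t2"
proof -
  have *: "V - U2 - U1 = V - U1 - U2" "U2 \<inter> U1 = {}" using V by blast+
  have "counterexample V U1 U2 red blue VT ET A B n t1 t2" by (rule counterexample_axioms)
  then show ?thesis
    unfolding counterexample_def * by (elim conjE) (intro conjI; (assumption | rule refl))
qed

text \<open>Let \<open>m\<close> be the least size of a subset of \<open>B\<close> dominating all
  but one percent of \<open>A\<close>; then \<open>\<kappa>\<close> is \<open>m - 1\<close>. Smaller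
  sets leave more than \<open>0.01 * t1\<close>, hence at least \<open>0.006 n\<close>, vertices
  undominated. Removing three vertices from an optimal set costs at most \<open>3 * n / 10^7\<close>
  vertices of \<open>A\<close> and brings its size down to \<open>\<kappa> - 2\<close>, so that
  \<open>\<kappa>\<close> neighbours suffice for the cut edges even when \<open>v1\<close> and
  \<open>v2\<close> are avoided.\<close>

lemma domination:
  obtains \<kappa> H where "finite H" "card H + 2 \<le> \<kappa>"
    "real (card {a \<in> A. \<forall>h\<in>H. {a, h} \<notin> ET}) \<le> 0.011 * real n"
    "\<And>B'. B' \<subseteq> B \<Longrightarrow> card B' \<le> \<kappa> \<Longrightarrow> 0.006 * real n \<le> real (card {a \<in> A. \<forall>b\<in>B'. {a, b} \<notin> ET})"
proof -
  define und where "und H = card {a \<in> A. \<forall>h\<in>H. {a, h} \<notin> ET}" for H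
  define dom where "dom m \<longleftrightarrow> (\<exists>H\<subseteq>B. card H = m \<and> real (und H) \<le> 0.01 * real t1)" for m
  have e: "{a \<in> A. \<forall>h\<in>B. {a, h} \<notin> ET} = {}"
    using tree_bipartition_neighbour[OF T(1) bip(1)] T(2,3) by auto
  have "und B = 0" unfolding und_def e by simp
  then have "dom (card B)" unfolding dom_def by (intro exI[of _ B]) auto
  define m where "m = (LEAST m. dom m)"
  have "dom m" unfolding m_def using \<open>dom (card B)\<close> by (rule LeastI)
  then obtain H where H: "H \<subseteq> B" "card H = m" "real (und H) \<le> 0.01 * real t1" by (auto simp: dom_def)
  have finH: "finite H" using H(1) AB finite_subset by blast
  have t1n: "real t1 \<le> real n" using n_eq by simp
  have drop: "real (und (H - Y)) \<le> real (und H) + 3 * real n / 10^7" if Y: "Y \<subseteq> H" "card Y \<le> 3" for Y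
  proof -
    have finY: "finite Y" using Y finH finite_subset by blast
    have "{a \<in> A. \<forall>h\<in>H - Y. {a, h} \<notin> ET} \<subseteq> {a \<in> A. \<forall>h\<in>H. {a, h} \<notin> ET} \<union> (\<Union>y\<in>Y. {a. {a, y} \<in> ET})"
      by blast
    moreover have "finite ({a \<in> A. \<forall>h\<in>H. {a, h} \<notin> ET} \<union> (\<Union>y\<in>Y. {a. {a, y} \<in> ET}))"
      using AB finY card_neighbours_le_degree[OF finite_tree(2)] by auto
    ultimately have "und (H - Y) \<le> card ({a \<in> A. \<forall>h\<in>H. {a, h} \<notin> ET} \<union> (\<Union>y\<in>Y. {a. {a, y} \<in> ET}))"
      unfolding und_def by (rule card_mono[rotated])
    also have "\<dots> \<le> und H + card (\<Union>y\<in>Y. {a. {a, y} \<in> ET})" unfolding und_def by (rule card_Un_le)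
    also have "\<dots> \<le> und H + (\<Sum>y\<in>Y. card {a. {a, y} \<in> ET})" using card_UN_le[OF finY] by simp
    finally have "real (und (H - Y)) \<le> real (und H) + (\<Sum>y\<in>Y. real (card {a. {a, y} \<in> ET}))"
      by (simp flip: of_nat_sum of_nat_add)
    also have "(\<Sum>y\<in>Y. real (card {a. {a, y} \<in> ET})) \<le> (\<Sum>y\<in>Y. real n / 10^7)"
    proof (rule sum_mono)
      fix y assume "y \<in> Y"
      then have "y \<in> VT" using Y H AB by blast
      then show "real (card {a. {a, y} \<in> ET}) \<le> real n / 10^7"
        using card_neighbours_le_degree(2)[OF finite_tree(2), of y] T(4)[of y] by linarith
    qed
    also have "\<dots> \<le> 3 * real n / 10^7" using Y(2) by (simp add: divide_right_mono mult_right_mono)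
    finally show ?thesis by simp
  qed
  have m3: "m > 3"
  proof (rule ccontr)
    assume "\<not> m > 3"
    then have "real (und {}) \<le> real (und H) + 3 * real n / 10^7" using drop[of H] H by simp
    moreover have "und {} = t1" using bip by (simp add: und_def)
    ultimately show False using H(3) bip(4) n_large by simp
  qed
  obtain Y where Y: "Y \<subseteq> H" "card Y = 3" using obtain_subset_with_card_n[of 3 H] m3 H by (metis less_imp_le)
  show ?thesis
  proof (rule that[of "H - Y" "m - 1"])
    show "finite (H - Y)" using finH by simp
    have "card (H - Y) = m - 3" using Y H finH by (metis card_Diff_subset finite_subset)
    then show "card (H - Y) + 2 \<le> m - 1" using m3 by simp
    show "real (card {a \<in> A. \<forall>h\<in>H - Y. {a, h} \<notin> ET}) \<le> 0.011 * real n"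
      using drop[of Y] Y H(3) t1n n_large by (simp add: und_def)
    show "0.006 * real n \<le> real (card {a \<in> A. \<forall>b\<in>B'. {a, b} \<notin> ET})" if "B' \<subseteq> B" "card B' \<le> m - 1" for B'
    proof -
      have "\<not> dom (card B')" using not_less_Least[of "card B'" dom] that m3 by (simp add: m_def)
      then show ?thesis using that(1) bip(4) by (auto simp: dom_def und_def)
    qed
  qed
qed

end

lemma embeds_mono: "embeds adj VT E X \<Longrightarrow> X \<subseteq> Y \<Longrightarrow> embeds adj VT E Y"
  unfolding embeds_def by (meson order_trans)

text \<open>Every edge has exactly one end in \<open>B\<close>, and there are at most
  \<open>n - 1\<close> edges.\<close>

lemma (in counterexample) sum_degrees_le: "(\<Sum>b\<in>B. card {a. {a, b} \<in> ET}) \<le> n"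
proof -
  obtain r where r: "r \<in> VT" using T(1) by (auto simp: tree_def connected_graph_def)
  obtain par rk where R: "rooted_tree VT r par rk" "rooted_tree.edges VT r par = ET"
    using tree_rooting[OF T(1) r] by blast
  have bipE: "\<exists>a\<in>A. \<exists>b\<in>B. e = {a, b}" if "e \<in> ET" for e using bip(1) that by (auto simp: bipartition_def)
  have nb: "a \<in> A" if "{a, b} \<in> ET" "b \<in> B" for a b
    using bipE[OF that(1)] that(2) AB(2) by (auto simp: doubleton_eq_iff)
  have "(\<Sum>b\<in>B. card {a. {a, b} \<in> ET}) = card (SIGMA b:B. {a. {a, b} \<in> ET})"
    using AB(4) card_neighbours_le_degree(1)[OF finite_tree(2)] by simp
  also have "\<dots> \<le> card ET"
  proof (rule card_inj_on_le)
    show "inj_on (\<lambda>(b, a). {a, b}) (SIGMA b:B. {a. {a, b} \<in> ET})"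
      using nb AB(2) by (auto simp: inj_on_def doubleton_eq_iff)
  qed (use finite_tree in auto)
  also have "\<dots> \<le> card (VT - {r})"
    unfolding R(2)[symmetric] rooted_tree.edges_def[OF R(1)]
    using finite_tree by (intro card_image_le) auto
  also have "\<dots> \<le> n" using T(2) finite_tree by (metis card_Diff1_le)
  finally show ?thesis .
qed

section \<open>Vertices classified by their blue degrees into the two sides\<close>

locale counterexample_dom = counterexample +
  fixes \<kappa>0 :: nat and H :: "'b set"
  assumes H: "finite H" "card H + 2 \<le> \<kappa>0"
      "real (card {a \<in> A. \<forall>h\<in>H. {a, h} \<notin> ET}) \<le> 0.011 * real n"
    and undom: "\<And>B'. B' \<subseteq> B \<Longrightarrow> card B' \<le> \<kappa>0 \<Longrightarrow> 0.006 * real n \<le> real (card {a \<in> A. \<forall>b\<in>B'. {a, b} \<notin> ET})"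
begin

lemma swapped_dom: "counterexample_dom V U2 U1 red blue VT ET A B n t1 t2 \<kappa>0 H"
proof -
  interpret sw: counterexample V U2 U1 red blue VT ET A B n t1 t2 by (rule swapped)
  show ?thesis by unfold_locales (fact H undom)+
qed

text \<open>Vertices in \<open>low U2\<close> can receive vertices of \<open>A\<close> when \<open>B\<close> is placed in \<open>U2\<close>. Two vertices of
  \<open>cap U1 U2\<close> with a common blue neighbour in \<open>U1\<close> can serve as the cut vertices of a blue split.\<close>

definition "K = n div 400"
definition "\<kappa> = min \<kappa>0 K"

abbreviation bdeg :: "'a set \<Rightarrow> 'a \<Rightarrow> nat" where
  "bdeg U v \<equiv> card {u \<in> U. blue v u}"

definition "low U = {v \<in> V. bdeg U v < \<kappa>}"
definition "mid U U' = {v \<in> V. \<kappa> \<le> bdeg U v \<and> \<kappa> \<le> bdeg U' v \<and> bdeg U v < K \<and> bdeg U' v < K}"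
definition "cap U U' = {v \<in> V. K \<le> bdeg U v \<and> \<kappa> \<le> bdeg U' v}"

lemma K_bounds: "real n / 500 \<le> real K" "real K \<le> real n / 400"
proof -
  have "400 * K \<le> n" "n \<le> 400 * K + 400" unfolding K_def by linarith+
  then have "400 * real K \<le> real n" "real n \<le> 400 * real K + 400" by linarith+
  then show "real n / 500 \<le> real K" "real K \<le> real n / 400" using n_large by simp_all
qed

text \<open>Capping at \<open>K\<close> keeps the vertices of each side out of its own
  \<open>low\<close> set. When the cap is active, the number of cut edges is controlled by the
  maximum degree instead of by \<open>H\<close>.\<close>

lemma \<kappa>_bounds: "\<kappa> \<le> K" "\<kappa> \<le> \<kappa>0" "card H + 2 \<le> \<kappa> \<or> 2 * (real n / 10^7) + 2 \<le> real \<kappa>"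
proof -
  show "\<kappa> \<le> K" "\<kappa> \<le> \<kappa>0" by (auto simp: \<kappa>_def)
  have "2 * (real n / 10^7) + 2 \<le> real K" using K_bounds n_large by simp
  then show "card H + 2 \<le> \<kappa> \<or> 2 * (real n / 10^7) + 2 \<le> real \<kappa>" using H(2) by (auto simp: \<kappa>_def min_def)
qed

lemma bdeg_own: "u \<in> U1 \<Longrightarrow> real (card U1) - real n / 10^5 \<le> real (bdeg U1 u)"
proof -
  assume u: "u \<in> U1"
  have fin: "finite U1" using V finite_subset by blast
  have "U1 \<subseteq> insert u ({q \<in> U1. red u q} \<union> {q \<in> U1. blue u q})"
  proof
    fix q assume "q \<in> U1"
    then show "q \<in> insert u ({q \<in> U1. red u q} \<union> {q \<in> U1. blue u q})"
      using col(1)[of u q] by (cases "q = u") auto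
  qed
  then have "card U1 \<le> card (insert u ({q \<in> U1. red u q} \<union> {q \<in> U1. blue u q}))"
    using fin by (intro card_mono) auto
  also have "\<dots> \<le> Suc (card {q \<in> U1. red u q} + card {q \<in> U1. blue u q})"
    using fin card_Un_le[of "{q \<in> U1. red u q}" "{q \<in> U1. blue u q}"] by (simp add: card_insert_if)
  finally have "real (card U1) \<le> 1 + real (card {q \<in> U1. red u q}) + real (card {q \<in> U1. blue u q})" by linarith
  then show ?thesis using miss1(1)[OF u] n_large by simp
qed

lemma bdeg_own_K: "u \<in> U1 \<Longrightarrow> K \<le> bdeg U1 u" "u \<in> U1 \<Longrightarrow> card U1 < bdeg U1 u + K"
proof -
  assume u: "u \<in> U1"
  have "real K \<le> real (bdeg U1 u)" "real (card U1) < real (bdeg U1 u) + real K"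
    using bdeg_own[OF u] K_bounds sizes n_large by simp_all
  then show "K \<le> bdeg U1 u" "card U1 < bdeg U1 u + K" by linarith+
qed

text \<open>Two such vertices with a common blue neighbour in \<open>U1\<close> meet all
  requirements on the images of the cut vertices, so they would give a blue copy.\<close>

lemma cap_disjoint:
  assumes "v1 \<in> cap U1 U2" "v2 \<in> cap U1 U2" "v1 \<noteq> v2"
  shows "{u \<in> U1. blue v1 u} \<inter> {u \<in> U1. blue v2 u} = {}"
proof (rule ccontr)
  assume "\<not> ?thesis"
  then obtain u0 where u0: "u0 \<in> U1" "blue v1 u0" "blue v2 u0" by blast
  interpret sw: counterexample_dom V U2 U1 red blue VT ET A B n t1 t2 \<kappa>0 H by (rule swapped_dom)
  have fU: "finite U1" "finite U2" using V finite_subset by blast+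
  have miss: "real (card {q \<in> U. \<not> blue u q}) \<le> real n / 10^5"
    if "real (card U) - real n / 10^5 \<le> real (bdeg U u)" "finite U" for U u
  proof -
    have "card {q \<in> U. \<not> blue u q} + card {q \<in> U. blue u q} = card U"
      using that(2) by (subst card_Un_disjoint[symmetric]) (auto intro!: arg_cong[of _ _ card])
    then show ?thesis using that(1) by linarith
  qed
  have "embeds blue VT ET (U1 \<union> U2 \<union> {v1, v2})"
  proof (rule embedding_through_two_vertices[where ?u0.0 = u0, OF T(1,2) _ _ _ AB(5) _ H(1,3) \<kappa>_bounds(3)])
    show "real (degree ET v) \<le> real n / 10^7" if "v \<in> VT" for v by (rule T(4)[OF that])
    show "10^8 \<le> n" using T(3) by simp
    show "real n / 10^7 \<le> real n / 10^6" by simp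
    show "real n / 500 \<le> real (bdeg U1 v)" "\<kappa> \<le> bdeg U2 v" if "v \<in> {v1, v2}" for v
    proof -
      have "v \<in> cap U1 U2" using that assms by auto
      then have "K \<le> bdeg U1 v" "\<kappa> \<le> bdeg U2 v" by (auto simp: cap_def)
      then show "real n / 500 \<le> real (bdeg U1 v)" "\<kappa> \<le> bdeg U2 v" using K_bounds by linarith+
    qed
    show "0.666 * real n \<le> real (card A)" using bip by simp
    show "blue u v \<Longrightarrow> blue v u" for u v by (rule sym)
    show "real (card {q \<in> U1. \<not> blue u q}) \<le> real n / 10^5" if "u \<in> U1" for u
      using miss[OF bdeg_own[OF that] fU(1)] .
    show "real (card {q \<in> U2. \<not> blue u q}) \<le> real n / 10^5" if "u \<in> U2" for u
      using miss[OF sw.bdeg_own[OF that] fU(2)] .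
  qed (fact col V fU sizes u0 assms)+
  then show False using none(2) embeds_mono[of blue VT ET _ V] V assms by (auto simp: cap_def)
qed

text \<open>Disjoint neighbourhoods of size at least \<open>n/500\<close> are packed into at most
  \<open>3 * n\<close> vertices.\<close>

lemma card_cap: "card (cap U1 U2) \<le> 1500"
proof -
  have fin: "finite (cap U1 U2)" "finite U1" using V finite_subset by (auto simp: cap_def)
  have "real (card (cap U1 U2)) * real K = (\<Sum>v\<in>cap U1 U2. real K)" by simp
  also have "\<dots> \<le> (\<Sum>v\<in>cap U1 U2. real (bdeg U1 v))" by (intro sum_mono) (auto simp: cap_def)
  also have "\<dots> = real (card (\<Union>v\<in>cap U1 U2. {u \<in> U1. blue v u}))"
    using fin cap_disjoint by (subst card_UN_disjoint) auto
  also have "\<dots> \<le> real (card V)" using V by (auto intro!: card_mono)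
  also have "\<dots> \<le> 3 * real n" using sizes(4) by linarith
  finally have "real (card (cap U1 U2)) * real K \<le> 3 * real n" .
  moreover have "real (card (cap U1 U2)) * (real n / 500) \<le> real (card (cap U1 U2)) * real K"
    using K_bounds by (intro mult_left_mono) auto
  ultimately have "real (card (cap U1 U2)) * real n \<le> 1500 * real n" by simp
  then have "real (card (cap U1 U2)) \<le> 1500" by (rule mult_right_le_imp_le) (use n_large in simp)
  then show ?thesis by linarith
qed

text \<open>\<open>w\<close> belongs to \<open>cap U1 U2\<close> itself, and it is blue to all but
  fewer than \<open>K\<close> vertices of \<open>U1\<close>. Its blue neighbourhood therefore meets
  that of every vertex in this set, which disjointness allows only for \<open>w\<close>.\<close>

lemma strong_unique:
  assumes "w \<in> V" "card U1 < bdeg U1 w + K" "card U2 < bdeg U2 w + K" "v \<in> cap U1 U2"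
  shows "v = w"
proof (rule ccontr)
  assume ne: "v \<noteq> w"
  have fin: "finite U1" using V finite_subset by blast
  have "real (card U1) < real (bdeg U1 w) + real K" "real (card U2) < real (bdeg U2 w) + real K"
    using assms(2,3) by linarith+
  then have "real K \<le> real (bdeg U1 w)" "real K \<le> real (bdeg U2 w)"
    using K_bounds sizes n_large by simp_all
  then have "w \<in> cap U1 U2" using assms(1) \<kappa>_bounds(1) by (auto simp: cap_def)
  then have "{u \<in> U1. blue v u} \<inter> {u \<in> U1. blue w u} = {}" using cap_disjoint assms(4) ne by blast
  then have "bdeg U1 v + bdeg U1 w = card ({u \<in> U1. blue v u} \<union> {u \<in> U1. blue w u})"
    using fin by (subst card_Un_disjoint) auto
  also have "\<dots> \<le> card U1" using fin by (intro card_mono) auto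
  finally show False using assms(2,4) by (auto simp: cap_def)
qed

text \<open>The red embedding with \<open>A\<close> placed in \<open>P\<close> and \<open>B\<close> in \<open>U2\<close>. The vertices of \<open>W\<close> also receive
  vertices of \<open>A\<close>, namely leaves whose neighbours are placed beforehand on \<open>\<psi> ` W\<close>. The images of
  \<open>B\<close> avoid the vertices with many blue neighbours in \<open>mid U1 U2\<close>, so that at most a third of
  \<open>mid U1 U2\<close> is unsuitable for the filling procedure.\<close>

lemma red_embedding:
  assumes P: "P \<subseteq> V" "P \<inter> U2 = {}" "mid U1 U2 \<subseteq> P" "P \<subseteq> low U2 \<union> mid U1 U2" "card (U1 - P) \<le> 2000"
    and W: "W \<subseteq> V" "W \<inter> P = {}" "card W \<le> 3000"
    and \<psi>: "inj_on \<psi> W" "\<psi> ` W \<subseteq> V" "\<psi> ` W \<inter> (P \<union> W) = {}" "\<And>w. w \<in> W \<Longrightarrow> red (\<psi> w) w"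
      "(\<Sum>w\<in>W. real (bdeg U1 (\<psi> w))) \<le> 0.004 * real n" "card {w \<in> W. \<psi> w \<notin> U2} \<le> 1"
    and size: "t1 + card (mid U1 U2) div 3 \<le> card W + card P"
  shows False
proof -
  define J where "J = mid U1 U2"
  interpret sw: counterexample_dom V U2 U1 red blue VT ET A B n t1 t2 \<kappa>0 H by (rule swapped_dom)
  have fin: "finite U1" "finite U2" "finite P" "finite W" "finite J"
    using V P W finite_subset by (auto simp: J_def mid_def)
  have "A \<noteq> {}" using bip n_large by auto
  then obtain r where r: "r \<in> B" using tree_bipartition_neighbour[OF T(1) bip(1)] T(2,3) by force
  then have rV: "r \<in> VT" using AB by blast
  obtain par rk where R: "rooted_tree VT r par rk" "rooted_tree.edges VT r par = ET"
    using tree_rooting[OF T(1) rV] by blast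
  interpret Rt: rooted_tree VT r par rk by fact
  have bipR: "bipartition VT Rt.edges A B" using bip R by simp
  \<comment> \<open>Reserved leaves need distinct parents. There are at least \<open>t1 - t2\<close>
    leaves in \<open>A\<close>, more than \<open>0.3 n\<close>, and a vertex has at most
    \<open>n / 10^7\<close> children; this gives three million parents for at most 3000 vertices of
    \<open>W\<close>.\<close>
  define LP where "LP = {b \<in> B. \<exists>a\<in>A. Rt.children a = {} \<and> a \<in> Rt.children b}"
  have finLP: "finite LP" using AB by (simp add: LP_def)
  have "card W \<le> card LP"
  proof -
    let ?L = "{a \<in> A. Rt.children a = {}}"
    have "card A = card ?L + card {a \<in> A. Rt.children a \<noteq> {}}"
      using AB(3) by (subst card_Un_disjoint[symmetric]) (auto intro!: arg_cong[of _ _ card])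
    then have 1: "t1 \<le> card ?L + t2" using Rt.card_inner_le[OF bipR] bip by simp
    have "?L \<subseteq> (\<Union>b\<in>LP. Rt.children b)"
    proof
      fix a assume a: "a \<in> ?L"
      then have "a \<in> VT" "a \<noteq> r" using AB r by auto
      then have "par a \<in> B" "a \<in> Rt.children (par a)"
        using Rt.par_bipartition[OF bipR] a by (auto simp: Rt.children_def)
      then show "a \<in> (\<Union>b\<in>LP. Rt.children b)" using a by (auto simp: LP_def)
    qed
    then have "card ?L \<le> card (\<Union>b\<in>LP. Rt.children b)" using finLP Rt.finite_children by (intro card_mono) auto
    also have "\<dots> \<le> (\<Sum>b\<in>LP. card (Rt.children b))" by (rule card_UN_le[OF finLP])
    finally have "real (card ?L) \<le> (\<Sum>b\<in>LP. real (card (Rt.children b)))" by (simp flip: of_nat_sum)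
    also have "\<dots> \<le> (\<Sum>b\<in>LP. real n / 10^7)"
    proof (rule sum_mono)
      fix b assume "b \<in> LP"
      then have "b \<in> VT" using AB by (auto simp: LP_def)
      then show "real (card (Rt.children b)) \<le> real n / 10^7"
        using Rt.degree_children[of b] T(4)[of b] R(2) by simp
    qed
    finally have "real (card ?L) \<le> real (card LP) * (real n / 10^7)" by simp
    moreover have "real t1 \<le> real (card ?L) + real t2" using 1 by linarith
    then have "0.3 * real n \<le> real (card ?L)" using bip(4) t2_le n_large by simp
    ultimately have "3000000 * real n \<le> real (card LP) * real n" by simp
    then have "3000000 \<le> real (card LP)" by (rule mult_right_le_imp_le) (use n_large in simp)
    then show ?thesis using W(3) by linarith
  qed
  then obtain g where g: "g ` W \<subseteq> LP" "inj_on g W" using card_le_inj[OF fin(4) finLP] by auto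
  define B0 where "B0 = g ` W"
  define wv where "wv = inv_into W g"
  define \<phi>0 where "\<phi>0 b = \<psi> (wv b)" for b
  have wvW: "wv b \<in> W" "g (wv b) = b" if "b \<in> B0" for b
    using that by (auto simp: wv_def B0_def inv_into_into f_inv_into_f)
  have wvg: "wv (g w) = w" if "w \<in> W" for w using that g by (simp add: wv_def)
  have B0B: "B0 \<subseteq> B" using g by (auto simp: B0_def LP_def)
  have cB0: "card B0 = card W" unfolding B0_def using g(2) by (rule card_image)
  have imW: "wv ` B0 = W"
  proof
    show "wv ` B0 \<subseteq> W" using wvW(1) by blast
    show "W \<subseteq> wv ` B0"
    proof
      fix w assume w: "w \<in> W"
      then have "g w \<in> B0" by (simp add: B0_def)
      then show "w \<in> wv ` B0" using wvg[OF w] by (metis imageI)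
    qed
  qed
  have im\<psi>: "\<phi>0 ` B0 = \<psi> ` W" using imW unfolding \<phi>0_def by (metis image_image)
  have injwv: "inj_on wv B0" using wvW by (metis inj_onI)
  have inj\<phi>0: "inj_on \<phi>0 B0"
    using injwv \<psi>(1) wvW(1) unfolding \<phi>0_def by (auto simp: inj_on_def)
  have "\<forall>b\<in>B0. \<exists>a. a \<in> A \<and> Rt.children a = {} \<and> par a = b"
    using g by (force simp: B0_def LP_def Rt.children_def)
  then obtain \<alpha> where \<alpha>: "\<And>b. b \<in> B0 \<Longrightarrow> \<alpha> b \<in> A \<and> Rt.children (\<alpha> b) = {} \<and> par (\<alpha> b) = b"
    by metis
  \<comment> \<open>A vertex of \<open>J\<close> has fewer than \<open>K\<close> blue neighbours in
    \<open>U2\<close>. Double counting shows that at most \<open>5 * K\<close> vertices of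
    \<open>U2\<close> are blue to more than a fifth of \<open>J\<close>.\<close>
  define bad where "bad = {p \<in> U2. card J < 5 * card {u \<in> J. blue p u}}"
  define Q where "Q = U2 - bad - W"
  define P1 where "P1 = {p \<in> U1 \<inter> P. \<forall>w\<in>W. red p (\<psi> w)}"
  define d where "d = n div 100000"
  \<comment> \<open>\<open>D\<close> has to exceed \<open>0.004 n + n / 10^5\<close>, which bounds
    the non-neighbours in \<open>P\<close> of an image of \<open>B\<close>, and to stay below the
    \<open>0.006 n\<close> undominated vertices even after the reserved leaves are
    discarded.\<close>
  define D where "D = n div 200"
  have dD: "real n / 10^6 \<le> real d" "real d \<le> real n / 10^5" "real n / 201 \<le> real D" "real D \<le> real n / 200"
  proof -
    have "100000 * d \<le> n" "n \<le> 100000 * d + 100000" "200 * D \<le> n" "n \<le> 200 * D + 200"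
      unfolding d_def D_def by linarith+
    then have "100000 * real d \<le> real n" "real n \<le> 100000 * real d + 100000" "200 * real D \<le> real n"
      "real n \<le> 200 * real D + 200" by linarith+
    then show "real n / 10^6 \<le> real d" "real d \<le> real n / 10^5" "real n / 201 \<le> real D" "real D \<le> real n / 200"
      using n_large by simp_all
  qed
  have cbad: "card bad \<le> 5 * K"
  proof (cases "J = {}")
    case True
    then show ?thesis by (simp add: bad_def)
  next
    case False
    then have J0: "card J > 0" using fin by (simp add: card_gt_0_iff)
    have finbad: "finite bad" using fin by (simp add: bad_def)
    have "card bad * card J \<le> (\<Sum>p\<in>bad. 5 * card {u \<in> J. blue p u})"
      using sum_bounded_below[of bad "card J" "\<lambda>p. 5 * card {u \<in> J. blue p u}"] by (force simp: bad_def)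
    also have "\<dots> \<le> (\<Sum>p\<in>U2. 5 * card {u \<in> J. blue p u})"
      using fin by (intro sum_mono2) (auto simp: bad_def)
    also have "\<dots> = 5 * (\<Sum>p\<in>U2. \<Sum>u\<in>J. if blue p u then 1 else 0)"
      using fin by (simp add: sum_distrib_left sum.If_cases Int_def)
    also have "\<dots> = 5 * (\<Sum>u\<in>J. \<Sum>p\<in>U2. if blue p u then 1 else 0)"
      by (subst sum.swap) (rule refl)
    also have "\<dots> = 5 * (\<Sum>u\<in>J. card {p \<in> U2. blue p u})" using fin by (simp add: sum.If_cases Int_def)
    also have "\<dots> = 5 * (\<Sum>u\<in>J. bdeg U2 u)"
    proof -
      have "{p \<in> U2. blue p u} = {p \<in> U2. blue u p}" for u using sym(2) by auto
      then show ?thesis by simp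
    qed
    also have "(\<Sum>u\<in>J. bdeg U2 u) \<le> card J * K"
      using sum_bounded_above[of J "bdeg U2" K] by (force simp: J_def mid_def)
    finally show ?thesis using J0 by simp
  qed
  have \<psi>Q: "\<phi>0 b \<in> V" "\<phi>0 b \<notin> P" "\<phi>0 b \<notin> W" if "b \<in> B0" for b
  proof -
    have "\<phi>0 b \<in> \<psi> ` W" using im\<psi> that by auto
    then show "\<phi>0 b \<in> V" "\<phi>0 b \<notin> P" "\<phi>0 b \<notin> W" using \<psi>(2,3) by auto
  qed
  have PQ: "P \<inter> Q = {}" using P(2) by (auto simp: Q_def)
  have blueP: "blue u q" if "\<not> red u q" "u \<noteq> q" for u q using col(1) that by blast
  have emb: "\<exists>f. inj_on f VT \<and> f ` VT \<subseteq> P \<union> Q \<union> \<phi>0 ` B0 \<union> wv ` B0 \<and>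
      (\<forall>t\<in>VT. t \<noteq> r \<longrightarrow> red (f (par t)) (f t))"
  proof (rule Rt.embedding_reserved_leaves[OF bipR r sym(1) B0B inj\<phi>0 \<alpha> injwv _ fin(3) _ _ PQ])
    show "red (\<phi>0 b) (wv b)" if "b \<in> B0" for b using \<psi>(4) wvW(1)[OF that] by (simp add: \<phi>0_def)
    show "finite Q" using fin by (simp add: Q_def)
    show "P1 \<subseteq> P" by (auto simp: P1_def)
    show "\<phi>0 ` B0 \<inter> P = {}" using im\<psi> \<psi>(3) by blast
    show "wv ` B0 \<inter> (P \<union> Q \<union> \<phi>0 ` B0) = {}" using imW im\<psi> \<psi>(3) W(2) by (auto simp: Q_def)
    show "red p (\<phi>0 b)" if "p \<in> P1" "b \<in> B0" for p b
      using that wvW(1) by (auto simp: P1_def \<phi>0_def)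
    show "card {q \<in> Q. \<not> red p q} \<le> d" if p: "p \<in> P1" for p
    proof -
      have p1: "p \<in> U1" "p \<notin> Q" using p PQ by (auto simp: P1_def)
      then have "{q \<in> Q. \<not> red p q} \<subseteq> {q \<in> U2. blue p q}" using blueP by (auto simp: Q_def)
      then have "card {q \<in> Q. \<not> red p q} \<le> bdeg U2 p" using fin by (intro card_mono) auto
      then show ?thesis using miss1(2)[OF p1(1)] dD by linarith
    qed
    show "card {p \<in> P1. \<not> red q p} \<le> d" if q: "q \<in> Q" for q
    proof -
      have q1: "q \<in> U2" "q \<notin> P1" using q PQ by (auto simp: P1_def Q_def)
      then have "{p \<in> P1. \<not> red q p} \<subseteq> {p \<in> U1. blue q p}" using blueP by (auto simp: P1_def)
      then have "card {p \<in> P1. \<not> red q p} \<le> bdeg U1 q" using fin by (intro card_mono) auto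
      then show ?thesis using miss2(2)[OF q1(1)] dD by linarith
    qed
    show "card B + card B0 + d \<le> card Q"
    proof -
      have "card U2 \<le> card (U2 - (bad \<union> W)) + card (bad \<union> W)"
        using diff_card_le_card_Diff[of "bad \<union> W" U2] fin by (simp add: bad_def)
      moreover have "U2 - (bad \<union> W) = Q" by (auto simp: Q_def)
      moreover have "card (bad \<union> W) \<le> 5 * K + 3000" using card_Un_le[of bad W] cbad W(3) by linarith
      ultimately have "card U2 \<le> card Q + (5 * K + 3000)" by simp
      then have "real (card U2) \<le> real (card Q) + (5 * real K + 3000)" by linarith
      then have "real (card B + card B0 + d) \<le> real (card Q)"
        using sizes(2) K_bounds(2) W(3) cB0 t2_le bip dD n_large by simp
      then show ?thesis by linarith
    qed
    show "card B + d \<le> card P1"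
    proof -
      have "U1 \<subseteq> (P1 \<union> (U1 - P)) \<union> (\<Union>w\<in>W. {u \<in> U1. blue (\<psi> w) u})"
      proof
        fix u assume u: "u \<in> U1"
        show "u \<in> (P1 \<union> (U1 - P)) \<union> (\<Union>w\<in>W. {u \<in> U1. blue (\<psi> w) u})"
        proof (rule ccontr)
          assume n: "\<not> ?thesis"
          then have "u \<in> P" using u by blast
          have "red u (\<psi> w)" if w: "w \<in> W" for w
          proof -
            have "\<psi> w \<noteq> u" using \<psi>(3) \<open>u \<in> P\<close> w by blast
            moreover have "\<not> blue (\<psi> w) u" using n w u by blast
            ultimately show ?thesis using col(1) sym(1) by blast
          qed
          then show False using n u \<open>u \<in> P\<close> by (auto simp: P1_def)
        qed
      qed
      moreover have "finite ((P1 \<union> (U1 - P)) \<union> (\<Union>w\<in>W. {u \<in> U1. blue (\<psi> w) u}))"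
        using fin by (auto simp: P1_def)
      ultimately have "card U1 \<le> card ((P1 \<union> (U1 - P)) \<union> (\<Union>w\<in>W. {u \<in> U1. blue (\<psi> w) u}))"
        by (rule card_mono[rotated])
      also have "\<dots> \<le> card P1 + card (U1 - P) + (\<Sum>w\<in>W. bdeg U1 (\<psi> w))"
        using card_Un_le[of P1 "U1 - P"] card_Un_le[of "P1 \<union> (U1 - P)" "\<Union>w\<in>W. {u \<in> U1. blue (\<psi> w) u}"]
          card_UN_le[OF fin(4), of "\<lambda>w. {u \<in> U1. blue (\<psi> w) u}"] by linarith
      finally have "real (card U1) \<le> real (card P1) + real (card (U1 - P)) + (\<Sum>w\<in>W. real (bdeg U1 (\<psi> w)))"
        by (simp flip: of_nat_sum of_nat_add)
      then have "real (card B + d) \<le> real (card P1)"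
        using sizes(1) P(5) \<psi>(5) t2_le bip dD n_large by simp
      then show ?thesis by linarith
    qed
    show "card {p \<in> P. \<not> red q p} \<le> D" if q: "q \<in> Q \<union> \<phi>0 ` B0" for q
    proof -
      have qP: "q \<notin> P" using q PQ \<psi>Q by auto
      have "real (bdeg U1 q) \<le> 0.004 * real n"
        using q
      proof
        assume "q \<in> Q"
        then show ?thesis using miss2(2)[of q] n_large by (simp add: Q_def)
      next
        assume "q \<in> \<phi>0 ` B0"
        then obtain w where "w \<in> W" "q = \<psi> w" using im\<psi> by auto
        then have "real (bdeg U1 q) \<le> (\<Sum>w\<in>W. real (bdeg U1 (\<psi> w)))"
          using fin member_le_sum[of w W "\<lambda>w. real (bdeg U1 (\<psi> w))"] by simp
        then show ?thesis using \<psi>(5) by linarith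
      qed
      moreover have "card {p \<in> P. \<not> red q p} \<le> bdeg U1 q + card (V - U1 - U2)"
      proof -
        have "{p \<in> P. \<not> red q p} \<subseteq> {u \<in> U1. blue q u} \<union> (V - U1 - U2)"
          using P(1,2) qP blueP[of q] by blast
        then have "card {p \<in> P. \<not> red q p} \<le> card ({u \<in> U1. blue q u} \<union> (V - U1 - U2))"
          using fin V by (intro card_mono) auto
        then show ?thesis using card_Un_le[of "{u \<in> U1. blue q u}" "V - U1 - U2"] by linarith
      qed
      ultimately have "real (card {p \<in> P. \<not> red q p}) \<le> real D" using sizes(3) dD n_large by simp
      then show ?thesis by linarith
    qed
    show "card A \<le> card B0 + card {u \<in> P. D < card {a \<in> A - \<alpha> ` B0. \<forall>b\<in>B. {a, b} \<in> Rt.edges \<longrightarrow> red u (\<phi> b)}}"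
      if \<phi>: "inj_on \<phi> B" "\<phi> ` B \<subseteq> Q \<union> \<phi>0 ` B0" "\<And>b. b \<in> B0 \<Longrightarrow> \<phi> b = \<phi>0 b" for \<phi>
    proof -
      define G where "G u = {a \<in> A - \<alpha> ` B0. \<forall>b\<in>B. {a, b} \<in> ET \<longrightarrow> red u (\<phi> b)}" for u
      define F where "F = {u \<in> J. card (G u) \<le> D}"
      have \<phi>P: "u \<noteq> \<phi> b" if "u \<in> P" "b \<in> B" for u b
      proof -
        have "\<phi> b \<in> Q \<union> \<phi>0 ` B0" using \<phi>(2) that(2) by auto
        moreover have "u \<notin> Q" using PQ that(1) by auto
        moreover have "u \<notin> \<phi>0 ` B0" using \<psi>Q(2) that(1) by auto
        ultimately show ?thesis by auto
      qed
      have finB0: "finite B0" using AB B0B finite_subset by blast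
      have split: "card X \<le> card (G u) + card W"
        if "X \<subseteq> A" "\<And>a b. a \<in> X \<Longrightarrow> b \<in> B \<Longrightarrow> {a, b} \<in> ET \<Longrightarrow> red u (\<phi> b)" for X u
      proof -
        have "X \<subseteq> G u \<union> \<alpha> ` B0" using that by (auto simp: G_def)
        then have "card X \<le> card (G u \<union> \<alpha> ` B0)" using AB finB0 by (intro card_mono) (auto simp: G_def)
        then show ?thesis
          using card_Un_le[of "G u" "\<alpha> ` B0"] card_image_le[OF finB0, of \<alpha>] cB0 by linarith
      qed
      \<comment> \<open>Fewer than \<open>\<kappa>\<close> images of \<open>B\<close> in
        \<open>U2\<close> are blue to \<open>u\<close>, and at most one image lies outside
        \<open>U2\<close>. Together these are at most \<open>\<kappa>0\<close>, so
        \<open>undom\<close> applies.\<close>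
      have good: "D < card (G u)" if u: "u \<in> P" "u \<notin> J" for u
      proof -
        define B' where "B' = {b \<in> B. blue u (\<phi> b)}"
        have "\<phi> ` B' \<subseteq> {q \<in> U2. blue u q} \<union> \<psi> ` {w \<in> W. \<psi> w \<notin> U2}"
        proof
          fix q assume "q \<in> \<phi> ` B'"
          then have q: "q \<in> Q \<union> \<psi> ` W" "blue u q" using \<phi>(2) im\<psi> by (auto simp: B'_def)
          then show "q \<in> {q \<in> U2. blue u q} \<union> \<psi> ` {w \<in> W. \<psi> w \<notin> U2}" by (auto simp: Q_def)
        qed
        then have "card (\<phi> ` B') \<le> card ({q \<in> U2. blue u q} \<union> \<psi> ` {w \<in> W. \<psi> w \<notin> U2})"
          using fin by (intro card_mono) auto
        also have "\<dots> \<le> bdeg U2 u + 1"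
          using card_Un_le[of "{q \<in> U2. blue u q}" "\<psi> ` {w \<in> W. \<psi> w \<notin> U2}"] \<psi>(6)
            card_image_le[of "{w \<in> W. \<psi> w \<notin> U2}" \<psi>] fin by simp
        also have "\<dots> \<le> \<kappa>0" using u P(4) \<kappa>_bounds(2) by (auto simp: J_def low_def)
        also have "card (\<phi> ` B') = card B'"
          using \<phi>(1) by (intro card_image) (auto simp: B'_def intro: inj_on_subset)
        finally have "0.006 * real n \<le> real (card {a \<in> A. \<forall>b\<in>B'. {a, b} \<notin> ET})"
          by (intro undom) (auto simp: B'_def)
        moreover have "card {a \<in> A. \<forall>b\<in>B'. {a, b} \<notin> ET} \<le> card (G u) + card W"
          using blueP \<phi>P[OF u(1)] by (intro split) (auto simp: B'_def)
        ultimately have "real D < real (card (G u))" using W(3) dD n_large by simp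
        then show ?thesis by linarith
      qed
      \<comment> \<open>Double counting of pairs of a vertex \<open>u\<close> in \<open>F\<close>
        and a tree edge whose end in \<open>B\<close> has an image blue to \<open>u\<close>. Each
        \<open>u\<close> accounts for at least \<open>0.65 n\<close> vertices of \<open>A\<close>,
        whereas an image in \<open>Q\<close> is blue to at most a fifth of \<open>J\<close> and the
        reserved images add only \<open>0.0003 n\<close> per vertex of \<open>J\<close>. Finally
        \<open>0.2003 / 0.65 < 1/3\<close>.\<close>
      have "3 * card F \<le> card J"
      proof -
        define N where "N u = {a \<in> A. \<exists>b\<in>B. {a, b} \<in> ET \<and> blue u (\<phi> b)}" for u
        define dg where "dg b = real (card {a. {a, b} \<in> ET})" for b
        have dgpos: "dg b \<ge> 0" for b by (simp add: dg_def)
        have dg\<Delta>: "dg b \<le> real n / 10^7" if "b \<in> B" for b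
          using card_neighbours_le_degree(2)[OF finite_tree(2), of b] T(4)[of b] that AB unfolding dg_def by force
        have big: "0.65 * real n \<le> real (card (N u))" if u: "u \<in> F" for u
        proof -
          have "u \<in> P" using u P(3) by (auto simp: F_def J_def)
          have "card (A - N u) \<le> card (G u) + card W"
            using blueP \<phi>P[OF \<open>u \<in> P\<close>] by (intro split) (auto simp: N_def)
          moreover have "card A = card (N u) + card (A - N u)"
            using AB by (subst card_Un_disjoint[symmetric]) (auto simp: N_def intro!: arg_cong[of _ _ card])
          moreover have "card (G u) \<le> D" using u by (simp add: F_def)
          ultimately have "t1 \<le> card (N u) + D + card W" using bip by linarith
          then have "real t1 \<le> real (card (N u)) + real D + real (card W)" by linarith
          then show ?thesis using bip(4) dD W(3) n_large by simp
        qed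
        have small: "real (card (N u)) \<le> (\<Sum>b\<in>B. if blue u (\<phi> b) then dg b else 0)" for u
        proof -
          let ?B = "{b \<in> B. blue u (\<phi> b)}"
          have "N u \<subseteq> (\<Union>b\<in>?B. {a. {a, b} \<in> ET})" by (auto simp: N_def)
          then have "card (N u) \<le> card (\<Union>b\<in>?B. {a. {a, b} \<in> ET})"
            using AB card_neighbours_le_degree(1)[OF finite_tree(2)] by (intro card_mono) auto
          also have "\<dots> \<le> (\<Sum>b\<in>?B. card {a. {a, b} \<in> ET})" using AB by (intro card_UN_le) auto
          finally have "real (card (N u)) \<le> (\<Sum>b\<in>?B. dg b)" by (simp add: dg_def flip: of_nat_sum)
          also have "\<dots> = (\<Sum>b\<in>B. if blue u (\<phi> b) then dg b else 0)"
            using AB by (simp add: sum.If_cases Int_def)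
          finally show ?thesis .
        qed
        have "0.65 * real n * real (card F) = (\<Sum>u\<in>F. 0.65 * real n)" by simp
        also have "\<dots> \<le> (\<Sum>u\<in>F. \<Sum>b\<in>B. if blue u (\<phi> b) then dg b else 0)"
          using big small order_trans by (intro sum_mono) blast
        also have "\<dots> \<le> (\<Sum>u\<in>J. \<Sum>b\<in>B. if blue u (\<phi> b) then dg b else 0)"
          using fin dgpos by (intro sum_mono2) (auto simp: F_def intro!: sum_nonneg)
        also have "\<dots> = (\<Sum>b\<in>B. \<Sum>u\<in>J. if blue u (\<phi> b) then dg b else 0)" by (rule sum.swap)
        also have "\<dots> = (\<Sum>b\<in>B. dg b * real (card {u \<in> J. blue u (\<phi> b)}))"
          using fin by (simp add: sum.If_cases Int_def mult.commute)
        also have "\<dots> \<le> (\<Sum>b\<in>B. dg b * (real (card J) / 5) + (if b \<in> B0 then real n / 10^7 * real (card J) else 0))"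
        proof (rule sum_mono)
          fix b assume b: "b \<in> B"
          have cJ: "card {u \<in> J. blue u (\<phi> b)} \<le> card J" using fin by (intro card_mono) auto
          show "dg b * real (card {u \<in> J. blue u (\<phi> b)}) \<le>
            dg b * (real (card J) / 5) + (if b \<in> B0 then real n / 10^7 * real (card J) else 0)"
          proof (cases "b \<in> B0")
            case True
            have "dg b * real (card {u \<in> J. blue u (\<phi> b)}) \<le> real n / 10^7 * real (card J)"
              using dg\<Delta>[OF b] cJ dgpos by (intro mult_mono) auto
            moreover have "0 \<le> dg b * (real (card J) / 5)" using dgpos by simp
            ultimately show ?thesis using True by simp
          next
            case False
            show ?thesis
            proof (cases "\<phi> b \<in> Q")
              case True
              then have "\<not> card J < 5 * card {u \<in> J. blue (\<phi> b) u}" by (auto simp: Q_def bad_def)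
              moreover have "{u \<in> J. blue (\<phi> b) u} = {u \<in> J. blue u (\<phi> b)}" using sym(2) by auto
              ultimately have "real (card {u \<in> J. blue u (\<phi> b)}) \<le> real (card J) / 5" by simp
              then have "dg b * real (card {u \<in> J. blue u (\<phi> b)}) \<le> dg b * (real (card J) / 5)"
                using dgpos by (intro mult_left_mono) auto
              then show ?thesis using \<open>b \<notin> B0\<close> by simp
            next
              case False
              have "\<phi> b \<in> Q \<union> \<phi>0 ` B0" using \<phi>(2) b by auto
              with False obtain b' where b': "b' \<in> B0" "\<phi> b = \<phi>0 b'" by auto
              then have "b = b'" using \<phi>(1,3) B0B b by (metis inj_onD subsetD)
              then show ?thesis using \<open>b \<notin> B0\<close> b' by simp
            qed
          qed
        qed
        also have "\<dots> = (\<Sum>b\<in>B. dg b) * (real (card J) / 5) + real (card B0) * (real n / 10^7 * real (card J))"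
        proof -
          have "B \<inter> {b. b \<in> B0} = B0" using B0B by blast
          then show ?thesis using AB by (simp add: sum.distrib sum_distrib_right sum.If_cases)
        qed
        also have "\<dots> \<le> real n * (real (card J) / 5) + 3000 * (real n / 10^7 * real (card J))"
        proof -
          have "(\<Sum>b\<in>B. dg b) \<le> real n"
            using of_nat_mono[OF sum_degrees_le, where 'a = real] by (simp add: dg_def)
          moreover have "real (card B0) \<le> 3000" using cB0 W(3) by simp
          ultimately show ?thesis by (intro add_mono mult_right_mono) auto
        qed
        finally have "real (card F) * 0.65 * real n \<le> 0.2003 * real (card J) * real n" by (simp add: algebra_simps)
        then have "real (card F) * 0.65 \<le> 0.2003 * real (card J)"
          by (rule mult_right_le_imp_le) (use n_large in simp)
        then have "3 * real (card F) \<le> real (card J)" by simp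
        then show ?thesis by linarith
      qed
      moreover have "P - F \<subseteq> {u \<in> P. D < card (G u)}" using good by (auto simp: F_def not_le)
      then have "card (P - F) \<le> card {u \<in> P. D < card (G u)}" using fin by (intro card_mono) auto
      moreover have "card P - card F \<le> card (P - F)"
        using fin by (intro diff_card_le_card_Diff) (auto simp: F_def)
      ultimately have "t1 \<le> card W + card {u \<in> P. D < card (G u)}" using size unfolding J_def by linarith
      then show ?thesis unfolding G_def R(2) cB0 bip(2) .
    qed
  qed
  then obtain f where f: "inj_on f VT" "f ` VT \<subseteq> P \<union> Q \<union> \<phi>0 ` B0 \<union> wv ` B0"
    "\<forall>t\<in>VT. t \<noteq> r \<longrightarrow> red (f (par t)) (f t)" by blast
  have "P \<union> Q \<union> \<phi>0 ` B0 \<union> wv ` B0 \<subseteq> V"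
    using P(1) W(1) V(3) \<psi>(2) unfolding im\<psi> imW Q_def by blast
  then have "f ` VT \<subseteq> V" using f(2) by (rule subset_trans[rotated])
  then have "embeds red VT Rt.edges V" using sym(1) f by (intro Rt.embedsI[of red f]) blast+
  then show False using none(1) R(2) by simp
qed

end

section \<open>The final count on the two sides\<close>

context counterexample_dom
begin

lemma low_mid_avoids: "(low U2 \<union> mid U1 U2) \<inter> U2 = {}"
proof -
  interpret sw: counterexample_dom V U2 U1 red blue VT ET A B n t1 t2 \<kappa>0 H by (rule swapped_dom)
  show ?thesis using sw.bdeg_own_K(1) \<kappa>_bounds(1) by (force simp: low_def mid_def)
qed

lemma card_U1_diff: "card (U1 - (low U2 \<union> mid U1 U2)) \<le> 2000"
proof -
  have "U1 - (low U2 \<union> mid U1 U2) \<subseteq> cap U1 U2"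
    using bdeg_own_K(1) V(2) by (auto simp: low_def cap_def not_less)
  then have "card (U1 - (low U2 \<union> mid U1 U2)) \<le> card (cap U1 U2)"
    using V by (intro card_mono) (auto simp: cap_def)
  then show ?thesis using card_cap by linarith
qed

lemma mid_commute: "mid U2 U1 = mid U1 U2"
  by (auto simp: mid_def)

text \<open>Otherwise a red copy exists with the vertices of \<open>cap\<close> counted here as
  \<open>W\<close>. Each of them has at least \<open>K - 1\<close> red neighbours in
  \<open>U2\<close>, which is at least 3000, so distinct images for the parents of the reserved
  leaves can be chosen.\<close>

lemma side_small:
  "card (low U2 \<union> mid U1 U2) + card {v \<in> cap U1 U2 \<union> cap U2 U1. bdeg U2 v + K \<le> card U2}
    < t1 + card (mid U1 U2) div 3"
proof (rule ccontr)
  interpret sw: counterexample_dom V U2 U1 red blue VT ET A B n t1 t2 \<kappa>0 H by (rule swapped_dom)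
  define W where "W = {v \<in> cap U1 U2 \<union> cap U2 U1. bdeg U2 v + K \<le> card U2}"
  assume "\<not> ?thesis"
  then have size: "t1 + card (mid U1 U2) div 3 \<le> card W + card (low U2 \<union> mid U1 U2)" by (simp add: W_def)
  have WV: "W \<subseteq> V" "finite W" using V(1) by (auto simp: W_def cap_def)
  have "card W \<le> card (cap U1 U2 \<union> cap U2 U1)"
    using V(1) by (intro card_mono) (auto simp: W_def cap_def)
  then have cW: "card W \<le> 3000" using card_Un_le[of "cap U1 U2" "cap U2 U1"] card_cap sw.card_cap by linarith
  have fU: "finite U2" using V finite_subset by blast
  have "\<exists>\<psi>. inj_on \<psi> W \<and> (\<forall>w\<in>W. \<psi> w \<in> {u \<in> U2. red u w})"
  proof (rule injective_choice[OF WV(2)])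
    show "card W \<le> card {u \<in> U2. red u w}" if w: "w \<in> W" for w
    proof -
      have "U2 \<subseteq> insert w ({u \<in> U2. red u w} \<union> {u \<in> U2. blue w u})"
      proof
        fix q assume "q \<in> U2"
        then show "q \<in> insert w ({u \<in> U2. red u w} \<union> {u \<in> U2. blue w u})"
          using col(1)[of w q] sym(1)[of w q] by (cases "q = w") auto
      qed
      then have "card U2 \<le> card (insert w ({u \<in> U2. red u w} \<union> {u \<in> U2. blue w u}))"
        using fU by (intro card_mono) auto
      also have "\<dots> \<le> Suc (card {u \<in> U2. red u w} + bdeg U2 w)"
        using fU card_Un_le[of "{u \<in> U2. red u w}" "{u \<in> U2. blue w u}"] by (simp add: card_insert_if)
      finally have "K \<le> Suc (card {u \<in> U2. red u w})" using w by (simp add: W_def)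
      moreover have "real 3001 \<le> real K" using K_bounds n_large by simp
      ultimately show ?thesis using cW by linarith
    qed
  qed (use fU in auto)
  then obtain \<psi> where \<psi>: "inj_on \<psi> W" "\<And>w. w \<in> W \<Longrightarrow> \<psi> w \<in> U2 \<and> red (\<psi> w) w" by blast
  have WU: "W \<inter> U2 = {}" using sw.bdeg_own_K(2) by (force simp: W_def)
  show False
  proof (rule red_embedding[OF _ low_mid_avoids _ _ card_U1_diff WV(1) _ cW \<psi>(1)])
    show "low U2 \<union> mid U1 U2 \<subseteq> V" by (auto simp: low_def mid_def)
    show "W \<inter> (low U2 \<union> mid U1 U2) = {}"
      using \<kappa>_bounds(1) by (auto simp: W_def cap_def low_def mid_def)
    show "\<psi> ` W \<subseteq> V" using \<psi> V by auto
    show "\<psi> ` W \<inter> (low U2 \<union> mid U1 U2 \<union> W) = {}" using \<psi>(2) low_mid_avoids WU by blast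
    show "red (\<psi> w) w" if "w \<in> W" for w using \<psi>(2)[OF that] by simp
    show "(\<Sum>w\<in>W. real (bdeg U1 (\<psi> w))) \<le> 0.004 * real n"
    proof -
      have "(\<Sum>w\<in>W. real (bdeg U1 (\<psi> w))) \<le> real (card W) * (real n / 10^6)"
        using sum_bounded_above[of W "\<lambda>w. real (bdeg U1 (\<psi> w))" "real n / 10^6"] miss2(2) \<psi>(2) by simp
      also have "\<dots> \<le> 3000 * (real n / 10^6)" using cW by (intro mult_right_mono) auto
      finally show ?thesis by simp
    qed
    have e: "{w \<in> W. \<psi> w \<notin> U2} = {}" using \<psi>(2) by blast
    show "card {w \<in> W. \<psi> w \<notin> U2} \<le> 1" unfolding e by simp
  qed (use size in auto)
qed

text \<open>If \<open>low U2\<close> is one vertex too small for \<open>A\<close>, then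
  \<open>x\<close> provides the missing place: it receives a leaf whose parent is sent to
  \<open>p\<close>. As \<open>p\<close> may lie outside \<open>U2\<close>, this is the case for
  which the red embedding tolerates one such image.\<close>

lemma single_red_edge:
  assumes "mid U1 U2 = {}" "t1 \<le> 1 + card (low U2)" "x \<in> V" "p \<in> V" "x \<notin> low U2" "p \<notin> low U2"
    "bdeg U1 p < \<kappa>"
  shows "\<not> red p x"
proof
  assume red: "red p x"
  show False
  proof (rule red_embedding[of "low U2" "{x}" "\<lambda>_. p"])
    show "low U2 \<inter> U2 = {}" using low_mid_avoids by blast
    show "card (U1 - low U2) \<le> 2000" using card_U1_diff assms(1) by simp
    show "(\<Sum>w\<in>{x}. real (bdeg U1 p)) \<le> 0.004 * real n" using assms(7) \<kappa>_bounds(1) K_bounds(2) n_large by simp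
    show "(\<lambda>_. p) ` {x} \<inter> (low U2 \<union> {x}) = {}" using assms(6) red col(2) by auto
    show "card {w \<in> {x}. p \<notin> U2} \<le> 1" using card_mono[of "{x}" "{w \<in> {x}. p \<notin> U2}"] by auto
  qed (use assms red in \<open>auto simp: low_def\<close>)
qed

lemma contradiction: False
proof -
  interpret sw: counterexample_dom V U2 U1 red blue VT ET A B n t1 t2 \<kappa>0 H by (rule swapped_dom)
  define M where "M = mid U1 U2"
  define X1 where "X1 = low U2 \<union> M"
  define X2 where "X2 = low U1 \<union> M"
  define C1 where "C1 = {v \<in> cap U1 U2 \<union> cap U2 U1. bdeg U2 v + K \<le> card U2}"
  define C2 where "C2 = {v \<in> cap U1 U2 \<union> cap U2 U1. bdeg U1 v + K \<le> card U1}"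
  have s1: "card X1 + card C1 < t1 + card M div 3" using side_small by (simp add: X1_def C1_def M_def)
  have s2: "card X2 + card C2 < t1 + card M div 3"
    using sw.side_small by (simp add: X2_def C2_def M_def mid_commute Un_commute)
  have fin: "finite X1" "finite X2" "finite C1" "finite C2" "finite M"
    using V(1) by (auto simp: X1_def X2_def C1_def C2_def M_def low_def mid_def cap_def)
  have cover: "V \<subseteq> X1 \<union> X2 \<union> (cap U1 U2 \<union> cap U2 U1)"
    by (auto simp: X1_def X2_def M_def low_def mid_def cap_def not_less)
  show False
  proof (cases "\<exists>w\<in>V. card U1 < bdeg U1 w + K \<and> card U2 < bdeg U2 w + K")
    case False
    then have "cap U1 U2 \<union> cap U2 U1 \<subseteq> C1 \<union> C2" by (auto simp: C1_def C2_def cap_def not_less)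
    then have "V \<subseteq> (X1 \<union> C1) \<union> (X2 \<union> C2)" using cover by blast
    then have "card V \<le> card ((X1 \<union> C1) \<union> (X2 \<union> C2))" using fin by (intro card_mono) auto
    \<comment> \<open>\<open>M\<close> is counted on both sides, so the sizes add up to at least
      \<open>2 * t1 - 1 + card M\<close>. By \<open>s1\<close> and \<open>s2\<close> they add up to
      at most \<open>2 * t1 - 2\<close> plus two thirds of \<open>card M\<close>.\<close>
    moreover have "card M \<le> card ((X1 \<union> C1) \<inter> (X2 \<union> C2))"
      using fin by (intro card_mono) (auto simp: X1_def X2_def)
    moreover have "card (X1 \<union> C1) + card (X2 \<union> C2) =
        card ((X1 \<union> C1) \<union> (X2 \<union> C2)) + card ((X1 \<union> C1) \<inter> (X2 \<union> C2))"
      using fin by (intro card_Un_Int) auto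
    ultimately have "card V + card M \<le> card X1 + card C1 + (card X2 + card C2)"
      using card_Un_le[of X1 C1] card_Un_le[of X2 C2] by linarith
    then show False using s1 s2 cardV(1) by linarith
  next
    case True
    then obtain w where w: "w \<in> V" "card U1 < bdeg U1 w + K" "card U2 < bdeg U2 w + K" by blast
    have "cap U1 U2 \<union> cap U2 U1 \<subseteq> {w}"
      using strong_unique[OF w] sw.strong_unique[OF w(1,3,2)] by blast
    then have "V \<subseteq> insert w (X1 \<union> X2)" using cover by blast
    then have "card V \<le> card (insert w (X1 \<union> X2))" using fin by (intro card_mono) auto
    also have "\<dots> \<le> Suc (card (X1 \<union> X2))" using fin by (simp add: card_insert_if)
    finally have cV: "card V \<le> Suc (card (X1 \<union> X2))" .
    have UI: "card X1 + card X2 = card (X1 \<union> X2) + card (X1 \<inter> X2)" using fin by (intro card_Un_Int) auto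
    have "card M \<le> card (X1 \<inter> X2)" using fin by (intro card_mono) (auto simp: X1_def X2_def)
    \<comment> \<open>Now \<open>w\<close> is the only vertex not counted, and the previous estimate
      becomes tight. It forces \<open>M\<close> to be empty, both sides to be disjoint of size
      \<open>t1 - 1\<close>, and \<open>V\<close> to have \<open>2 * t1 - 1\<close>
      vertices.\<close>
    then have "card M = 0" using cV UI s1 s2 cardV(1) by linarith
    then have M0: "M = {}" using fin by simp
    then have cX: "card X1 \<le> t1 - 1" "card X2 \<le> t1 - 1" "t1 \<ge> 1" using s1 s2 by auto
    have "card (X1 \<inter> X2) = 0" "t1 \<le> card X1 + 1" "t1 \<le> card X2 + 1" "card V + 1 \<le> 2 * t1"
      using cX cV UI cardV(1) by linarith+
    then have dis: "X1 \<inter> X2 = {}" using fin by simp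
    have X: "X1 = low U2" "X2 = low U1" using M0 by (auto simp: X1_def X2_def)
    have m: "mid U1 U2 = {}" "mid U2 U1 = {}" using M0 mid_commute by (auto simp: M_def)
    have "real (card U1) < real (bdeg U1 w) + real K" "real (card U2) < real (bdeg U2 w) + real K"
      using w by linarith+
    then have "real K \<le> real (bdeg U1 w)" "real K \<le> real (bdeg U2 w)"
      using K_bounds sizes n_large by simp_all
    then have wX: "w \<notin> X1 \<union> X2" using \<kappa>_bounds(1) by (auto simp: X low_def)
    have lowV: "u \<in> V" "bdeg U u < \<kappa>" if "u \<in> low U" for u U using that by (auto simp: low_def)
    \<comment> \<open>A red edge at \<open>p\<close> inside \<open>insert w X1\<close> would allow
      \<open>A\<close> to be placed on the opposite set \<open>X2\<close>, with \<open>x\<close> as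
      the additional vertex.\<close>
    have red1: "\<not> red p x" if px: "p \<in> X1" "x \<in> insert w X1" for p x
    proof (rule sw.single_red_edge[OF m(2)])
      show "t1 \<le> 1 + card (low U1)" using \<open>t1 \<le> card X2 + 1\<close> by (simp add: X)
      show "x \<in> V" "p \<in> V" using px w(1) lowV(1) by (auto simp: X)
      show "x \<notin> low U1" "p \<notin> low U1" using px dis wX by (auto simp: X)
      show "bdeg U2 p < \<kappa>" using px lowV(2) by (simp add: X)
    qed
    have red2: "\<not> red p x" if px: "p \<in> X2" "x \<in> insert w X2" for p x
    proof (rule single_red_edge[OF m(1)])
      show "t1 \<le> 1 + card (low U2)" using \<open>t1 \<le> card X1 + 1\<close> by (simp add: X)
      show "x \<in> V" "p \<in> V" using px w(1) lowV(1) by (auto simp: X)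
      show "x \<notin> low U2" "p \<notin> low U2" using px dis wX by (auto simp: X)
      show "bdeg U1 p < \<kappa>" using px lowV(2) by (simp add: X)
    qed
    have "embeds blue VT ET (insert w (X1 \<union> X2))"
    proof (rule embedding_two_cliques[OF T(1,2), of t1])
      \<comment> \<open>The bound \<open>t1 + 2 * t2 <= card V + 1\<close> enters here: as
        \<open>V\<close> has only \<open>2 * t1 - 1\<close> vertices, it gives
        \<open>2 * t2 <= t1\<close>.\<close>
      show "2 * n \<le> 3 * t1" using n_eq cardV(2) \<open>card V + 1 \<le> 2 * t1\<close> by linarith
      have "real 4 \<le> real t1" using bip(4) n_large by simp
      then show "4 \<le> t1" by linarith
      show "blue u v" if "u \<in> X1" "v \<in> X1" "u \<noteq> v" for u v using red1[of u v] col(1) that by blast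
      show "blue u v" if "u \<in> X2" "v \<in> X2" "u \<noteq> v" for u v using red2[of u v] col(1) that by blast
      show "blue w u" if u: "u \<in> X1 \<union> X2" for u
      proof -
        have "\<not> red u w" using u red1 red2 by blast
        moreover have "u \<noteq> w" using u wX by blast
        ultimately show ?thesis using col(1) sym by blast
      qed
    qed (use fin dis wX n_eq sym \<open>t1 \<le> card X1 + 1\<close> \<open>t1 \<le> card X2 + 1\<close> in auto)
    moreover have "insert w (X1 \<union> X2) \<subseteq> V" using w(1) by (auto simp: X low_def)
    ultimately show False using none(2) embeds_mono[of blue VT ET "insert w (X1 \<union> X2)" V] by simp
  qed
qed

end

lemma (in counterexample) inconsistent: False
proof -
  obtain \<kappa>0 H where "finite H" "card H + 2 \<le> \<kappa>0"
    "real (card {a \<in> A. \<forall>h\<in>H. {a, h} \<notin> ET}) \<le> 0.011 * real n"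
    "\<And>B'. B' \<subseteq> B \<Longrightarrow> card B' \<le> \<kappa>0 \<Longrightarrow> 0.006 * real n \<le> real (card {a \<in> A. \<forall>b\<in>B'. {a, b} \<notin> ET})"
    by (rule domination) (rule that)
  then interpret counterexample_dom V U1 U2 red blue VT ET A B n t1 t2 \<kappa>0 H
    by unfold_locales
  show False by (rule contradiction)
qed

section \<open>From the colouring to the setting with fixed constants\<close>

lemma has_mono_copyI:
  assumes "embeds (\<lambda>u v. u \<noteq> v \<and> col {u, v} = k) VT ET V" "fin_graph VT ET"
  shows "has_mono_copy V col VT ET"
proof -
  obtain f where f: "inj_on f VT" "f ` VT \<subseteq> V"
    "\<forall>u v. {u, v} \<in> ET \<longrightarrow> f u \<noteq> f v \<and> col {f u, f v} = k"
    using assms(1) unfolding embeds_def by (elim exE conjE) (rule that)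
  have "col (f ` e) = k" if e: "e \<in> ET" for e
  proof -
    obtain u v where "e = {u, v}" using e assms(2) by (auto simp: fin_graph_def nsets_def card_2_iff)
    then show ?thesis using f(3) e by auto
  qed
  with f(1,2) show ?thesis unfolding has_mono_copy_def by (intro exI[of _ k] exI[of _ f] conjI ballI)
qed

text \<open>Since \<open>t2\<close> is at most slightly more than \<open>t1 / 2\<close>, both
  \<open>t1 + 2 * t2\<close> and \<open>2 * t1\<close> are at most about \<open>2 * t1\<close>.
  Hence \<open>U1\<close> and \<open>U2\<close>, of order almost \<open>t1\<close> each, cover
  nearly all of \<open>V\<close>, and \<open>t1\<close> is at least almost
  \<open>2 * n / 3\<close>.\<close>

lemma mono_copy_of_witness:
  fixes V :: "'a set" and VT :: "'b set" and \<mu> :: real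
  assumes \<mu>: "0 < \<mu>" "\<mu> \<le> 1 / 10^6" and n: "10^9 \<le> n" "t1 + t2 = n" "(2 - \<mu>) * real t2 \<le> real t1"
    and V: "finite V" "card V = max (t1 + 2 * t2) (2 * t1) - 1"
    and W: "typeII_witness \<mu> t1 t2 V col k k' U1 U2" and k: "k \<noteq> k'"
    and T: "tree VT ET" "card VT = n" "real (max_degree VT ET) \<le> real n / 10^7"
    and bip: "bipartition VT ET A B" "card A = t1" "card B = t2"
  shows "has_mono_copy V col VT ET"
proof (rule ccontr)
  assume no: "\<not> has_mono_copy V col VT ET"
  define red where "red u v \<longleftrightarrow> u \<noteq> v \<and> col {u, v} = k" for u v
  define blue where "blue u v \<longleftrightarrow> u \<noteq> v \<and> col {u, v} = k'" for u v
  have U: "U1 \<subseteq> V" "U2 \<subseteq> V" "U1 \<inter> U2 = {}" "(1 - \<mu>) * real t1 \<le> real (card U1)" "(1 - \<mu>) * real t1 \<le> real (card U2)"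
    using W by (auto simp: typeII_witness_def)
  have cd: "col_degree col k u S = card {q \<in> S. red u q}" "col_degree col k' u S = card {q \<in> S. blue u q}" for u S
    by (auto simp: col_degree_def red_def blue_def intro!: arg_cong[of _ _ card])
  have n0: "10^9 \<le> real n" using of_nat_mono[OF n(1), where 'a = real] by simp
  have nt: "real n = real t1 + real t2" using n(2) by simp
  have "\<mu> * real t2 \<le> 1 / 10^6 * real t2" by (intro mult_right_mono) (use \<mu> in auto)
  then have t2: "1.999999 * real t2 \<le> real t1" using n(3) by (simp add: left_diff_distrib)
  have "\<mu> * real t1 \<le> 1 / 10^6 * real t1" by (intro mult_right_mono) (use \<mu> in auto)
  then have cU: "0.999999 * real t1 \<le> real (card U1)" "0.999999 * real t1 \<le> real (card U2)"
    using U(4,5) by (simp_all add: left_diff_distrib)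
  have \<mu>n: "\<mu> * real (t1 + t2) \<le> real n / 10^6"
    using mult_right_mono[OF \<mu>(2), of "real n"] n(2) by simp
  have miss: "u \<in> U1 \<Longrightarrow> real (card {q \<in> U1. red u q}) \<le> real n / 10^6"
    "u \<in> U1 \<Longrightarrow> real (card {q \<in> U2. blue u q}) \<le> real n / 10^6"
    "u \<in> U2 \<Longrightarrow> real (card {q \<in> U2. red u q}) \<le> real n / 10^6"
    "u \<in> U2 \<Longrightarrow> real (card {q \<in> U1. blue u q}) \<le> real n / 10^6" for u
    using W \<mu>n unfolding typeII_witness_def cd by force+
  have fg: "fin_graph VT ET" using T(1) by (simp add: tree_def)
  have deg: "real (degree ET v) \<le> real n / 10^7" if "v \<in> VT" for v
  proof -
    have "degree ET v \<le> max_degree VT ET"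
      using that fg by (auto simp: max_degree_def fin_graph_def)
    then show ?thesis using T(3) by linarith
  qed
  have finU: "finite U1" "finite U2" using U V finite_subset by blast+
  have cW: "real (card (V - U1 - U2)) = real (card V) - real (card U1) - real (card U2)"
  proof -
    have "card V = card (V - U1 - U2) + card (U1 \<union> U2)"
      using U V(1) by (subst card_Un_disjoint[symmetric]) (auto simp: finU intro!: arg_cong[of _ _ card])
    moreover have "card (U1 \<union> U2) = card U1 + card U2" using U(3) finU by (rule card_Un_disjoint[rotated 2])
    ultimately show ?thesis by linarith
  qed
  have cV: "2 * t1 \<le> card V + 1" "t1 + 2 * t2 \<le> card V + 1" using V(2) by linarith+
  have cV': "real (card V) \<le> real t1 + 2 * real t2 \<or> real (card V) \<le> 2 * real t1"
    using V(2) by linarith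
  interpret counterexample V U1 U2 red blue VT ET A B n t1 t2
  proof unfold_locales
    show "0.666 * real n \<le> real (card U1)" "0.666 * real n \<le> real (card U2)" "0.666 * real n \<le> real t1"
      using cU t2 nt n0 by simp_all
    show "real (card (V - U1 - U2)) \<le> real n / 10^5" using cW cU cV' t2 nt n0 by auto
    have "real (card V) \<le> real (3 * n)" using cV' nt by auto
    then show "card V \<le> 3 * n" by linarith
    show "red u v \<or> blue u v" if "u \<noteq> v" for u v
      using k that by (cases "col {u, v}"; cases k; cases k') (auto simp: red_def blue_def)
    show "\<not> embeds red VT ET V" using no has_mono_copyI[OF _ fg] unfolding red_def by blast
    show "\<not> embeds blue VT ET V" using no has_mono_copyI[OF _ fg] unfolding blue_def by blast
  qed (use V U T n bip cV deg miss k in \<open>auto simp: red_def blue_def insert_commute\<close>)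
  show False by (rule inconsistent)
qed

theorem theorem2p4:
  shows "\<exists>\<mu>\<^sub>0::real. \<mu>\<^sub>0 > 0 \<and> (\<forall>\<mu>::real. 0 < \<mu> \<and> \<mu> \<le> \<mu>\<^sub>0 \<longrightarrow>
          (\<exists>c\<^sub>0::real. c\<^sub>0 > 0 \<and> (\<forall>c::real. 0 < c \<and> c \<le> c\<^sub>0 \<longrightarrow>
            (\<exists>n\<^sub>0::nat. \<forall>n\<ge>n\<^sub>0. \<forall>t\<^sub>1 t\<^sub>2 :: nat.
               t\<^sub>1 + t\<^sub>2 = n \<and> real t\<^sub>1 \<ge> (2 - \<mu>) * real t\<^sub>2 \<longrightarrow>
               (\<forall>(V :: 'a set) (col :: 'a set \<Rightarrow> colour).
                  finite V \<and> card V = max (t\<^sub>1 + 2 * t\<^sub>2) (2 * t\<^sub>1) - 1 \<and>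
                  typeII_extremal \<mu> t\<^sub>1 t\<^sub>2 V col \<longrightarrow>
                  (\<forall>(VT :: 'b set) ET.
                     tree VT ET \<and> card VT = n \<and> real (max_degree VT ET) \<le> c * real n \<and>
                     (\<exists>A B. bipartition VT ET A B \<and> card A = t\<^sub>1 \<and> card B = t\<^sub>2) \<longrightarrow>
                     has_mono_copy V col VT ET))))))"
proof (intro exI[of _ "1 / 10^7 :: real"] exI[of _ "10^9 :: nat"] conjI allI impI;
    (elim conjE)?)
  \<comment> \<open>The thresholds are absolute: \<open>1 / 10^7\<close> serves both as
    \<open>\<mu>\<^sub>0\<close> and as \<open>c\<^sub>0\<close>, and \<open>10^9\<close> as
    \<open>n\<^sub>0\<close>.\<close>
  fix \<mu> c :: real and n t1 t2 :: nat and V :: "'a set" and col and VT :: "'b set" and ET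
  assume a: "0 < \<mu>" "\<mu> \<le> 1 / 10^7" "0 < c" "c \<le> 1 / 10^7" "10^9 \<le> n" "t1 + t2 = n" "(2 - \<mu>) * real t2 \<le> real t1"
    "finite V" "card V = max (t1 + 2 * t2) (2 * t1) - 1" "typeII_extremal \<mu> t1 t2 V col"
    "tree VT ET" "card VT = n" "real (max_degree VT ET) \<le> c * real n"
    "\<exists>A B. bipartition VT ET A B \<and> card A = t1 \<and> card B = t2"
  then obtain A B where AB: "bipartition VT ET A B" "card A = t1" "card B = t2" by blast
  have "c * real n \<le> 1 / 10^7 * real n" using a(4) by (intro mult_right_mono) auto
  then have deg: "real (max_degree VT ET) \<le> real n / 10^7" using a(13) by simp
  obtain k k' U1 U2 where "typeII_witness \<mu> t1 t2 V col k k' U1 U2" "k \<noteq> k'"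
    using a(10) unfolding typeII_extremal_def by auto
  then show "has_mono_copy V col VT ET"
    using mono_copy_of_witness[OF a(1) _ a(5,6,7,8,9) _ _ a(11,12) deg AB] a(2) by auto
qed simp_all

end
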